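(* Let $(Q,\mathfrak n,k)$ be a regular local ring, $\mathfrak a\subseteq\mathfrak n^2$ an ideal of $Q$, $R=Q/\mathfrak a$ with maximal ideal $\mathfrak m=\mathfrak n/\mathfrak a$, and $J$ an ideal of $Q$ containing $\mathfrak a$. If $I=J/\mathfrak a$ is a q.c.i. ideal of $R$, then $\nu(J)=\nu(\mathfrak a)+\operatorname{grade}_R(I)$.
   Context: $\nu(M)$ is the minimal number of generators of a finitely generated module. An ideal $I$ of a local ring $R$ with $\nu(I)=n$, minimal generating set $f_1,\dots,f_n$, Koszul complex $E$ on $f_1,\dots,f_n$ and $S=R/I$ is a quasi-complete intersection (q.c.i.) ideal if $\mathrm H_1(E)$ is a free $S$-module and the canonical homomorphism of graded $S$-algebras $\bigwedge^S_* \mathrm H_1(E)\to \mathrm H_*(E)$ is bijective. $\operatorname{grade}_R(I)$ is the maximal length of an $R$-regular sequence in $I$. *)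

theory Defs
  imports "HOL-Algebra.Algebra" "HOL-Library.Extended_Nat"
begin

definition local_ring_with :: "('a, 'b) ring_scheme \<Rightarrow> 'a set \<Rightarrow> bool" where
  "local_ring_with Q N \<longleftrightarrow> noetherian_ring Q \<and> cring Q \<and> maximalideal N Q \<and>
     (\<forall>M. maximalideal M Q \<longrightarrow> M = N)"

definition num_gens :: "('a, 'b) ring_scheme \<Rightarrow> 'a set \<Rightarrow> nat" where
  "num_gens R I = (LEAST n. \<exists>S. finite S \<and> S \<subseteq> I \<and> card S = n \<and> genideal R S = I)"

definition krull_dim :: "('a, 'b) ring_scheme \<Rightarrow> enat" where
  "krull_dim R = (SUP ps \<in> {ps. ps \<noteq> [] \<and> (\<forall>P \<in> set ps. primeideal P R) \<and> sorted_wrt (\<subset>) ps}.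
                    enat (length ps - 1))"

definition regular_local_ring :: "('a, 'b) ring_scheme \<Rightarrow> 'a set \<Rightarrow> bool" where
  "regular_local_ring Q N \<longleftrightarrow> local_ring_with Q N \<and> krull_dim Q = enat (num_gens Q N)"

definition regular_seq :: "('a, 'b) ring_scheme \<Rightarrow> 'a list \<Rightarrow> bool" where
  "regular_seq R xs \<longleftrightarrow> set xs \<subseteq> carrier R \<and> genideal R (set xs) \<noteq> carrier R \<and>
     (\<forall>i < length xs. \<forall>y \<in> carrier R.
        xs ! i \<otimes>\<^bsub>R\<^esub> y \<in> genideal R (set (take i xs)) \<longrightarrow> y \<in> genideal R (set (take i xs)))"

definition grade :: "('a, 'b) ring_scheme \<Rightarrow> 'a set \<Rightarrow> enat" where
  "grade R I = (SUP xs \<in> {xs. regular_seq R xs \<and> set xs \<subseteq> I}. enat (length xs))"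

text \<open>The Koszul complex on f_0,...,f_{n-1} is the exterior algebra on basis vectors e_0..e_{n-1};
  an element is a coefficient function on subsets T of {..<n} (coefficient of e_T, T listed
  increasingly).\<close>

definition kelems :: "('a, 'b) ring_scheme \<Rightarrow> nat \<Rightarrow> (nat set \<Rightarrow> 'a) set" where
  "kelems R n = {e. \<forall>T. (T \<subseteq> {..<n} \<longrightarrow> e T \<in> carrier R) \<and> (\<not> T \<subseteq> {..<n} \<longrightarrow> e T = \<zero>\<^bsub>R\<^esub>)}"

definition kdeg :: "('a, 'b) ring_scheme \<Rightarrow> nat \<Rightarrow> nat \<Rightarrow> (nat set \<Rightarrow> 'a) set" where
  "kdeg R n i = {e \<in> kelems R n. \<forall>T. card T \<noteq> i \<longrightarrow> e T = \<zero>\<^bsub>R\<^esub>}"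

definition rsign :: "('a, 'b) ring_scheme \<Rightarrow> nat \<Rightarrow> 'a \<Rightarrow> 'a" where
  "rsign R k x = (if even k then x else \<ominus>\<^bsub>R\<^esub> x)"

definition kzero :: "('a, 'b) ring_scheme \<Rightarrow> nat set \<Rightarrow> 'a" where
  "kzero R = (\<lambda>T. \<zero>\<^bsub>R\<^esub>)"

definition kone :: "('a, 'b) ring_scheme \<Rightarrow> nat set \<Rightarrow> 'a" where
  "kone R = (\<lambda>T. if T = {} then \<one>\<^bsub>R\<^esub> else \<zero>\<^bsub>R\<^esub>)"

text \<open>Koszul differential: d(e_T) = sum over j in T of (-1)^(number of t in T below j) f_j e_(T-{j}).\<close>
definition kdiff :: "('a, 'b) ring_scheme \<Rightarrow> (nat \<Rightarrow> 'a) \<Rightarrow> nat \<Rightarrow> (nat set \<Rightarrow> 'a) \<Rightarrow> nat set \<Rightarrow> 'a" where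
  "kdiff R f n e = (\<lambda>U. if U \<subseteq> {..<n} then
      (\<Oplus>\<^bsub>R\<^esub> j \<in> {..<n} - U. rsign R (card {t \<in> U. t < j}) (f j \<otimes>\<^bsub>R\<^esub> e (insert j U)))
    else \<zero>\<^bsub>R\<^esub>)"

text \<open>Exterior (wedge) product: e_S * e_T = (-1)^(#{(s,t) in S x T. t < s}) e_(S \<union> T) if disjoint.\<close>
definition kmult :: "('a, 'b) ring_scheme \<Rightarrow> (nat set \<Rightarrow> 'a) \<Rightarrow> (nat set \<Rightarrow> 'a) \<Rightarrow> nat set \<Rightarrow> 'a" where
  "kmult R a b = (\<lambda>W. \<Oplus>\<^bsub>R\<^esub> S \<in> Pow W.
      rsign R (card {(s, t). s \<in> S \<and> t \<in> W - S \<and> t < s}) (a S \<otimes>\<^bsub>R\<^esub> b (W - S)))"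

definition kcycles :: "('a, 'b) ring_scheme \<Rightarrow> (nat \<Rightarrow> 'a) \<Rightarrow> nat \<Rightarrow> nat \<Rightarrow> (nat set \<Rightarrow> 'a) set" where
  "kcycles R f n i = {e \<in> kdeg R n i. kdiff R f n e = kzero R}"

definition kbounds :: "('a, 'b) ring_scheme \<Rightarrow> (nat \<Rightarrow> 'a) \<Rightarrow> nat \<Rightarrow> nat \<Rightarrow> (nat set \<Rightarrow> 'a) set" where
  "kbounds R f n i = kdiff R f n ` kdeg R n (Suc i)"

definition kprod :: "('a, 'b) ring_scheme \<Rightarrow> (nat \<Rightarrow> nat set \<Rightarrow> 'a) \<Rightarrow> nat set \<Rightarrow> nat set \<Rightarrow> 'a" where
  "kprod R z T = foldr (\<lambda>j acc. kmult R (z j) acc) (sorted_list_of_set T) (kone R)"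

definition klincomb :: "('a, 'b) ring_scheme \<Rightarrow> (nat \<Rightarrow> nat set \<Rightarrow> 'a) \<Rightarrow> nat \<Rightarrow> nat \<Rightarrow> (nat set \<Rightarrow> 'a) \<Rightarrow> nat set \<Rightarrow> 'a" where
  "klincomb R z m i a = (\<lambda>W. \<Oplus>\<^bsub>R\<^esub> T \<in> {T. T \<subseteq> {..<m} \<and> card T = i}. a T \<otimes>\<^bsub>R\<^esub> kprod R z T W)"

definition kminus :: "('a, 'b) ring_scheme \<Rightarrow> (nat set \<Rightarrow> 'a) \<Rightarrow> (nat set \<Rightarrow> 'a) \<Rightarrow> nat set \<Rightarrow> 'a" where
  "kminus R a b = (\<lambda>T. a T \<ominus>\<^bsub>R\<^esub> b T)"

text \<open>I is q.c.i.: for a minimal generating set f_0..f_{n-1} of I with Koszul complex E,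
  H_1(E) is a free S = R/I-module (with basis the classes of cycles z_0..z_{m-1}) and the canonical
  map from the exterior algebra of H_1(E) over S to H(E) is bijective.  Since H_1(E) is free with
  that basis, the exterior power of degree i is S-free on the wedges z_T (|T| = i), so bijectivity
  in degree i says: the classes of the products z_T span H_i(E) over S (surjectivity) and are
  S-linearly independent (injectivity: an R-combination that is a boundary has all coefficients
  in I).  For i = 1 these two conditions are exactly freeness of H_1(E) with basis [z_j].\<close>
definition qci_ideal :: "('a, 'b) ring_scheme \<Rightarrow> 'a set \<Rightarrow> bool" where
  "qci_ideal R I \<longleftrightarrow> ideal I R \<and>
    (\<exists>f n. n = num_gens R I \<and> f ` {..<n} \<subseteq> I \<and> genideal R (f ` {..<n}) = I \<and>
      (\<exists>m z. (\<forall>j < m. z j \<in> kcycles R f n 1) \<and>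
        (\<forall>i. (\<forall>c \<in> kcycles R f n i. \<exists>a. (\<forall>T. a T \<in> carrier R) \<and>
                 kminus R c (klincomb R z m i a) \<in> kbounds R f n i) \<and>
             (\<forall>a. (\<forall>T. a T \<in> carrier R) \<longrightarrow> klincomb R z m i a \<in> kbounds R f n i \<longrightarrow>
                 (\<forall>T. T \<subseteq> {..<m} \<and> card T = i \<longrightarrow> a T \<in> I)))))"

end

theory Submission
  imports Defs
begin

text \<open>Let \<open>f\<close> be \<open>n\<close> minimal generators of \<open>I\<close>, \<open>E\<close> their Koszul complex and \<open>z\<^sub>1, \<dots>, z\<^sub>m\<close> cycles giving a
  basis of \<open>H\<^sub>1(E)\<close>. As \<open>H\<^sub>i(E)\<close> is the \<open>i\<close>-th exterior power of \<open>H\<^sub>1(E)\<close>, the top nonvanishing homology is in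
  degree \<open>m\<close>, so the grade of \<open>I\<close> is \<open>n - m\<close>. Lift \<open>f\<close> and \<open>z\<close> to \<open>Q\<close> and let \<open>h\<^sub>j\<close> be the sum of the \<open>z\<^sub>j\<^sub>s f\<^sub>s\<close>, an
  element of \<open>A\<close>. If the \<open>h\<^sub>j\<close> are independent modulo \<open>N A\<close>, they extend to minimal generators \<open>h, g\<close> of
  \<open>A\<close>, and then \<open>f, g\<close> are minimal generators of \<open>J\<close>, which gives the count.

  For the independence, let \<open>\<Sum>a\<^sub>j h\<^sub>j \<in> N A\<close> and let \<open>K\<close> be the Koszul complex of a regular system of
  parameters \<open>x\<close>. Its first homology over \<open>Q\<close> vanishes, and this yields a bivector \<open>w\<close> in \<open>K \<otimes> R\<close> with
  \<open>d w = \<Sum>f\<^sub>s \<rho>\<^sub>s\<close>, where \<open>d \<rho>\<^sub>s\<close> is the \<open>s\<close>-th coordinate of \<open>\<Sum>a\<^sub>j z\<^sub>j\<close>. The divided powers of \<open>w\<close> satisfy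
  \<open>d w\<^sup>(\<^sup>i\<^sup>) = w\<^sup>(\<^sup>i\<^sup>-\<^sup>1\<^sup>) d w\<close>, and freeness of \<open>H\<^sub>1(E)\<close> shows that if \<open>c w\<^sup>(\<^sup>i\<^sup>)\<close> is a boundary modulo \<open>I\<close>, so is
  \<open>c a\<^sub>j w\<^sup>(\<^sup>i\<^sup>-\<^sup>1\<^sup>)\<close>. Since \<open>w\<^sup>(\<^sup>i\<^sup>) = 0\<close> for large \<open>i\<close>, a power of \<open>a\<^sub>j\<close> lies in \<open>I + (x)\<close>, hence \<open>a\<^sub>j\<close> lies in the
  maximal ideal.\<close>

section \<open>Saturation at a prime ideal\<close>

text \<open>Factorials cannot be inverted, as the characteristic is arbitrary. So w is written as a
  sum of simple bivectors u v and its divided powers are read off from the product of the factors 1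
  + u v; simple bivectors have square zero, which makes the boundary formula valid over any ring.
  The bivector compares two expressions of the sum of the a_j h_j through x. One has coefficients in
  A, because the sum lies in N A. In the other the coefficients are combinations of f, because each
  sum of a_j z_js over j is a coefficient in a relation of the minimal generators f over R and hence
  lies in the maximal ideal. The difference is a relation of x over Q, hence a boundary, and modulo
  A only the second expression survives. Regularity is defined by chains of primes, so the vanishing
  of the first Koszul homology of x has to be extracted from Krull's principal ideal theorem. The
  grade is a supremum over regular sequences, which calls for the depth sensitivity of the Koszul
  complex. Localizations and residue rings are mostly avoided: statements hold modulo an ideal b of
  one ring, up to saturation.\<close>

locale noetherian_cring = noetherian_ring + cring

text \<open>The contraction to \<open>R\<close> of the extension of \<open>b\<close> to the localization at the prime \<open>M\<close>; it stands in
  for that localization throughout.\<close>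

definition saturation :: "('a, 'b) ring_scheme \<Rightarrow> 'a set \<Rightarrow> 'a set \<Rightarrow> 'a set" where
  "saturation R M b = {a \<in> carrier R. \<exists>s \<in> carrier R - M. s \<otimes>\<^bsub>R\<^esub> a \<in> b}"

text \<open>Zorn applies because the union of a chain of ideals is itself a member of the chain.
  Noetherian arguments below take this form, usually as a maximal counterexample.\<close>

lemma (in noetherian_cring) maximal_ideal_in_family:
  assumes "C \<noteq> {}" and "\<And>I. I \<in> C \<Longrightarrow> ideal I R"
  obtains M where "M \<in> C" and "\<And>I. I \<in> C \<Longrightarrow> M \<subseteq> I \<Longrightarrow> I = M"
proof -
  have "\<Union>D \<in> C" if "D \<noteq> {}" "subset.chain C D" for D
  proof -
    have "subset.chain {I. ideal I R} D" "D \<subseteq> C"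
      using that(2) assms(2) unfolding pred_on.chain_def by auto
    then show ?thesis using ideal_chain_is_trivial that(1) by blast
  qed
  then show ?thesis using subset_Zorn_nonempty[OF assms(1)] that by metis
qed

context cring
begin

lemma add_minus_cancel:
  "x \<in> carrier R \<Longrightarrow> y \<in> carrier R \<Longrightarrow> (x \<oplus> y) \<ominus> y = x"
  by algebra

lemma minus_add_cancel:
  "x \<in> carrier R \<Longrightarrow> y \<in> carrier R \<Longrightarrow> (x \<ominus> y) \<oplus> y = x"
  by algebra

lemma minus_eq_add_swap:
  assumes "a \<in> carrier R" "b \<in> carrier R" "c \<in> carrier R" "e \<in> carrier R"
    and "a \<ominus> e = b \<oplus> c"
  shows "a \<ominus> b = c \<oplus> e"
proof -
  have "a = (b \<oplus> c) \<oplus> e" using minus_add_cancel[of a e] assms by simp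
  also have "\<dots> = (c \<oplus> e) \<oplus> b" using assms(1-4) by (simp add: a_ac)
  finally show ?thesis using add_minus_cancel[of "c \<oplus> e" b] assms(1-4) by simp
qed

lemma add_principal_mem:
  assumes "ideal b R" "x \<in> carrier R"
  shows "a \<in> b <+>\<^bsub>R\<^esub> PIdl x \<longleftrightarrow> (\<exists>u\<in>b. \<exists>r\<in>carrier R. a = u \<oplus> r \<otimes> x)"
  unfolding set_add_def' cgenideal_def by auto

lemma ideal_sum_upper:
  assumes "ideal b R" "ideal c R"
  shows "b \<subseteq> b <+>\<^bsub>R\<^esub> c" "c \<subseteq> b <+>\<^bsub>R\<^esub> c"
proof -
  interpret b: ideal b R by fact
  interpret c: ideal c R by fact
  show "b \<subseteq> b <+>\<^bsub>R\<^esub> c"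
  proof
    fix a assume "a \<in> b"
    then have "a = a \<oplus> \<zero>" by (simp add: b.Icarr)
    then show "a \<in> b <+>\<^bsub>R\<^esub> c" unfolding set_add_def' using \<open>a \<in> b\<close> c.zero_closed by blast
  qed
  show "c \<subseteq> b <+>\<^bsub>R\<^esub> c"
  proof
    fix a assume "a \<in> c"
    then have "a = \<zero> \<oplus> a" by (simp add: c.Icarr)
    then show "a \<in> b <+>\<^bsub>R\<^esub> c" unfolding set_add_def' using \<open>a \<in> c\<close> b.zero_closed by blast
  qed
qed

lemma ideal_sum_least:
  assumes "ideal d R" "b \<subseteq> d" "c \<subseteq> d"
  shows "b <+>\<^bsub>R\<^esub> c \<subseteq> d"
proof -
  interpret d: ideal d R by fact
  show ?thesis unfolding set_add_def' using assms d.a_closed by blast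
qed

lemma add_principal_ideal:
  assumes "ideal b R" "x \<in> carrier R"
  shows "ideal (b <+>\<^bsub>R\<^esub> PIdl x) R" "b \<subseteq> b <+>\<^bsub>R\<^esub> PIdl x" "x \<in> b <+>\<^bsub>R\<^esub> PIdl x"
proof -
  have I: "ideal (PIdl x) R" using assms(2) by (rule cgenideal_ideal)
  show "ideal (b <+>\<^bsub>R\<^esub> PIdl x) R" using add_ideals[OF assms(1) I] .
  show "b \<subseteq> b <+>\<^bsub>R\<^esub> PIdl x" "x \<in> b <+>\<^bsub>R\<^esub> PIdl x"
    using ideal_sum_upper[OF assms(1) I] cgenideal_self[OF assms(2)] by auto
qed

lemma add_principal_least:
  assumes "ideal d R" "b \<subseteq> d" "x \<in> d"
  shows "b <+>\<^bsub>R\<^esub> PIdl x \<subseteq> d"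
  using ideal_sum_least[OF assms(1,2) cgenideal_minimal[OF assms(1,3)]] .

lemma genideal_insert:
  assumes "B \<subseteq> carrier R" "x \<in> carrier R"
  shows "Idl (insert x B) = Idl B <+>\<^bsub>R\<^esub> PIdl x"
proof
  have I: "ideal (Idl B) R" by (rule genideal_ideal[OF assms(1)])
  note A = add_principal_ideal[OF I assms(2)]
  have "insert x B \<subseteq> Idl B <+>\<^bsub>R\<^esub> PIdl x" using A(2,3) genideal_self[OF assms(1)] by blast
  then show "Idl (insert x B) \<subseteq> Idl B <+>\<^bsub>R\<^esub> PIdl x" using genideal_minimal[OF A(1)] by blast
  have J: "ideal (Idl (insert x B)) R" using assms by (intro genideal_ideal) auto
  have "insert x B \<subseteq> Idl (insert x B)" using assms by (intro genideal_self) auto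
  moreover have "Idl B \<subseteq> Idl (insert x B)" using genideal_minimal[OF J, of B] calculation by blast
  ultimately show "Idl B <+>\<^bsub>R\<^esub> PIdl x \<subseteq> Idl (insert x B)" using add_principal_least[OF J] by blast
qed

lemma primeideal_one_notin: "primeideal M R \<Longrightarrow> \<one> \<notin> M"
  using ideal.one_imp_carrier primeideal.I_notcarr primeideal.axioms(1) by metis

lemma primeideal_mult_notin:
  "primeideal M R \<Longrightarrow> s \<in> carrier R - M \<Longrightarrow> t \<in> carrier R - M \<Longrightarrow> s \<otimes> t \<in> carrier R - M"
  using primeideal.I_prime[of M R s t] by auto

lemma saturation_ideal:
  assumes "primeideal M R" "ideal b R"
  shows "ideal (saturation R M b) R"
proof -
  interpret b: ideal b R by fact
  show ?thesis
  proof (rule idealI[OF ring_axioms])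
    show "subgroup (saturation R M b) (add_monoid R)"
    proof (rule subgroup.intro)
      show "saturation R M b \<subseteq> carrier (add_monoid R)" by (auto simp: saturation_def)
      show "\<one>\<^bsub>add_monoid R\<^esub> \<in> saturation R M b"
        using primeideal_one_notin[OF assms(1)] b.zero_closed by (auto simp: saturation_def)
    next
      fix x y assume "x \<in> saturation R M b" "y \<in> saturation R M b"
      then obtain s t where s: "x \<in> carrier R" "y \<in> carrier R" "s \<in> carrier R - M" "t \<in> carrier R - M"
        "s \<otimes> x \<in> b" "t \<otimes> y \<in> b" by (auto simp: saturation_def)
      have "s \<in> carrier R" "t \<in> carrier R" using s by auto
      then have "(s \<otimes> t) \<otimes> (x \<oplus> y) = t \<otimes> (s \<otimes> x) \<oplus> s \<otimes> (t \<otimes> y)" using s(1,2) by algebra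
      then have "(s \<otimes> t) \<otimes> (x \<oplus> y) \<in> b" using s b.I_l_closed b.a_closed by auto
      then show "x \<otimes>\<^bsub>add_monoid R\<^esub> y \<in> saturation R M b"
        using s primeideal_mult_notin[OF assms(1) s(3,4)] by (auto simp: saturation_def)
    next
      fix x assume "x \<in> saturation R M b"
      then obtain s where s: "x \<in> carrier R" "s \<in> carrier R - M" "s \<otimes> x \<in> b"
        by (auto simp: saturation_def)
      have "s \<otimes> (\<ominus> x) = \<ominus> (s \<otimes> x)" using s by (simp add: r_minus)
      then have "s \<otimes> (\<ominus> x) \<in> b" using s b.a_inv_closed by auto
      then show "inv\<^bsub>add_monoid R\<^esub> x \<in> saturation R M b"
        using s by (auto simp: saturation_def a_inv_def[symmetric])
    qed
  next
    fix a x assume "a \<in> saturation R M b" "x \<in> carrier R"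
    then obtain s where s: "a \<in> carrier R" "s \<in> carrier R - M" "s \<otimes> a \<in> b" "x \<in> carrier R"
      by (auto simp: saturation_def)
    have "s \<otimes> (x \<otimes> a) = x \<otimes> (s \<otimes> a)" using s by (simp add: m_lcomm)
    then have "s \<otimes> (x \<otimes> a) \<in> b" using s b.I_l_closed by auto
    then show *: "x \<otimes> a \<in> saturation R M b" using s by (auto simp: saturation_def)
    show "a \<otimes> x \<in> saturation R M b" using * s by (simp add: m_comm)
  qed
qed

lemma saturation_upper:
  assumes "primeideal M R" "ideal b R"
  shows "b \<subseteq> saturation R M b"
proof
  fix a assume "a \<in> b"
  then have "a \<in> carrier R" "\<one> \<otimes> a \<in> b" using ideal.Icarr[OF assms(2)] by auto
  then show "a \<in> saturation R M b"
    using primeideal_one_notin[OF assms(1)] by (auto simp: saturation_def intro!: bexI[of _ \<one>])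
qed

lemma saturation_mono: "b \<subseteq> c \<Longrightarrow> saturation R M b \<subseteq> saturation R M c"
  by (auto simp: saturation_def)

lemma saturation_idem:
  assumes "primeideal M R" "ideal b R"
  shows "saturation R M (saturation R M b) = saturation R M b"
proof
  show "saturation R M (saturation R M b) \<subseteq> saturation R M b"
  proof
    fix a assume "a \<in> saturation R M (saturation R M b)"
    then obtain s t where s: "a \<in> carrier R" "s \<in> carrier R - M" "t \<in> carrier R - M" "t \<otimes> (s \<otimes> a) \<in> b"
      by (auto simp: saturation_def)
    then have "(t \<otimes> s) \<otimes> a \<in> b" by (simp add: m_assoc)
    then show "a \<in> saturation R M b"
      using primeideal_mult_notin[OF assms(1) s(3,2)] s(1) by (auto simp: saturation_def)
  qed
qed (rule saturation_upper[OF assms(1) saturation_ideal[OF assms]])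

lemma saturatedD:
  assumes "saturation R M b = b" "a \<in> carrier R" "s \<in> carrier R - M" "s \<otimes> a \<in> b"
  shows "a \<in> b"
  using assms unfolding saturation_def by blast

lemma prime_saturated:
  assumes "primeideal p R" "primeideal M R" "p \<subseteq> M"
  shows "saturation R M p = p"
proof
  show "saturation R M p \<subseteq> p"
    using assms primeideal.I_prime[OF assms(1)] by (auto simp: saturation_def)
  show "p \<subseteq> saturation R M p"
    using saturation_upper[OF assms(2)] primeideal.axioms(1)[OF assms(1)] by blast
qed


section \<open>Colon ideals and maximal annihilators\<close>

definition colon :: "'a set \<Rightarrow> 'a \<Rightarrow> 'a set" where
  "colon c t = {r \<in> carrier R. r \<otimes> t \<in> c}"

lemma colon_ideal:
  assumes "ideal c R" "t \<in> carrier R"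
  shows "ideal (colon c t) R"
proof -
  interpret c: ideal c R by fact
  show ?thesis
  proof (rule idealI[OF ring_axioms])
    show "subgroup (colon c t) (add_monoid R)"
    proof (rule subgroup.intro)
      fix x assume "x \<in> colon c t"
      then have x: "x \<in> carrier R" "x \<otimes> t \<in> c" by (auto simp: colon_def)
      have "(\<ominus> x) \<otimes> t = \<ominus> (x \<otimes> t)" using x assms(2) by algebra
      then show "inv\<^bsub>add_monoid R\<^esub> x \<in> colon c t"
        using x c.a_inv_closed by (auto simp: colon_def a_inv_def[symmetric])
    qed (use assms(2) c.a_closed c.zero_closed in \<open>auto simp: colon_def l_distr\<close>)
  next
    fix a x assume "a \<in> colon c t" "x \<in> carrier R"
    then have x: "a \<in> carrier R" "a \<otimes> t \<in> c" "x \<in> carrier R" by (auto simp: colon_def)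
    then show *: "x \<otimes> a \<in> colon c t"
      using assms(2) c.I_l_closed by (auto simp: colon_def m_assoc)
    show "a \<otimes> x \<in> colon c t" using * x by (simp add: m_comm)
  qed
qed

lemma colon_upper:
  assumes "ideal c R" "t \<in> carrier R"
  shows "c \<subseteq> colon c t"
  using assms ideal.I_r_closed[OF assms(1)] ideal.Icarr[OF assms(1)] by (auto simp: colon_def)

text \<open>Suppose r s kills t modulo c and s t is not in c. The annihilator of s t contains that
  of t, so by maximality they agree, and r lies in it.\<close>

lemma maximal_colon_prime:
  assumes c: "ideal c R" and t: "t \<in> carrier R" "t \<notin> c"
    and max: "\<And>u. u \<in> carrier R \<Longrightarrow> u \<notin> c \<Longrightarrow> colon c t \<subseteq> colon c u \<Longrightarrow> colon c u = colon c t"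
  shows "primeideal (colon c t) R"
proof (rule primeidealI[OF colon_ideal[OF c t(1)] is_cring])
  have "\<one> \<notin> colon c t" using t by (simp add: colon_def)
  then show "carrier R \<noteq> colon c t" using one_closed by blast
  fix r s assume rs: "r \<in> carrier R" "s \<in> carrier R" "r \<otimes> s \<in> colon c t"
  interpret c: ideal c R by fact
  show "r \<in> colon c t \<or> s \<in> colon c t"
  proof (cases "s \<otimes> t \<in> c")
    case True
    then show ?thesis using rs by (simp add: colon_def)
  next
    case False
    have "colon c t \<subseteq> colon c (s \<otimes> t)"
    proof
      fix y assume "y \<in> colon c t"
      then have y: "y \<in> carrier R" "y \<otimes> t \<in> c" by (auto simp: colon_def)
      have "y \<otimes> (s \<otimes> t) = s \<otimes> (y \<otimes> t)" using y rs t by algebra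
      then show "y \<in> colon c (s \<otimes> t)" using y rs c.I_l_closed by (auto simp: colon_def)
    qed
    then have "colon c (s \<otimes> t) = colon c t" using max False rs t by auto
    moreover have "r \<in> colon c (s \<otimes> t)" using rs t by (auto simp: colon_def m_assoc)
    ultimately show ?thesis by simp
  qed
qed

end

context noetherian_cring
begin

text \<open>Supplies associated primes of R/c: the annihilator of any nonzero class lies in a
  maximal annihilator, which is prime.\<close>

lemma exists_maximal_colon:
  assumes c: "ideal c R" and t: "t \<in> carrier R" "t \<notin> c"
  obtains u where "u \<in> carrier R" "u \<notin> c" "colon c t \<subseteq> colon c u" "primeideal (colon c u) R"
    "\<And>v. v \<in> carrier R \<Longrightarrow> v \<notin> c \<Longrightarrow> colon c u \<subseteq> colon c v \<Longrightarrow> colon c v = colon c u"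
proof -
  let ?C = "{colon c u | u. u \<in> carrier R \<and> u \<notin> c \<and> colon c t \<subseteq> colon c u}"
  have "?C \<noteq> {}" using t by blast
  moreover have "\<And>I. I \<in> ?C \<Longrightarrow> ideal I R" using colon_ideal[OF c] by auto
  ultimately obtain M where M: "M \<in> ?C" "\<And>I. I \<in> ?C \<Longrightarrow> M \<subseteq> I \<Longrightarrow> I = M"
    by (rule maximal_ideal_in_family) auto
  then obtain u where u: "u \<in> carrier R" "u \<notin> c" "colon c t \<subseteq> colon c u" "M = colon c u" by auto
  have max: "\<And>v. v \<in> carrier R \<Longrightarrow> v \<notin> c \<Longrightarrow> colon c u \<subseteq> colon c v \<Longrightarrow> colon c v = colon c u"
    using M(2) u by blast
  show thesis using that[OF u(1-3) maximal_colon_prime[OF c u(1,2) max] max] .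
qed

text \<open>Nakayama's lemma after localization at M. Take d maximal among the saturated ideals that
  contain c but not b. If y t were outside d for some y in M and t in b, the saturation of d + (y t)
  would contain b, so s t = u + r y t with u in d and s outside M. Since s - r y is also outside M,
  t itself would lie in d. Hence M b is contained in d, and \<open>le\<close> puts b into d.\<close>

lemma nakayama_saturated:
  assumes M: "primeideal M R" and c: "ideal c R" and b: "ideal b R"
    and cb: "c \<subseteq> b" and sat: "saturation R M c = c"
    and le: "b \<subseteq> saturation R M (c <+>\<^bsub>R\<^esub> M \<cdot>\<^bsub>R\<^esub> b)"
  shows "b = c"
proof (rule ccontr)
  assume "b \<noteq> c"
  interpret M: primeideal M R by fact
  interpret b: ideal b R by fact
  let ?C = "{c'. ideal c' R \<and> c \<subseteq> c' \<and> saturation R M c' = c' \<and> \<not> b \<subseteq> c'}"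
  have "c \<in> ?C" using c sat cb \<open>b \<noteq> c\<close> by auto
  then have "?C \<noteq> {}" by blast
  then obtain d where d: "d \<in> ?C" and max: "\<And>I. I \<in> ?C \<Longrightarrow> d \<subseteq> I \<Longrightarrow> I = d"
    by (rule maximal_ideal_in_family) auto
  have dI: "ideal d R" and cd: "c \<subseteq> d" and ds: "saturation R M d = d" and nbd: "\<not> b \<subseteq> d" using d by auto
  interpret d: ideal d R by (rule dI)
  have gen: "y \<otimes> t \<in> d" if y: "y \<in> M" and t: "t \<in> b" for y t
  proof (rule ccontr)
    assume n: "y \<otimes> t \<notin> d"
    have yc: "y \<in> carrier R" and tc: "t \<in> carrier R" using y t M.Icarr b.Icarr by auto
    note A = add_principal_ideal[OF dI m_closed[OF yc tc]]
    let ?e = "saturation R M (d <+>\<^bsub>R\<^esub> PIdl (y \<otimes> t))"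
    have e: "ideal ?e R" "d <+>\<^bsub>R\<^esub> PIdl (y \<otimes> t) \<subseteq> ?e" "saturation R M ?e = ?e"
      using saturation_ideal[OF M A(1)] saturation_upper[OF M A(1)] saturation_idem[OF M A(1)] by auto
    have "?e \<noteq> d" using n A(3) e(2) by blast
    moreover have "d \<subseteq> ?e" using A(2) e(2) by blast
    ultimately have "?e \<notin> ?C" using max by blast
    then have "b \<subseteq> ?e" using e \<open>d \<subseteq> ?e\<close> cd by blast
    then obtain s where s: "s \<in> carrier R - M" "s \<otimes> t \<in> d <+>\<^bsub>R\<^esub> PIdl (y \<otimes> t)"
      using t by (auto simp: saturation_def)
    then obtain u r where u: "u \<in> d" "r \<in> carrier R" "s \<otimes> t = u \<oplus> r \<otimes> (y \<otimes> t)"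
      using add_principal_mem[OF dI m_closed[OF yc tc]] by auto
    have uc: "u \<in> carrier R" and sc: "s \<in> carrier R" using u s by auto
    have "(s \<ominus> r \<otimes> y) \<otimes> t = s \<otimes> t \<ominus> r \<otimes> (y \<otimes> t)" using u(2) sc yc tc by algebra
    also have "\<dots> = u" using u(2) uc yc tc by (simp add: u(3) add_minus_cancel)
    finally have "(s \<ominus> r \<otimes> y) \<otimes> t \<in> d" using u by simp
    moreover have "s \<ominus> r \<otimes> y \<notin> M"
    proof
      assume "s \<ominus> r \<otimes> y \<in> M"
      then have "(s \<ominus> r \<otimes> y) \<oplus> r \<otimes> y \<in> M" using y u(2) M.I_l_closed M.a_closed by auto
      moreover have "(s \<ominus> r \<otimes> y) \<oplus> r \<otimes> y = s" using u(2) sc yc by algebra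
      ultimately show False using s by simp
    qed
    moreover have "s \<ominus> r \<otimes> y \<in> carrier R" using u(2) sc yc by simp
    ultimately have "t \<in> d" using saturatedD[OF ds tc] by blast
    then show False using n d.I_l_closed yc by auto
  qed
  have "M \<cdot>\<^bsub>R\<^esub> b \<subseteq> d"
  proof
    fix z assume "z \<in> M \<cdot>\<^bsub>R\<^esub> b"
    then show "z \<in> d" by (induction rule: ideal_prod.induct) (use gen d.a_closed in auto)
  qed
  then have "c <+>\<^bsub>R\<^esub> M \<cdot>\<^bsub>R\<^esub> b \<subseteq> d" using cd by (intro ideal_sum_least[OF dI])
  then have "b \<subseteq> d" using le saturation_mono[of _ d M] ds by blast
  then show False using nbd by simp
qed

text \<open>If \<open>M\<close> is minimal over \<open>c0\<close>, the localization of \<open>R/c0\<close> at \<open>M\<close> is artinian. In a counterexample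
  with maximal lower bound \<open>c\<close>, some \<open>t \<notin> c\<close> has \<open>M t \<subseteq> c\<close>, and the chain is compared with the one
  obtained by adjoining \<open>t\<close>.\<close>

lemma descending_chain_saturated:
  assumes M: "primeideal M R" and c0: "ideal c0 R"
    and only: "\<And>P. primeideal P R \<Longrightarrow> c0 \<subseteq> P \<Longrightarrow> P \<subseteq> M \<Longrightarrow> P = M"
    and b: "\<And>k. ideal (b k) R" "\<And>k. saturation R M (b k) = b k" "\<And>k. c0 \<subseteq> b k"
      "\<And>k. b (Suc k) \<subseteq> b k"
  shows "\<exists>k. b k = b (Suc k)"
proof (rule ccontr)
  assume no: "\<not> ?thesis"
  define chain where "chain c b \<longleftrightarrow> (\<forall>k. ideal (b k) R \<and> saturation R M (b k) = b k \<and> c \<subseteq> b k \<and>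
      b (Suc k) \<subseteq> b k)" for c and b :: "nat \<Rightarrow> 'a set"
  let ?C = "{c. ideal c R \<and> saturation R M c = c \<and> c0 \<subseteq> c \<and> (\<exists>b. chain c b \<and> (\<forall>k. b k \<noteq> b (Suc k)))}"
  have "saturation R M c0 \<in> ?C"
  proof -
    have "chain (saturation R M c0) b" unfolding chain_def
      using b saturation_mono[OF b(3), of M] by auto
    then show ?thesis
      using no saturation_ideal[OF M c0] saturation_idem[OF M c0] saturation_upper[OF M c0] by blast
  qed
  then have "?C \<noteq> {}" by blast
  then obtain c where c: "c \<in> ?C" and max: "\<And>I. I \<in> ?C \<Longrightarrow> c \<subseteq> I \<Longrightarrow> I = c"
    by (rule maximal_ideal_in_family) auto
  then obtain b where ch: "chain c b" and nb: "\<And>k. b k \<noteq> b (Suc k)" by blast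
  have cI: "ideal c R" and cs: "saturation R M c = c" and c0c: "c0 \<subseteq> c" using c by auto
  have bI: "\<And>k. ideal (b k) R" and bs: "\<And>k. saturation R M (b k) = b k" and cb: "\<And>k. c \<subseteq> b k"
    and dec: "\<And>k. b (Suc k) \<subseteq> b k" using ch unfolding chain_def by auto
  have sub: "b k \<subseteq> carrier R" for k using ideal.Icarr[OF bI] by blast
  have "c \<noteq> carrier R" using nb[of 0] cb[of 0] cb[of 1] sub[of 0] sub[of 1] by auto
  then obtain t0 where "t0 \<in> carrier R" "t0 \<notin> c" using ideal.Icarr[OF cI] by blast
  then obtain t where t: "t \<in> carrier R" "t \<notin> c" "primeideal (colon c t) R"
    using exists_maximal_colon[OF cI] by metis
  \<comment> \<open>As c is saturated, no element outside M carries t into c. Minimality of M over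
    \<open>c0\<close> then identifies this prime annihilator with M.\<close>
  have "colon c t \<subseteq> M"
    using saturatedD[OF cs t(1)] t(2) unfolding colon_def by blast
  then have colM: "colon c t = M" using only[OF t(3)] colon_upper[OF cI t(1)] c0c by blast
  have key: "\<exists>k. b' k = b' (Suc k)"
    if "chain (saturation R M (c <+>\<^bsub>R\<^esub> PIdl t)) b'" for b'
  proof (rule ccontr)
    let ?e = "saturation R M (c <+>\<^bsub>R\<^esub> PIdl t)"
    assume "\<nexists>k. b' k = b' (Suc k)"
    note A = add_principal_ideal[OF cI t(1)]
    have e: "ideal ?e R" "c <+>\<^bsub>R\<^esub> PIdl t \<subseteq> ?e" "saturation R M ?e = ?e"
      using saturation_ideal[OF M A(1)] saturation_upper[OF M A(1)] saturation_idem[OF M A(1)] by auto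
    have "?e \<in> ?C" using that \<open>\<nexists>k. b' k = b' (Suc k)\<close> e A(2) c0c by blast
    then have "?e = c" using max e(2) A(2) by blast
    then show False using e(2) A(3) t(2) by blast
  qed
  show False
  \<comment> \<open>If every b k contains t, the chain is already bounded below by the saturation of
    c + (t), against the choice of c. Otherwise t is missing from some b j, hence from all later
    members, and the chain obtained by adjoining t to those becomes stationary somewhere.\<close>
  proof (cases "\<forall>k. t \<in> b k")
    case True
    have "saturation R M (c <+>\<^bsub>R\<^esub> PIdl t) \<subseteq> b k" for k
      using saturation_mono[OF add_principal_least[OF bI cb True[rule_format]]] bs by blast
    then have "chain (saturation R M (c <+>\<^bsub>R\<^esub> PIdl t)) b"
      using bI bs dec unfolding chain_def by blast
    then show False using key nb by blast
  next
    case False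
    then obtain j where j: "t \<notin> b j" by blast
    have anti: "b (j + k) \<subseteq> b j" for k using lift_Suc_antimono_le[of b, OF dec, of j "j + k"] by auto
    define b' where "b' k = saturation R M (b (j + k) <+>\<^bsub>R\<^esub> PIdl t)" for k
    have mono: "saturation R M (x <+>\<^bsub>R\<^esub> PIdl t) \<subseteq> saturation R M (y <+>\<^bsub>R\<^esub> PIdl t)" if "x \<subseteq> y" for x y
      by (rule saturation_mono) (use that in \<open>auto simp: set_add_def'\<close>)
    note A = add_principal_ideal[OF bI t(1)]
    have "chain (saturation R M (c <+>\<^bsub>R\<^esub> PIdl t)) b'"
      unfolding chain_def b'_def
      using saturation_ideal[OF M A(1)] saturation_idem[OF M A(1)] mono[OF cb] mono[OF dec] by auto
    then obtain k where k: "b' k = b' (Suc k)" using key by blast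
    \<comment> \<open>Equality after adjoining t is transferred back: in s a = u + r t the term r t
      lies in b (j + k), which is saturated and misses t; so r is in M and r t is in c.\<close>
    have "b (j + k) \<subseteq> b (Suc (j + k))"
    proof
      fix a assume a: "a \<in> b (j + k)"
      then have "a \<in> b' (Suc k)" using A(2) saturation_upper[OF M A(1)] k unfolding b'_def by blast
      then obtain s where s: "s \<in> carrier R - M" "s \<otimes> a \<in> b (Suc (j + k)) <+>\<^bsub>R\<^esub> PIdl t"
        unfolding b'_def saturation_def by auto
      then obtain u r where u: "u \<in> b (Suc (j + k))" "r \<in> carrier R" "s \<otimes> a = u \<oplus> r \<otimes> t"
        using add_principal_mem[OF bI t(1)] by auto
      interpret B: ideal "b (Suc (j + k))" R by (rule bI)
      interpret B': ideal "b (j + k)" R by (rule bI)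
      have carr: "a \<in> carrier R" "u \<in> carrier R" "s \<in> carrier R" using a u s by auto
      have "r \<otimes> t = s \<otimes> a \<ominus> u" using u(2) carr t(1) by (simp add: u(3)) algebra
      moreover have "s \<otimes> a \<in> b (j + k)" "u \<in> b (j + k)" using a carr B'.I_l_closed u(1) dec by auto
      ultimately have rt: "r \<otimes> t \<in> b (j + k)" using B'.a_closed B'.a_inv_closed by (simp add: minus_eq)
      have "r \<in> M"
      proof (rule ccontr)
        assume "r \<notin> M"
        then have "t \<in> b (j + k)" using saturatedD[OF bs t(1) _ rt] u(2) by blast
        then show False using j anti by blast
      qed
      then have "r \<otimes> t \<in> b (Suc (j + k))" using colM cb unfolding colon_def by blast
      then have "s \<otimes> a \<in> b (Suc (j + k))" using u B.a_closed by auto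
      then show "a \<in> b (Suc (j + k))" using saturatedD[OF bs carr(1) s(1)] by blast
    qed
    then show False using nb dec by blast
  qed
qed

end

section \<open>The principal ideal theorem\<close>

primrec ideal_power :: "('a, 'b) ring_scheme \<Rightarrow> 'a set \<Rightarrow> nat \<Rightarrow> 'a set" where
  "ideal_power R q 0 = carrier R"
| "ideal_power R q (Suc k) = ideal_prod R q (ideal_power R q k)"

lemma (in ring) ideal_power_ideal: "ideal q R \<Longrightarrow> ideal (ideal_power R q k) R"
  by (induction k) (auto intro: oneideal ideal_prod_is_ideal)

lemma (in ring) ideal_power_antimono:
  assumes "ideal q R"
  shows "ideal_power R q (Suc k) \<subseteq> ideal_power R q k"
  using ideal_prod_inter[OF assms ideal_power_ideal[OF assms]] by auto

context noetherian_cring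
begin

text \<open>Nakayama at q, applied to q^k + p over p, gives that q^k lies in p. As p is prime, the
  exponent can be lowered until q itself lies in p.\<close>

lemma ideal_power_stable_imp_subset:
  assumes p: "primeideal p R" and q: "primeideal q R" and pq: "p \<subseteq> q"
    and st: "ideal_power R q k \<subseteq> saturation R q (ideal_power R q (Suc k) <+>\<^bsub>R\<^esub> p)"
  shows "q \<subseteq> p"
proof -
  interpret p: primeideal p R by fact
  interpret q: primeideal q R by fact
  let ?Q = "ideal_power R q"
  have QI: "ideal (?Q j) R" for j using ideal_power_ideal q.is_ideal by blast
  let ?b = "?Q k <+>\<^bsub>R\<^esub> p"
  have bI: "ideal ?b R" by (rule add_ideals[OF QI p.is_ideal])
  have pb: "p \<subseteq> ?b" "?Q k \<subseteq> ?b" using ideal_sum_upper[OF QI p.is_ideal] by auto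
  have psat: "saturation R q p = p" by (rule prime_saturated[OF p q pq])
  have qbI: "ideal (q \<cdot>\<^bsub>R\<^esub> ?b) R" by (rule ideal_prod_is_ideal[OF q.is_ideal bI])
  have sI: "ideal (p <+>\<^bsub>R\<^esub> q \<cdot>\<^bsub>R\<^esub> ?b) R" by (rule add_ideals[OF p.is_ideal qbI])
  have up: "p \<subseteq> p <+>\<^bsub>R\<^esub> q \<cdot>\<^bsub>R\<^esub> ?b" "q \<cdot>\<^bsub>R\<^esub> ?b \<subseteq> p <+>\<^bsub>R\<^esub> q \<cdot>\<^bsub>R\<^esub> ?b"
    using ideal_sum_upper[OF p.is_ideal qbI] by auto
  have "?Q (Suc k) \<subseteq> q \<cdot>\<^bsub>R\<^esub> ?b"
  proof
    fix z assume "z \<in> ?Q (Suc k)"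
    then have "z \<in> q \<cdot>\<^bsub>R\<^esub> ?Q k" by simp
    then show "z \<in> q \<cdot>\<^bsub>R\<^esub> ?b"
      by (induction rule: ideal_prod.induct) (use pb in \<open>auto intro: ideal_prod.intros\<close>)
  qed
  then have "?Q (Suc k) <+>\<^bsub>R\<^esub> p \<subseteq> p <+>\<^bsub>R\<^esub> q \<cdot>\<^bsub>R\<^esub> ?b"
    using up by (intro ideal_sum_least[OF sI]) auto
  then have "?Q k \<subseteq> saturation R q (p <+>\<^bsub>R\<^esub> q \<cdot>\<^bsub>R\<^esub> ?b)"
    using st saturation_mono by blast
  moreover have "p \<subseteq> saturation R q (p <+>\<^bsub>R\<^esub> q \<cdot>\<^bsub>R\<^esub> ?b)"
    using up(1) saturation_upper[OF q sI] by blast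
  ultimately have "?b \<subseteq> saturation R q (p <+>\<^bsub>R\<^esub> q \<cdot>\<^bsub>R\<^esub> ?b)"
    by (intro ideal_sum_least[OF saturation_ideal[OF q sI]])
  then have "?b = p" by (rule nakayama_saturated[OF q p.is_ideal bI pb(1) psat])
  then have "?Q k \<subseteq> p" using pb by blast
  then show ?thesis
  proof (induction k)
    case 0
    then show ?case by (auto dest: q.Icarr)
  next
    case (Suc k)
    show ?case
    proof (cases "q \<subseteq> p")
      case False
      then obtain y where y: "y \<in> q" "y \<notin> p" by blast
      have "?Q k \<subseteq> p"
      proof
        fix z assume z: "z \<in> ?Q k"
        then have "y \<otimes> z \<in> p" using Suc.prems y by (auto intro: ideal_prod.prod)
        then show "z \<in> p" using p.I_prime[OF q.Icarr[OF y(1)] ideal.Icarr[OF QI z]] y(2) by simp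
      qed
      then show ?thesis by (rule Suc.IH)
    qed simp
  qed
qed

text \<open>Krull's principal ideal theorem, relative to the prime \<open>p\<close>. If \<open>M\<close> were minimal over
  \<open>p + (x)\<close>, then the descending chain condition modulo \<open>p + (x)\<close> (after saturation at \<open>M\<close>) would
  make the symbolic powers of \<open>q\<close> modulo \<open>p\<close> stationary.\<close>

lemma krull_principal_ideal:
  assumes p: "primeideal p R" and q: "primeideal q R" and M: "primeideal M R"
    and pq: "p \<subset> q" and qM: "q \<subset> M" and x: "x \<in> M"
  shows "\<exists>P. primeideal P R \<and> p \<subset> P \<and> P \<subset> M \<and> x \<in> P"
proof (rule ccontr)
  assume no: "\<not> ?thesis"
  interpret p: primeideal p R by fact
  interpret q: primeideal q R by fact
  interpret M: primeideal M R by fact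
  have xc: "x \<in> carrier R" using x M.Icarr by blast
  \<comment> \<open>Otherwise q itself would be a prime of the kind assumed not to exist. So x can
    be cancelled modulo ideals saturated at q.\<close>
  have xq: "x \<notin> q" using no q pq qM by blast
  let ?c0 = "p <+>\<^bsub>R\<^esub> PIdl x"
  note C = add_principal_ideal[OF p.is_ideal xc]
  have only: "P = M" if "primeideal P R" "?c0 \<subseteq> P" "P \<subseteq> M" for P
    using no that C xq pq by blast
  \<comment> \<open>The symbolic powers of q modulo p. Being saturated at q, they are also saturated
    at the larger prime M.\<close>
  define Q where "Q k = saturation R q (ideal_power R q k <+>\<^bsub>R\<^esub> p)" for k
  have PI: "ideal (ideal_power R q j) R" for j using ideal_power_ideal q.is_ideal by blast
  have PpI: "ideal (ideal_power R q j <+>\<^bsub>R\<^esub> p) R" for j by (rule add_ideals[OF PI p.is_ideal])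
  have QI: "ideal (Q k) R" and Qs: "saturation R q (Q k) = Q k" for k
    unfolding Q_def using saturation_ideal[OF q PpI] saturation_idem[OF q PpI] by auto
  have pQ: "p \<subseteq> Q k" and PQ: "ideal_power R q k \<subseteq> Q k" for k
    unfolding Q_def using saturation_upper[OF q PpI[of k]] ideal_sum_upper[OF PI[of k] p.is_ideal] by auto
  have Qdec: "Q (Suc k) \<subseteq> Q k" for k
    unfolding Q_def
    by (intro saturation_mono ideal_sum_least[OF PpI])
      (use ideal_power_antimono[OF q.is_ideal, of k] ideal_sum_upper[OF PI[of k] p.is_ideal] in auto)
  have QsM: "saturation R M (Q k) = Q k" for k
  proof
    show "saturation R M (Q k) \<subseteq> Q k"
      using saturatedD[OF Qs] qM unfolding saturation_def[of R M] by blast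
  qed (rule saturation_upper[OF M QI])
  define b where "b k = saturation R M (Q k <+>\<^bsub>R\<^esub> PIdl x)" for k
  note A = add_principal_ideal[OF QI xc]
  have bup: "Q k <+>\<^bsub>R\<^esub> PIdl x \<subseteq> b k" for k unfolding b_def by (rule saturation_upper[OF M A(1)])
  have "\<exists>k. b k = b (Suc k)"
  proof (rule descending_chain_saturated[OF M C(1) only])
    fix k
    show "ideal (b k) R" "saturation R M (b k) = b k"
      unfolding b_def using saturation_ideal[OF M A(1)] saturation_idem[OF M A(1)] by auto
    show "?c0 \<subseteq> b k"
      by (rule subset_trans[OF add_principal_least[OF A(1)] bup]) (use pQ A in blast)+
    show "b (Suc k) \<subseteq> b k"
      unfolding b_def by (intro saturation_mono add_principal_least[OF A(1)]) (use Qdec A in blast)+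
  qed
  then obtain k where k: "b k = b (Suc k)" by blast
  have xQI: "ideal (M \<cdot>\<^bsub>R\<^esub> Q k) R" by (rule ideal_prod_is_ideal[OF M.is_ideal QI])
  \<comment> \<open>The stationary chain gives s a = u + r x with u in Q (k + 1), so r x is in Q k.
    As x is outside q, r lies in Q k; thus s a is in Q (k + 1) + M Q k, and Nakayama at M
    applies.\<close>
  have "Q k = Q (Suc k)"
  proof (rule nakayama_saturated[OF M QI QI Qdec QsM], rule subsetI)
    fix a assume a: "a \<in> Q k"
    then have "a \<in> b (Suc k)" using A(2) bup k by blast
    then obtain s where s: "s \<in> carrier R - M" "s \<otimes> a \<in> Q (Suc k) <+>\<^bsub>R\<^esub> PIdl x" and ac: "a \<in> carrier R"
      unfolding b_def saturation_def by auto
    then obtain u r where u: "u \<in> Q (Suc k)" "r \<in> carrier R" "s \<otimes> a = u \<oplus> r \<otimes> x"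
      using add_principal_mem[OF QI xc] by auto
    interpret B: ideal "Q k" R by (rule QI)
    have carr: "u \<in> carrier R" "s \<in> carrier R" using u ideal.Icarr[OF QI] s by auto
    have "r \<otimes> x = s \<otimes> a \<ominus> u" using u(2) carr xc by (simp add: u(3)) algebra
    moreover have "s \<otimes> a \<in> Q k" "u \<in> Q k" using a carr B.I_l_closed u(1) Qdec by auto
    ultimately have "x \<otimes> r \<in> Q k"
      using B.a_closed B.a_inv_closed u(2) xc by (simp add: minus_eq m_comm)
    then have "r \<in> Q k" using saturatedD[OF Qs u(2)] xq xc by blast
    then have "x \<otimes> r \<in> M \<cdot>\<^bsub>R\<^esub> Q k" using x by (auto intro: ideal_prod.prod)
    then have "s \<otimes> a \<in> Q (Suc k) <+>\<^bsub>R\<^esub> M \<cdot>\<^bsub>R\<^esub> Q k"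
      unfolding set_add_def' using u xc by (auto simp: m_comm)
    then show "a \<in> saturation R M (Q (Suc k) <+>\<^bsub>R\<^esub> M \<cdot>\<^bsub>R\<^esub> Q k)"
      using s ac by (auto simp: saturation_def)
  qed
  then have "ideal_power R q k \<subseteq> saturation R q (ideal_power R q (Suc k) <+>\<^bsub>R\<^esub> p)"
    using PQ[of k] unfolding Q_def by blast
  then have "q \<subseteq> p" using ideal_power_stable_imp_subset[OF p q] pq by blast
  then show False using pq by blast
qed

section \<open>Moving an element down a chain of primes\<close>

definition prime_chain :: "'a set list \<Rightarrow> bool" where
  "prime_chain ps \<longleftrightarrow> (\<forall>P\<in>set ps. primeideal P R) \<and> sorted_wrt (\<subset>) ps"

text \<open>Turns the principal ideal theorem into an induction on dimension: every prime but the
  first can be made to contain x without shortening the chain. Proceeding from the top, once the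
  prime M above q contains x, q is exchanged for a prime P between p and M that contains x.\<close>

lemma prime_chain_push:
  assumes "prime_chain (p # ps)" "ps \<noteq> []" "x \<in> last ps"
  shows "\<exists>ps'. prime_chain (p # ps') \<and> length ps' = length ps \<and> x \<in> hd ps' \<and> last ps' = last ps"
  using assms
proof (induction ps arbitrary: p)
  case Nil
  then show ?case by simp
next
  case (Cons q qs)
  show ?case
  proof (cases qs)
    case Nil
    then show ?thesis using Cons.prems by (intro exI[of _ "[q]"]) simp
  next
    case (Cons r rs)
    have "prime_chain (q # qs)" using Cons.prems(1) by (simp add: prime_chain_def)
    then obtain qs' where qs': "prime_chain (q # qs')" "length qs' = length qs" "x \<in> hd qs'" "last qs' = last qs"
      using Cons.IH[of q] Cons.prems(3) Cons by (metis last_ConsR list.distinct(1))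
    then obtain M ms where M: "qs' = M # ms" using Cons by (cases qs') auto
    have pr: "primeideal p R" "primeideal q R" "primeideal M R" "p \<subset> q" "q \<subset> M" "x \<in> M"
      using Cons.prems(1) qs'(1,3) M by (simp_all add: prime_chain_def)
    obtain P where P: "primeideal P R" "p \<subset> P" "P \<subset> M" "x \<in> P"
      using krull_principal_ideal[OF pr] by blast
    have "\<forall>N\<in>set ms. M \<subset> N" "\<forall>N\<in>set qs'. primeideal N R" "sorted_wrt (\<subset>) qs'"
      using qs'(1) M by (simp_all add: prime_chain_def)
    moreover have "\<forall>N\<in>set qs'. P \<subset> N" using calculation(1) P(3) M by (simp, blast)
    moreover have "\<forall>N\<in>set qs'. p \<subset> N" using calculation(4) P(2) by blast
    ultimately have "prime_chain (p # P # qs')"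
      using P(1,2) pr(1) unfolding prime_chain_def by simp
    then show ?thesis using qs'(2,4) M Cons P(4) by (intro exI[of _ "P # qs'"]) simp
  qed
qed

end

section \<open>Regular elements and regular systems of parameters\<close>

context cring
begin

lemma ideal_finsum:
  assumes "ideal b R" "\<And>i. i \<in> D \<Longrightarrow> f i \<in> b"
  shows "finsum R f D \<in> b"
proof -
  interpret b: ideal b R by fact
  show ?thesis using assms(2)
  proof (induction D rule: infinite_finite_induct)
    case (insert i D)
    then have "f \<in> D \<rightarrow> carrier R" "f i \<in> carrier R" using b.Icarr by auto
    then show ?case using insert b.a_closed by simp
  qed auto
qed

text \<open>Coefficient matrix of an exterior element of degree two. The zero diagonal is a separate
  condition because antisymmetry does not imply it in characteristic two.\<close>

definition alternating :: "'i set \<Rightarrow> ('i \<Rightarrow> 'i \<Rightarrow> 'a) \<Rightarrow> bool" where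
  "alternating D w \<longleftrightarrow> (\<forall>i\<in>D. \<forall>j\<in>D. w i j \<in> carrier R \<and> w i i = \<zero> \<and> w i j = \<ominus> w j i)"

lemma alternatingD:
  assumes "alternating D w" "i \<in> D" "j \<in> D"
  shows "w i j \<in> carrier R" "w i i = \<zero>" "w i j = \<ominus> w j i"
  using bspec[OF bspec[OF assms(1)[unfolded alternating_def] assms(2)] assms(3)] by blast+

lemma alternating_subset: "alternating D w \<Longrightarrow> D' \<subseteq> D \<Longrightarrow> alternating D' w"
  unfolding alternating_def by (meson subsetD)

text \<open>The entries at (i, j) and (j, i) cancel. Square-zero identities such as
  \<open>kd_kd\<close> and \<open>kmul_kmul_same\<close> are instances.\<close>

lemma alternating_sum_zero:
  assumes "finite D" "alternating D w"
  shows "(\<Oplus>i\<in>D. \<Oplus>j\<in>D. w i j) = \<zero>"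
  using assms
proof (induction D)
  case (insert k D)
  have w: "\<And>i j. i \<in> insert k D \<Longrightarrow> j \<in> insert k D \<Longrightarrow> w i j \<in> carrier R"
    and wk: "w k k = \<zero>" and sk: "\<And>j. j \<in> D \<Longrightarrow> w j k = \<ominus> w k j"
    using alternatingD[OF insert.prems] by blast+
  have S: "(\<lambda>j. w k j) \<in> D \<rightarrow> carrier R" "(\<lambda>i. w i k) \<in> D \<rightarrow> carrier R"
    "(\<lambda>i. \<Oplus>j\<in>D. w i j) \<in> D \<rightarrow> carrier R" "(\<lambda>i. \<ominus> w k i) \<in> D \<rightarrow> carrier R"
    using w by (auto intro!: finsum_closed)
  have "(\<Oplus>i\<in>insert k D. \<Oplus>j\<in>insert k D. w i j) =
      (\<Oplus>j\<in>insert k D. w k j) \<oplus> (\<Oplus>i\<in>D. \<Oplus>j\<in>insert k D. w i j)"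
    using insert.hyps w by (intro finsum_insert) (auto intro!: finsum_closed)
  also have "(\<Oplus>j\<in>insert k D. w k j) = (\<Oplus>j\<in>D. w k j)"
    using insert.hyps w S wk by (simp add: finsum_insert)
  also have "(\<Oplus>i\<in>D. \<Oplus>j\<in>insert k D. w i j) = (\<Oplus>i\<in>D. \<ominus> w k i \<oplus> (\<Oplus>j\<in>D. w i j))"
    using insert.hyps w sk by (intro finsum_cong') (auto simp: finsum_insert intro!: finsum_closed)
  also have "\<dots> = (\<Oplus>i\<in>D. \<ominus> w k i) \<oplus> (\<Oplus>i\<in>D. \<Oplus>j\<in>D. w i j)"
    using S by (intro finsum_addf) auto
  also have "(\<Oplus>i\<in>D. \<Oplus>j\<in>D. w i j) = \<zero>"
    by (rule insert.IH[OF alternating_subset[OF insert.prems]]) auto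
  finally have "(\<Oplus>i\<in>insert k D. \<Oplus>j\<in>insert k D. w i j) = (\<Oplus>j\<in>D. w k j) \<oplus> (\<Oplus>i\<in>D. \<ominus> w k i)"
    using S by (simp add: finsum_closed)
  also have "\<dots> = (\<Oplus>j\<in>D. w k j \<oplus> \<ominus> w k j)"
    using S by (intro finsum_addf[symmetric]) auto
  also have "\<dots> = (\<Oplus>j\<in>D. \<zero>)"
    using w by (intro finsum_cong') (auto simp: r_neg)
  finally show ?case by simp
qed simp

section \<open>Prime avoidance and regular elements\<close>

lemma exists_in_all_ideals_notin_prime:
  assumes P: "primeideal P R" and V: "finite V"
    and K: "\<And>v. v \<in> V \<Longrightarrow> ideal (K v) R" "\<And>v. v \<in> V \<Longrightarrow> \<not> K v \<subseteq> P"
  shows "\<exists>r\<in>carrier R - P. \<forall>v\<in>V. r \<in> K v"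
  using V K
proof (induction V)
  case empty
  then show ?case using primeideal_one_notin[OF P] by auto
next
  case (insert v V)
  then obtain r where r: "r \<in> carrier R - P" "\<forall>v\<in>V. r \<in> K v" by auto
  have v: "ideal (K v) R" "\<not> K v \<subseteq> P" using insert.prems by auto
  then obtain s where s: "s \<in> K v" "s \<notin> P" by blast
  have sc: "s \<in> carrier R" using ideal.Icarr[OF v(1)] s by blast
  have "r \<otimes> s \<in> carrier R - P" by (rule primeideal_mult_notin[OF P]) (use r s sc in auto)
  moreover have "r \<otimes> s \<in> K v" using ideal.I_l_closed[OF v(1)] s r by auto
  moreover have "r \<otimes> s \<in> K v'" if "v' \<in> V" for v'
    using ideal.I_r_closed[of "K v'" R r s] insert.prems(1)[of v'] that r sc by auto
  ultimately show ?case by blast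
qed

text \<open>Let x avoid all primes but P and lie in P. Adding y r, with y in I outside P and r in
  every other prime but not in P, moves x out of P without changing its class modulo the others.
  Incomparability of the primes makes r available.\<close>

lemma prime_avoidance:
  assumes I: "ideal I R" and PP: "finite PP" "\<And>P. P \<in> PP \<Longrightarrow> primeideal P R"
    and inc: "\<And>P P'. P \<in> PP \<Longrightarrow> P' \<in> PP \<Longrightarrow> P \<subseteq> P' \<Longrightarrow> P = P'"
    and nsub: "\<And>P. P \<in> PP \<Longrightarrow> \<not> I \<subseteq> P"
  shows "\<exists>x\<in>I. \<forall>P\<in>PP. x \<notin> P"
  using PP inc nsub
proof (induction PP)
  case empty
  have "\<zero> \<in> I" by (rule additive_subgroup.zero_closed[OF ideal.axioms(1)[OF I]])
  then show ?case by blast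
next
  case (insert P PP)
  interpret I: ideal I R by fact
  interpret P: primeideal P R using insert.prems(1) by simp
  obtain x where x: "x \<in> I" "\<forall>P\<in>PP. x \<notin> P" using insert by auto
  show ?case
  proof (cases "x \<in> P")
    case False
    then show ?thesis using x by blast
  next
    case True
    obtain y where y: "y \<in> I" "y \<notin> P" using insert.prems(3) by blast
    have "\<exists>r\<in>carrier R - P. \<forall>v\<in>PP. r \<in> v"
    proof (rule exists_in_all_ideals_notin_prime[OF P.primeideal insert.hyps(1)])
      fix v assume v: "v \<in> PP"
      show "ideal v R" using primeideal.axioms(1)[OF insert.prems(1)[of v]] v by simp
      show "\<not> v \<subseteq> P" using insert.prems(2)[of v P] insert.hyps(2) v by auto
    qed
    then obtain r where r: "r \<in> carrier R" "r \<notin> P" "\<forall>v\<in>PP. r \<in> v" by blast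
    have carr: "x \<in> carrier R" "y \<in> carrier R" using x y I.Icarr by auto
    have yr: "y \<otimes> r \<notin> P" using P.I_prime carr r y by blast
    have "x \<oplus> y \<otimes> r \<in> I" using x y r I.I_r_closed I.a_closed by auto
    moreover have "x \<oplus> y \<otimes> r \<notin> P"
    proof
      assume "x \<oplus> y \<otimes> r \<in> P"
      then have "(x \<oplus> y \<otimes> r) \<oplus> \<ominus> x \<in> P" using True P.a_closed P.a_inv_closed by blast
      moreover have "(x \<oplus> y \<otimes> r) \<oplus> \<ominus> x = y \<otimes> r" using carr r by algebra
      ultimately show False using yr by simp
    qed
    moreover have "x \<oplus> y \<otimes> r \<notin> P'" if P': "P' \<in> PP" for P'
    proof
      interpret P': primeideal P' R using insert.prems(1) P' by simp
      have "y \<otimes> r \<in> P'" using r P' carr P'.I_l_closed by auto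
      assume "x \<oplus> y \<otimes> r \<in> P'"
      then have "(x \<oplus> y \<otimes> r) \<oplus> \<ominus> (y \<otimes> r) \<in> P'"
        using \<open>y \<otimes> r \<in> P'\<close> P'.a_closed P'.a_inv_closed by blast
      moreover have "(x \<oplus> y \<otimes> r) \<oplus> \<ominus> (y \<otimes> r) = x" using carr r by algebra
      ultimately show False using x P' by simp
    qed
    ultimately show ?thesis by blast
  qed
qed

end

context noetherian_cring
begin

text \<open>The ideals \<open>colon b u\<close> maximal among those with \<open>u \<notin> b\<close> are the maximal associated primes;
  there are finitely many of them because any such \<open>u\<close> lies in a finitely generated ideal spanned
  by others.\<close>

lemma exists_regular_element:
  assumes b: "ideal b R" and I: "ideal I R"
    and ann: "\<And>y. y \<in> carrier R \<Longrightarrow> (\<And>x. x \<in> I \<Longrightarrow> x \<otimes> y \<in> b) \<Longrightarrow> y \<in> b"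
  obtains x where "x \<in> I" "\<And>y. y \<in> carrier R \<Longrightarrow> x \<otimes> y \<in> b \<Longrightarrow> y \<in> b"
proof -
  define U where "U = {u \<in> carrier R - b. primeideal (colon b u) R \<and>
    (\<forall>v\<in>carrier R - b. colon b u \<subseteq> colon b v \<longrightarrow> colon b v = colon b u)}"
  let ?C = "{Idl V | V. finite V \<and> V \<subseteq> U}"
  have Uc: "U \<subseteq> carrier R" unfolding U_def by auto
  have "?C \<noteq> {}" by blast
  \<comment> \<open>Noetherianity enters here: among the ideals spanned by finite subsets of U, a
    maximal one contains all of U.\<close>
  then obtain T where T: "T \<in> ?C" "\<And>J. J \<in> ?C \<Longrightarrow> T \<subseteq> J \<Longrightarrow> J = T"
    by (rule maximal_ideal_in_family) (use Uc in \<open>auto intro!: genideal_ideal\<close>)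
  then obtain V where V: "finite V" "V \<subseteq> U" "T = Idl V" by auto
  have Vc: "V \<subseteq> carrier R" using V Uc by auto
  have UV: "U \<subseteq> Idl V"
  proof
    fix u assume u: "u \<in> U"
    have c: "insert u V \<subseteq> carrier R" using u Uc Vc by auto
    have "Idl (insert u V) \<in> ?C" using u V by blast
    moreover have "Idl V \<subseteq> Idl (insert u V)"
      by (rule genideal_minimal[OF genideal_ideal[OF c]]) (use genideal_self[OF c] in blast)
    ultimately have "Idl (insert u V) = Idl V" using T(2) V(3) by blast
    then show "u \<in> Idl V" using genideal_self[OF c] by blast
  qed
  \<comment> \<open>A maximal annihilator different from those of all v in V contains none of them,
    so some r outside it kills every v modulo b. Then r kills the ideal spanned by V modulo b, and
    in particular u, a contradiction.\<close>
  have finitely_many: "\<exists>v\<in>V. colon b u = colon b v" if u: "u \<in> U" for u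
  proof (rule ccontr)
    assume n: "\<not> ?thesis"
    have u': "primeideal (colon b u) R" "u \<in> carrier R" "u \<notin> b" using u by (auto simp: U_def)
    have "\<exists>r\<in>carrier R - colon b u. \<forall>v\<in>V. r \<in> colon b v"
    proof (rule exists_in_all_ideals_notin_prime[OF u'(1) V(1)])
      fix v assume v: "v \<in> V"
      show "ideal (colon b v) R" using colon_ideal[OF b] v Vc by blast
      have "v \<in> U" using v V by blast
      then show "\<not> colon b v \<subseteq> colon b u" using n v u'(2,3) unfolding U_def by blast
    qed
    then obtain r where r: "r \<in> carrier R" "r \<notin> colon b u" "\<forall>v\<in>V. r \<in> colon b v" by blast
    have "V \<subseteq> colon b r"
    proof
      fix v assume v: "v \<in> V"
      then have "v \<in> carrier R" "r \<otimes> v \<in> b" using Vc r(3) by (auto simp: colon_def)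
      then show "v \<in> colon b r" using r(1) by (simp add: colon_def m_comm)
    qed
    then have "Idl V \<subseteq> colon b r" by (rule genideal_minimal[OF colon_ideal[OF b r(1)]])
    then have "u \<in> colon b r" using UV u by blast
    then show False using r u' by (simp add: colon_def m_comm)
  qed
  have "\<exists>x\<in>I. \<forall>P\<in>colon b ` V. x \<notin> P"
  proof (rule prime_avoidance[OF I])
    show "finite (colon b ` V)" using V by simp
    show "\<And>P. P \<in> colon b ` V \<Longrightarrow> primeideal P R" using V unfolding U_def by auto
    show "\<And>P P'. P \<in> colon b ` V \<Longrightarrow> P' \<in> colon b ` V \<Longrightarrow> P \<subseteq> P' \<Longrightarrow> P = P'"
      using V(2) unfolding U_def by blast
    fix P assume "P \<in> colon b ` V"
    then obtain v where v: "v \<in> V" "P = colon b v" by blast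
    then have "v \<in> carrier R" "v \<notin> b" using V(2) unfolding U_def by auto
    then obtain x where "x \<in> I" "x \<otimes> v \<notin> b" using ann by blast
    then show "\<not> I \<subseteq> P" using v by (auto simp: colon_def)
  qed
  then obtain x where x: "x \<in> I" "\<forall>v\<in>V. x \<notin> colon b v" by blast
  have xc: "x \<in> carrier R" using ideal.Icarr[OF I] x by blast
  show thesis
  \<comment> \<open>If x killed some y outside b modulo b, it would lie in a maximal annihilator,
    and x was chosen outside all of these.\<close>
  proof (rule that[OF x(1)], rule ccontr)
    fix y assume y: "y \<in> carrier R" "x \<otimes> y \<in> b" "y \<notin> b"
    obtain u where u: "u \<in> carrier R" "u \<notin> b" "colon b y \<subseteq> colon b u" "primeideal (colon b u) R"
      "\<And>v. v \<in> carrier R \<Longrightarrow> v \<notin> b \<Longrightarrow> colon b u \<subseteq> colon b v \<Longrightarrow> colon b v = colon b u"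
      using exists_maximal_colon[OF b y(1,3)] by metis
    then have "u \<in> U" unfolding U_def by blast
    then obtain v where "v \<in> V" "colon b u = colon b v" using finitely_many by blast
    then show False using x(2) u(3) y xc by (auto simp: colon_def)
  qed
qed

end

section \<open>Local rings, lengths of chains of primes and parameters\<close>

locale noetherian_local_ring = noetherian_cring +
  fixes N :: "'a set"
  assumes max_N: "maximalideal N R" and unique_max: "\<And>M. maximalideal M R \<Longrightarrow> M = N"
begin

lemma prime_N: "primeideal N R"
  using maximalideal_prime[OF max_N] .

lemma ideal_N: "ideal N R"
  using max_N maximalideal.axioms(1) by blast

lemma proper_ideal_subset_N:
  assumes "ideal I R" "\<one> \<notin> I"
  shows "I \<subseteq> N"
proof -
  let ?C = "{J. ideal J R \<and> I \<subseteq> J \<and> \<one> \<notin> J}"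
  have "?C \<noteq> {}" using assms by blast
  then obtain M where M: "M \<in> ?C" "\<And>J. J \<in> ?C \<Longrightarrow> M \<subseteq> J \<Longrightarrow> J = M"
    by (rule maximal_ideal_in_family) auto
  have "maximalideal M R"
  proof (rule maximalidealI)
    show "ideal M R" "carrier R \<noteq> M" using M(1) by auto
    fix J assume J: "ideal J R" "M \<subseteq> J" "J \<subseteq> carrier R"
    show "J = M \<or> J = carrier R"
    proof (cases "\<one> \<in> J")
      case True
      then show ?thesis using ideal.one_imp_carrier[OF J(1)] by blast
    next
      case False
      then show ?thesis using M(1) M(2)[of J] J by blast
    qed
  qed
  then have "M = N" by (rule unique_max)
  then show ?thesis using M(1) by blast
qed

lemma unit_if_notin_N:
  assumes "s \<in> carrier R" "s \<notin> N"
  obtains t where "t \<in> carrier R" "t \<otimes> s = \<one>"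
proof -
  have "ideal (PIdl s) R" "s \<in> PIdl s" using assms cgenideal_ideal cgenideal_self by auto
  then have "\<one> \<in> PIdl s" using proper_ideal_subset_N[of "PIdl s"] assms by blast
  then show thesis using that unfolding cgenideal_def by auto
qed

lemma saturation_N:
  assumes "ideal b R"
  shows "saturation R N b = b"
proof
  show "saturation R N b \<subseteq> b"
  proof
    fix a assume "a \<in> saturation R N b"
    then obtain s where s: "a \<in> carrier R" "s \<in> carrier R" "s \<notin> N" "s \<otimes> a \<in> b"
      by (auto simp: saturation_def)
    obtain t where t: "t \<in> carrier R" "t \<otimes> s = \<one>" using unit_if_notin_N[OF s(2,3)] by blast
    have "a = t \<otimes> (s \<otimes> a)" using s t by (simp add: m_assoc[symmetric])
    moreover have "t \<otimes> (s \<otimes> a) \<in> b" using s t ideal.I_l_closed[OF assms] by blast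
    ultimately show "a \<in> b" by simp
  qed
qed (rule saturation_upper[OF prime_N assms])

lemma prime_subset_N: "primeideal P R \<Longrightarrow> P \<subseteq> N"
  using proper_ideal_subset_N primeideal_one_notin primeideal.axioms(1) by blast

text \<open>Makes the last prime contain every element of N, so that \<open>prime_chain_push\<close>
  applies to any of them.\<close>

lemma prime_chain_end_at_N:
  assumes "prime_chain ps" "ps \<noteq> []"
  shows "prime_chain (butlast ps @ [N])"
proof -
  have ps: "ps = butlast ps @ [last ps]" using assms(2) by simp
  have "prime_chain (butlast ps @ [last ps])" using assms ps by simp
  then have *: "\<forall>P\<in>set (butlast ps). primeideal P R \<and> P \<subset> last ps" "sorted_wrt (\<subset>) (butlast ps)"
    "primeideal (last ps) R"
    by (auto simp: prime_chain_def sorted_wrt_append)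
  then have "\<forall>P\<in>set (butlast ps). P \<subset> N" using prime_subset_N[of "last ps"] by blast
  then show ?thesis using * prime_N by (auto simp: prime_chain_def sorted_wrt_append)
qed

lemma prime_chain_push_N:
  assumes "prime_chain (p # ps)" "ps \<noteq> []" "x \<in> N"
  obtains ps' where "prime_chain (p # ps')" "length ps' = length ps" "x \<in> hd ps'"
proof -
  have "prime_chain (p # butlast ps @ [N])"
    using prime_chain_end_at_N[OF assms(1)] assms(2) by simp
  then show thesis using prime_chain_push[of p "butlast ps @ [N]" x] assms that by auto
qed

lemma prime_chain_tl_contains:
  assumes "prime_chain (p # ps)" "ps \<noteq> []" "B \<subseteq> p" "x \<in> hd ps" "P \<in> set ps"
  shows "insert x B \<subseteq> P"
proof -
  have "hd ps \<subseteq> P" using assms(1,2,5) by (cases ps) (auto simp: prime_chain_def)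
  moreover have "p \<subseteq> P" using assms(1,5) by (auto simp: prime_chain_def)
  ultimately show ?thesis using assms by blast
qed

lemma prime_chain_tl: "prime_chain (p # ps) \<Longrightarrow> prime_chain ps"
  by (simp add: prime_chain_def)

text \<open>Krull's height theorem in the form needed. Each generator x i is pushed into all primes
  but the first and then counted as part of B; dropping the first prime costs one unit of length per
  generator. With no generator left, every prime of the chain is N.\<close>

lemma prime_chain_length_le:
  assumes "finite D" "B \<subseteq> carrier R" "x ` D \<subseteq> carrier R" "N = Idl (B \<union> x ` D)"
    and "prime_chain ps" "\<And>P. P \<in> set ps \<Longrightarrow> B \<subseteq> P"
  shows "length ps \<le> Suc (card D)"
  using assms
proof (induction D arbitrary: B ps)
  case empty
  have eq: "P = N" if "P \<in> set ps" for P
  proof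
    have P: "primeideal P R" using empty.prems(4) that by (simp add: prime_chain_def)
    show "P \<subseteq> N" by (rule prime_subset_N[OF P])
    show "N \<subseteq> P" using empty.prems genideal_minimal[OF primeideal.axioms(1)[OF P]] that by simp
  qed
  show ?case
  proof (rule ccontr)
    assume "\<not> ?thesis"
    then obtain p q rs where "ps = p # q # rs" by (cases ps; cases "tl ps") auto
    then show False using eq empty.prems(4) by (auto simp: prime_chain_def)
  qed
next
  case (insert i D)
  show ?case
  proof (cases "length ps \<le> 1")
    case False
    then obtain p qs where ps: "ps = p # qs" "qs \<noteq> []" by (cases ps) auto
    have c: "B \<union> x ` insert i D \<subseteq> carrier R" using insert.prems by auto
    have xN: "x i \<in> N" using genideal_self[OF c] insert.prems(3) by blast
    obtain qs' where qs': "prime_chain (p # qs')" "length qs' = length qs" "x i \<in> hd qs'"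
      using prime_chain_push_N[of p qs "x i"] insert.prems(4) ps xN by blast
    have ne: "qs' \<noteq> []" using qs'(2) ps by auto
    have "length qs' \<le> Suc (card D)"
    proof (rule insert.IH)
      show "insert (x i) B \<subseteq> carrier R" "x ` D \<subseteq> carrier R" using insert.prems by auto
      show "N = Idl (insert (x i) B \<union> x ` D)" using insert.prems(3) by simp
      show "prime_chain qs'" using prime_chain_tl qs' by blast
      have "B \<subseteq> p" using insert.prems(5) ps by simp
      then show "\<And>P. P \<in> set qs' \<Longrightarrow> insert (x i) B \<subseteq> P"
        using prime_chain_tl_contains[OF qs'(1) ne _ qs'(3)] by blast
    qed
    then show ?thesis using ps qs'(2) insert.hyps by simp
  qed simp
qed


text \<open>Modulo b + (x i) the coefficients c already come from w; let v j be the coefficient of x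
  i in the remainder. The new row and column of the matrix are -v and v. Since the contribution of w
  to the relation cancels, x i (c i + sum of v j x j) lies in b, and x i can be cancelled because b
  is prime.\<close>

lemma extend_koszul_syzygy:
  assumes D: "finite D" "i \<notin> D" and b: "primeideal b R"
    and x: "\<And>j. j \<in> insert i D \<Longrightarrow> x j \<in> carrier R" "x i \<notin> b"
    and c: "\<And>j. j \<in> insert i D \<Longrightarrow> c j \<in> carrier R"
    and sum: "(\<Oplus>j\<in>insert i D. c j \<otimes> x j) \<in> b"
    and w: "alternating D w"
    and cw: "\<And>j. j \<in> D \<Longrightarrow> c j \<ominus> (\<Oplus>k\<in>D. w j k \<otimes> x k) \<in> b <+>\<^bsub>R\<^esub> PIdl (x i)"
  shows "\<exists>w. alternating (insert i D) w \<and>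
     (\<forall>j\<in>insert i D. c j \<ominus> (\<Oplus>k\<in>insert i D. w j k \<otimes> x k) \<in> b)"
proof -
  interpret b: primeideal b R by fact
  have wc: "w j k \<in> carrier R" "w j j = \<zero>" and ws: "w j k = \<ominus> w k j" if "j \<in> D" "k \<in> D" for j k
    by (fact alternatingD[OF w that])+
  have xi: "x i \<in> carrier R" "c i \<in> carrier R" and xD: "\<And>j. j \<in> D \<Longrightarrow> x j \<in> carrier R"
    and cD: "\<And>j. j \<in> D \<Longrightarrow> c j \<in> carrier R" using x c by auto
  define s where "s j = (\<Oplus>k\<in>D. w j k \<otimes> x k)" for j
  have sc: "s j \<in> carrier R" if "j \<in> D" for j
    unfolding s_def using that wc xD by (auto intro!: finsum_closed)
  have "\<exists>v\<in>carrier R. (c j \<ominus> s j) \<ominus> v \<otimes> x i \<in> b" if j: "j \<in> D" for j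
  proof -
    obtain u r where u: "u \<in> b" "r \<in> carrier R" "c j \<ominus> s j = u \<oplus> r \<otimes> x i"
      using cw[OF j] add_principal_mem[OF b.is_ideal xi(1)] unfolding s_def by blast
    have "(c j \<ominus> s j) \<ominus> r \<otimes> x i = u"
      using u b.Icarr xi by (simp add: add_minus_cancel)
    then show ?thesis using u by blast
  qed
  then obtain v where v: "\<And>j. j \<in> D \<Longrightarrow> v j \<in> carrier R" "\<And>j. j \<in> D \<Longrightarrow> (c j \<ominus> s j) \<ominus> v j \<otimes> x i \<in> b"
    by metis
  define e where "e = (\<Oplus>j\<in>D. v j \<otimes> x j)"
  define S where "S = (\<Oplus>j\<in>D. c j \<otimes> x j)"
  have ec: "e \<in> carrier R" "S \<in> carrier R" unfolding e_def S_def using v xD cD by (auto intro!: finsum_closed)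
  have "(\<Oplus>j\<in>D. x j \<otimes> ((c j \<ominus> s j) \<ominus> v j \<otimes> x i)) \<in> b"
    by (rule ideal_finsum[OF b.is_ideal]) (use v xD b.I_l_closed in auto)
  also have "(\<Oplus>j\<in>D. x j \<otimes> ((c j \<ominus> s j) \<ominus> v j \<otimes> x i)) =
      (\<Oplus>j\<in>D. c j \<otimes> x j \<oplus> (\<ominus> (s j \<otimes> x j) \<oplus> \<ominus> x i \<otimes> (v j \<otimes> x j)))"
  proof (rule finsum_cong')
    fix j assume j: "j \<in> D"
    have "x' \<otimes> ((c' \<ominus> s') \<ominus> v' \<otimes> x i) = c' \<otimes> x' \<oplus> (\<ominus> (s' \<otimes> x') \<oplus> \<ominus> x i \<otimes> (v' \<otimes> x'))"
      if "x' \<in> carrier R" "c' \<in> carrier R" "s' \<in> carrier R" "v' \<in> carrier R" for x' c' s' v'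
      using that xi(1) by algebra
    from this[OF xD[OF j] cD[OF j] sc[OF j] v(1)[OF j]]
    show "x j \<otimes> ((c j \<ominus> s j) \<ominus> v j \<otimes> x i) = c j \<otimes> x j \<oplus> (\<ominus> (s j \<otimes> x j) \<oplus> \<ominus> x i \<otimes> (v j \<otimes> x j))" .
  qed (use v xD cD sc xi in auto)
  also have "\<dots> = S \<oplus> ((\<Oplus>j\<in>D. \<ominus> (s j \<otimes> x j)) \<oplus> (\<Oplus>j\<in>D. \<ominus> x i \<otimes> (v j \<otimes> x j)))"
    unfolding S_def using v(1) xD cD sc xi by (subst finsum_addf, (auto)[2])+ simp
  also have "(\<Oplus>j\<in>D. \<ominus> x i \<otimes> (v j \<otimes> x j)) = \<ominus> x i \<otimes> e"
    unfolding e_def using v(1) xD xi D(1) by (subst finsum_rdistr) auto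
  also have "(\<Oplus>j\<in>D. \<ominus> (s j \<otimes> x j)) = (\<Oplus>j\<in>D. \<Oplus>k\<in>D. \<ominus> (w j k \<otimes> x k \<otimes> x j))"
  proof (rule finsum_cong')
    fix j assume j: "j \<in> D"
    have "\<ominus> (s j \<otimes> x j) = s j \<otimes> (\<ominus> x j)" using sc xD j by (simp add: r_minus)
    also have "\<dots> = (\<Oplus>k\<in>D. w j k \<otimes> x k \<otimes> (\<ominus> x j))"
      unfolding s_def using wc xD j D(1) by (intro finsum_ldistr) auto
    also have "\<dots> = (\<Oplus>k\<in>D. \<ominus> (w j k \<otimes> x k \<otimes> x j))"
      using wc xD j by (intro finsum_cong') (auto simp: r_minus)
    finally show "\<ominus> (s j \<otimes> x j) = (\<Oplus>k\<in>D. \<ominus> (w j k \<otimes> x k \<otimes> x j))" .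
  qed (use wc xD in \<open>auto intro!: finsum_closed\<close>)
  also have "\<dots> = \<zero>"
  proof (rule alternating_sum_zero[OF D(1)])
    have "\<ominus> (w j k \<otimes> x k \<otimes> x j) = \<ominus> (\<ominus> (w k j \<otimes> x j \<otimes> x k))" if "j \<in> D" "k \<in> D" for j k
    proof -
      have "w k j \<in> carrier R" "x j \<in> carrier R" "x k \<in> carrier R" using wc xD that by auto
      then show ?thesis unfolding ws[OF that] by (simp add: l_minus r_minus m_ac)
    qed
    then show "alternating D (\<lambda>j k. \<ominus> (w j k \<otimes> x k \<otimes> x j))"
      using wc xD unfolding alternating_def by simp
  qed
  finally have 1: "S \<oplus> (\<zero> \<oplus> \<ominus> x i \<otimes> e) \<in> b" .
  have 2: "c i \<otimes> x i \<oplus> S \<in> b"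
    using sum D xi cD xD by (simp add: finsum_insert S_def)
  have "(c i \<otimes> x i \<oplus> S) \<ominus> (S \<oplus> (\<zero> \<oplus> \<ominus> x i \<otimes> e)) \<in> b"
    unfolding minus_eq using 1 2 b.a_closed b.a_inv_closed by blast
  moreover have "(c i \<otimes> x i \<oplus> S) \<ominus> (S \<oplus> (\<zero> \<oplus> \<ominus> x i \<otimes> e)) = x i \<otimes> (c i \<oplus> e)"
    using xi ec by algebra
  ultimately have "x i \<otimes> (c i \<oplus> e) \<in> b" by (simp only:)
  then have "c i \<oplus> e \<in> b" using b.I_prime[of "x i" "c i \<oplus> e"] xi ec x(2) by blast
  then have ci: "c i \<ominus> (\<ominus> e) \<in> b" using ec by (simp add: minus_eq)
  define w' where "w' j k = (if j = i then if k = i then \<zero> else \<ominus> v k else if k = i then v j else w j k)" for j k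
  have ij: "j \<noteq> i" if "j \<in> D" for j using D that by blast
  have "alternating (insert i D) w'"
    unfolding alternating_def
  proof (intro ballI)
    fix j k assume jk: "j \<in> insert i D" "k \<in> insert i D"
    show "w' j k \<in> carrier R \<and> w' j j = \<zero> \<and> w' j k = \<ominus> w' k j"
    proof (cases "j = i \<or> k = i")
      case True
      then show ?thesis using jk v(1) wc(2) ij unfolding w'_def by auto
    next
      case False
      then have "j \<in> D" "k \<in> D" using jk by auto
      moreover have e: "w' j k = w j k" "w' k j = w k j" "w' j j = w j j" using False by (auto simp: w'_def)
      ultimately show ?thesis unfolding e using wc[of j k] ws[of j k] by blast
    qed
  qed
  moreover have "c j \<ominus> (\<Oplus>k\<in>insert i D. w' j k \<otimes> x k) \<in> b" if j: "j \<in> insert i D" for j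
  proof (cases "j = i")
    case True
    have "(\<Oplus>k\<in>insert i D. w' j k \<otimes> x k) = w' j i \<otimes> x i \<oplus> (\<Oplus>k\<in>D. w' j k \<otimes> x k)"
      using D xi xD v(1) ij True by (intro finsum_insert) (auto simp: w'_def)
    also have "(\<Oplus>k\<in>D. w' j k \<otimes> x k) = (\<Oplus>k\<in>D. \<ominus> \<one> \<otimes> (v k \<otimes> x k))"
      using xD v(1) ij True by (intro finsum_cong') (auto simp: w'_def l_minus)
    also have "\<dots> = \<ominus> \<one> \<otimes> e"
      unfolding e_def using D(1) v(1) xD by (intro finsum_rdistr[symmetric]) auto
    finally show ?thesis using ci True xi ec by (simp add: w'_def l_minus)
  next
    case False
    then have jD: "j \<in> D" using j by blast
    have "(\<Oplus>k\<in>insert i D. w' j k \<otimes> x k) = w' j i \<otimes> x i \<oplus> (\<Oplus>k\<in>D. w' j k \<otimes> x k)"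
      using D xi xD v(1) ij False jD wc by (intro finsum_insert) (auto simp: w'_def)
    also have "(\<Oplus>k\<in>D. w' j k \<otimes> x k) = s j"
      unfolding s_def using xD ij jD wc by (intro finsum_cong') (auto simp: w'_def)
    finally have "(\<Oplus>k\<in>insert i D. w' j k \<otimes> x k) = v j \<otimes> x i \<oplus> s j" using False by (simp add: w'_def)
    moreover have "c j \<ominus> (v j \<otimes> x i \<oplus> s j) = (c j \<ominus> s j) \<ominus> v j \<otimes> x i"
    proof -
      have "c j \<in> carrier R" "v j \<in> carrier R" "s j \<in> carrier R" using cD v sc jD by auto
      then show ?thesis using xi(1) by algebra
    qed
    ultimately show ?thesis using v(2)[OF jD] by simp
  qed
  ultimately show ?thesis by blast
qed

text \<open>The chain has the greatest length that \<open>prime_chain_length_le\<close> allows,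
  which is how regularity of the ring modulo B is expressed. Primality of Idl B is proved along with
  the Koszul property because \<open>extend_koszul_syzygy\<close> must cancel a parameter at each
  step.\<close>

lemma regular_parameters:
  assumes "finite D" "B \<subseteq> carrier R" "x ` D \<subseteq> carrier R" "N = Idl (B \<union> x ` D)"
    and "prime_chain ps" "length ps = Suc (card D)" "\<And>P. P \<in> set ps \<Longrightarrow> B \<subseteq> P"
  shows "primeideal (Idl B) R \<and>
    (\<forall>c. (\<forall>i\<in>D. c i \<in> carrier R) \<longrightarrow> (\<Oplus>i\<in>D. c i \<otimes> x i) \<in> Idl B \<longrightarrow>
      (\<exists>w. alternating D w \<and> (\<forall>i\<in>D. c i \<ominus> (\<Oplus>j\<in>D. w i j \<otimes> x j) \<in> Idl B)))"
  using assms
proof (induction "card D" arbitrary: D B ps)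
  case 0
  then have "D = {}" by simp
  then have "N = Idl B" using 0 by simp
  then show ?case using prime_N \<open>D = {}\<close> by (auto simp: alternating_def)
next
  case (Suc d)
  obtain p qs where ps: "ps = p # qs" "qs \<noteq> []"
    using Suc.prems(6) Suc.hyps(2) by (cases ps; cases "tl ps") auto
  have p: "primeideal p R" and Bp: "B \<subseteq> p" using Suc.prems(5,7) ps by (auto simp: prime_chain_def)
  interpret p: primeideal p R by fact
  have pn: "p \<noteq> N"
  proof
    assume "p = N"
    moreover have "p \<subset> hd qs" "primeideal (hd qs) R"
      using ps Suc.prems(5) by (auto simp: prime_chain_def)
    ultimately show False using prime_subset_N by blast
  qed
  have carr: "B \<union> x ` D \<subseteq> carrier R" using Suc.prems by auto
  \<comment> \<open>The chain has at least two members, so p differs from N and misses some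
    generator x i.\<close>
  obtain i where i: "i \<in> D" "x i \<notin> p"
  proof (rule ccontr)
    assume "\<not> thesis"
    then have "x ` D \<subseteq> p" using that by blast
    then have "N \<subseteq> p" unfolding Suc.prems(4) using Bp by (intro genideal_minimal[OF p.is_ideal]) simp
    then show False using pn prime_subset_N[OF p] by blast
  qed
  have xi: "x i \<in> carrier R" "x i \<in> N" using i carr genideal_self[OF carr] Suc.prems(4) by auto
  obtain qs' where qs': "prime_chain (p # qs')" "length qs' = length qs" "x i \<in> hd qs'"
    using prime_chain_push_N[of p qs "x i"] Suc.prems(5) ps xi(2) by blast
  have ne: "qs' \<noteq> []" using qs'(2) ps by auto
  define D' where "D' = D - {i}"
  define B' where "B' = insert (x i) B"
  have D': "D = insert i D'" "i \<notin> D'" "finite D'" "card D' = d"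
    using i Suc.prems(1) Suc.hyps(2) by (auto simp: D'_def)
  have un: "B' \<union> x ` D' = B \<union> x ` D" unfolding B'_def D'(1) by blast
  have N': "N = Idl (B' \<union> x ` D')" unfolding un by (rule Suc.prems(4))
  have sub': "B' \<subseteq> carrier R" "x ` D' \<subseteq> carrier R" using carr unfolding un[symmetric] by blast+
  note prems' = sub' N' prime_chain_tl[OF qs'(1)]
  have prems'': "B' \<subseteq> P" if "P \<in> set qs'" for P
    unfolding B'_def by (rule prime_chain_tl_contains[OF qs'(1) ne Bp qs'(3) that])
  have len: "length qs' = Suc (card D')" using qs'(2) ps(1) Suc.prems(6) Suc.hyps(2) D'(4) by simp
  note ih = Suc.hyps(1)[OF D'(4)[symmetric] D'(3) prems'(1-4) len prems'']
  have IH: "primeideal (Idl B') R"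
    "\<And>c. (\<forall>i\<in>D'. c i \<in> carrier R) \<Longrightarrow> (\<Oplus>i\<in>D'. c i \<otimes> x i) \<in> Idl B' \<Longrightarrow>
      (\<exists>w. alternating D' w \<and> (\<forall>i\<in>D'. c i \<ominus> (\<Oplus>j\<in>D'. w i j \<otimes> x j) \<in> Idl B'))"
    using conjunct1[OF ih] conjunct2[OF ih] by - (assumption, blast)
  have q: "primeideal (hd qs') R" "p \<subset> hd qs'" and hs: "hd qs' \<in> set qs'"
    using qs'(1) ne by (auto simp: prime_chain_def)
  have le: "Idl B' \<subseteq> hd qs'"
    using genideal_minimal[OF primeideal.axioms(1)[OF q(1)] prems''[OF hs]] .
  \<comment> \<open>If the inclusion were strict, the prime Idl B' could be put in front of
    \<open>qs'\<close>, giving a chain longer than the remaining generators permit.\<close>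
  have "Idl B' = hd qs'"
  proof (rule ccontr)
    assume n: "Idl B' \<noteq> hd qs'"
    have "Idl B' \<subset> P" if "P \<in> set qs'" for P
    proof -
      have "hd qs' \<subseteq> P" using that qs'(1) ne by (cases qs') (auto simp: prime_chain_def)
      then show ?thesis using n le by blast
    qed
    then have "prime_chain (Idl B' # qs')" using IH(1) prems'(4) by (simp add: prime_chain_def)
    moreover have "\<And>P. P \<in> set (Idl B' # qs') \<Longrightarrow> B' \<subseteq> P"
      using prems'' genideal_self[OF prems'(1)] by auto
    ultimately show False
      using prime_chain_length_le[OF D'(3) prems'(1-3), of "Idl B' # qs'"] len by simp
  qed
  then have pB': "p \<subset> Idl B'" using q by simp
  have BI: "ideal (Idl B) R" by (rule genideal_ideal[OF Suc.prems(2)])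
  have B'eq: "Idl B' = Idl B <+>\<^bsub>R\<^esub> PIdl (x i)"
    unfolding B'_def by (rule genideal_insert[OF Suc.prems(2) xi(1)])
  have Bp': "Idl B \<subseteq> p" by (rule genideal_minimal[OF p.is_ideal Bp])
  have NpI: "ideal (N \<cdot>\<^bsub>R\<^esub> p) R" by (rule ideal_prod_is_ideal[OF ideal_N p.is_ideal])
  have sumI: "ideal (Idl B <+>\<^bsub>R\<^esub> N \<cdot>\<^bsub>R\<^esub> p) R" by (rule add_ideals[OF BI NpI])
  \<comment> \<open>An element of p has the form u + r x i with u in Idl B, and r is in p because x
    i is not. Thus p = Idl B + N p, and Nakayama applies.\<close>
  have "p = Idl B"
  proof (rule nakayama_saturated[OF prime_N BI p.is_ideal Bp' saturation_N[OF BI]])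
    show "p \<subseteq> saturation R N (Idl B <+>\<^bsub>R\<^esub> N \<cdot>\<^bsub>R\<^esub> p)"
    proof
      fix a assume a: "a \<in> p"
      then have "a \<in> Idl B <+>\<^bsub>R\<^esub> PIdl (x i)" using pB' B'eq by blast
      then obtain u r where u: "u \<in> Idl B" "r \<in> carrier R" "a = u \<oplus> r \<otimes> x i"
        using add_principal_mem[OF BI xi(1)] by blast
      have uc: "u \<in> carrier R" "u \<in> p" using u ideal.Icarr[OF BI] Bp' by auto
      have "r \<otimes> x i = a \<ominus> u"
        using uc(1) u(2) xi(1) add_minus_cancel[of "r \<otimes> x i" u] unfolding u(3) by (simp add: a_comm)
      also have "\<dots> \<in> p" unfolding minus_eq using a uc p.a_closed p.a_inv_closed by blast
      finally have "r \<in> p" using p.I_prime u(2) xi i(2) by blast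
      then have "x i \<otimes> r \<in> N \<cdot>\<^bsub>R\<^esub> p" using xi(2) by (auto intro: ideal_prod.prod)
      then have "a \<in> Idl B <+>\<^bsub>R\<^esub> N \<cdot>\<^bsub>R\<^esub> p"
        unfolding set_add_def' using u xi(1) by (auto simp: m_comm)
      then show "a \<in> saturation R N (Idl B <+>\<^bsub>R\<^esub> N \<cdot>\<^bsub>R\<^esub> p)"
        using saturation_upper[OF prime_N sumI] by blast
    qed
  qed
  then have Bprime: "primeideal (Idl B) R" and xiB: "x i \<notin> Idl B" using p i by auto
  have "\<exists>w. alternating D w \<and> (\<forall>i\<in>D. c i \<ominus> (\<Oplus>j\<in>D. w i j \<otimes> x j) \<in> Idl B)"
    if c: "\<forall>i\<in>D. c i \<in> carrier R" and s: "(\<Oplus>i\<in>D. c i \<otimes> x i) \<in> Idl B" for c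
  proof -
    have xD: "\<And>j. j \<in> D \<Longrightarrow> x j \<in> carrier R" using Suc.prems(3) by auto
    have xD': "\<And>j. j \<in> D' \<Longrightarrow> x j \<in> carrier R" and cD': "\<And>j. j \<in> D' \<Longrightarrow> c j \<in> carrier R"
      and ci: "c i \<in> carrier R"
      using xD c D'(1) by auto
    have *: "(\<Oplus>i\<in>D. c i \<otimes> x i) = c i \<otimes> x i \<oplus> (\<Oplus>j\<in>D'. c j \<otimes> x j)"
      using D' xD' cD' ci xi(1) by (simp add: finsum_insert)
    have Sc: "(\<Oplus>j\<in>D'. c j \<otimes> x j) \<in> carrier R" using xD' cD' by (auto intro!: finsum_closed)
    interpret B': ideal "Idl B'" R using IH(1) primeideal.axioms(1) by blast
    have "x i \<in> Idl B'" using genideal_self[OF prems'(1)] by (auto simp: B'_def)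
    then have in': "(\<Oplus>i\<in>D. c i \<otimes> x i) \<in> Idl B'" "c i \<otimes> x i \<in> Idl B'"
      using s \<open>p = Idl B\<close> pB' B'.I_l_closed ci by blast+
    have "(\<Oplus>j\<in>D'. c j \<otimes> x j) = (c i \<otimes> x i \<oplus> (\<Oplus>j\<in>D'. c j \<otimes> x j)) \<ominus> c i \<otimes> x i"
      unfolding a_comm[OF m_closed[OF ci xi(1)] Sc]
      by (rule add_minus_cancel[OF Sc m_closed[OF ci xi(1)], symmetric])
    also have "\<dots> \<in> Idl B'" unfolding minus_eq *[symmetric] using in' B'.a_closed B'.a_inv_closed by blast
    finally obtain w where w: "alternating D' w" "\<forall>i\<in>D'. c i \<ominus> (\<Oplus>j\<in>D'. w i j \<otimes> x j) \<in> Idl B'"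
      using IH(2)[of c] cD' by blast
    have "\<exists>w. alternating (insert i D') w \<and>
        (\<forall>j\<in>insert i D'. c j \<ominus> (\<Oplus>k\<in>insert i D'. w j k \<otimes> x k) \<in> Idl B)"
    proof (rule extend_koszul_syzygy[where x = x and c = c and w = w, OF D'(3,2) Bprime _ xiB _ _ w(1)])
      show "(\<Oplus>j\<in>insert i D'. c j \<otimes> x j) \<in> Idl B" using s unfolding D'(1) .
      show "\<And>j. j \<in> D' \<Longrightarrow> c j \<ominus> (\<Oplus>k\<in>D'. w j k \<otimes> x k) \<in> Idl B <+>\<^bsub>R\<^esub> PIdl (x i)"
        using w(2) unfolding B'eq by blast
      show "\<And>j. j \<in> insert i D' \<Longrightarrow> x j \<in> carrier R" using xD unfolding D'(1) by blast
      show "\<And>j. j \<in> insert i D' \<Longrightarrow> c j \<in> carrier R" using c unfolding D'(1) by blast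
    qed
    then show ?thesis unfolding D'(1) .
  qed
  then show ?case using Bprime by blast
qed

end

section \<open>Operators on the Koszul complex\<close>

context cring
begin

lemma rsign_closed [simp]: "x \<in> carrier R \<Longrightarrow> rsign R k x \<in> carrier R"
  by (simp add: rsign_def)

lemma rsign_zero [simp]: "rsign R k \<zero> = \<zero>"
  by (simp add: rsign_def)

lemma rsign_rsign: "x \<in> carrier R \<Longrightarrow> rsign R k (rsign R l x) = rsign R (k + l) x"
  by (simp add: rsign_def)

lemma rsign_add:
  "x \<in> carrier R \<Longrightarrow> y \<in> carrier R \<Longrightarrow> rsign R k (x \<oplus> y) = rsign R k x \<oplus> rsign R k y"
  by (simp add: rsign_def minus_add)

lemma rsign_mult:
  "c \<in> carrier R \<Longrightarrow> x \<in> carrier R \<Longrightarrow> rsign R k (c \<otimes> x) = c \<otimes> rsign R k x"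
  by (simp add: rsign_def r_minus)

lemma rsign_odd: "x \<in> carrier R \<Longrightarrow> odd (k + l) \<Longrightarrow> rsign R k x = \<ominus> rsign R l x"
  by (auto simp: rsign_def)

text \<open>Operators act on all R-valued functions on sets, without support or degree conditions;
  these return through \<open>kdeg\<close> where homology is formed.\<close>

definition klinear :: "((nat set \<Rightarrow> 'a) \<Rightarrow> nat set \<Rightarrow> 'a) \<Rightarrow> bool" where
  "klinear F \<longleftrightarrow> (\<forall>e\<in>UNIV \<rightarrow> carrier R. F e \<in> UNIV \<rightarrow> carrier R) \<and>
    (\<forall>e\<in>UNIV \<rightarrow> carrier R. \<forall>e'\<in>UNIV \<rightarrow> carrier R. F (\<lambda>T. e T \<oplus> e' T) = (\<lambda>T. F e T \<oplus> F e' T)) \<and>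
    (\<forall>c\<in>carrier R. \<forall>e\<in>UNIV \<rightarrow> carrier R. F (\<lambda>T. c \<otimes> e T) = (\<lambda>T. c \<otimes> F e T))"

lemma klinearI:
  assumes "\<And>e T. e \<in> UNIV \<rightarrow> carrier R \<Longrightarrow> F e T \<in> carrier R"
    and "\<And>e e' T. e \<in> UNIV \<rightarrow> carrier R \<Longrightarrow> e' \<in> UNIV \<rightarrow> carrier R \<Longrightarrow>
      F (\<lambda>T. e T \<oplus> e' T) T = F e T \<oplus> F e' T"
    and "\<And>c e T. c \<in> carrier R \<Longrightarrow> e \<in> UNIV \<rightarrow> carrier R \<Longrightarrow> F (\<lambda>T. c \<otimes> e T) T = c \<otimes> F e T"
  shows "klinear F"
  using assms unfolding klinear_def by (intro conjI ballI Pi_I ext) blast+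

lemma klinearD:
  assumes "klinear F" "e \<in> UNIV \<rightarrow> carrier R"
  shows "F e \<in> UNIV \<rightarrow> carrier R" "F e T \<in> carrier R"
    and "e' \<in> UNIV \<rightarrow> carrier R \<Longrightarrow> F (\<lambda>T. e T \<oplus> e' T) = (\<lambda>T. F e T \<oplus> F e' T)"
    and "c \<in> carrier R \<Longrightarrow> F (\<lambda>T. c \<otimes> e T) = (\<lambda>T. c \<otimes> F e T)"
  using assms unfolding klinear_def by blast+

lemma klinear_zero:
  assumes "klinear F"
  shows "F (\<lambda>T. \<zero>) = (\<lambda>T. \<zero>)"
proof -
  have "F (\<lambda>T. \<zero> \<otimes> \<zero>) = (\<lambda>T. \<zero> \<otimes> F (\<lambda>T. \<zero>) T)"
    by (rule klinearD(4)[OF assms]) auto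
  then show ?thesis using klinearD(2)[OF assms, of "\<lambda>T. \<zero>"] by simp
qed

lemma klinear_uminus:
  assumes "klinear F" "e \<in> UNIV \<rightarrow> carrier R"
  shows "F (\<lambda>T. \<ominus> e T) = (\<lambda>T. \<ominus> F e T)"
proof -
  have "(\<lambda>T. \<ominus> e T) = (\<lambda>T. (\<ominus> \<one>) \<otimes> e T)"
  proof
    fix T
    have "e T \<in> carrier R" using assms(2) by auto
    then show "\<ominus> e T = (\<ominus> \<one>) \<otimes> e T" by (simp add: l_minus)
  qed
  then have "F (\<lambda>T. \<ominus> e T) = (\<lambda>T. (\<ominus> \<one>) \<otimes> F e T)"
    using klinearD(4)[OF assms, of "\<ominus> \<one>"] by simp
  then show ?thesis using klinearD(2)[OF assms] by (simp add: l_minus)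
qed

lemma klinear_minus:
  assumes "klinear F" "e \<in> UNIV \<rightarrow> carrier R" "e' \<in> UNIV \<rightarrow> carrier R"
  shows "F (\<lambda>T. e T \<ominus> e' T) = (\<lambda>T. F e T \<ominus> F e' T)"
  using klinearD(3)[OF assms(1,2), of "\<lambda>T. \<ominus> e' T"] klinear_uminus[OF assms(1,3)] assms(3)
  by (simp add: minus_eq Pi_iff)

lemma klinear_lincomb:
  assumes F: "klinear F" and D: "finite D" "\<And>i. i \<in> D \<Longrightarrow> c i \<in> carrier R"
    "\<And>i. i \<in> D \<Longrightarrow> g i \<in> UNIV \<rightarrow> carrier R"
  shows "F (\<lambda>T. \<Oplus>i\<in>D. c i \<otimes> g i T) = (\<lambda>T. \<Oplus>i\<in>D. c i \<otimes> F (g i) T)"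
  using D
proof (induction D)
  case empty
  then show ?case using klinear_zero[OF F] by simp
next
  case (insert k D)
  have g: "\<And>i T. i \<in> insert k D \<Longrightarrow> g i T \<in> carrier R" using insert.prems(2) by auto
  have Fg: "\<And>i T. i \<in> insert k D \<Longrightarrow> F (g i) T \<in> carrier R"
    using klinearD(2)[OF F insert.prems(2)] by blast
  have "(\<lambda>T. \<Oplus>i\<in>insert k D. c i \<otimes> g i T) = (\<lambda>T. c k \<otimes> g k T \<oplus> (\<Oplus>i\<in>D. c i \<otimes> g i T))"
    using insert.hyps insert.prems(1) g by (intro ext finsum_insert) auto
  then have "F (\<lambda>T. \<Oplus>i\<in>insert k D. c i \<otimes> g i T) =
      F (\<lambda>T. c k \<otimes> g k T \<oplus> (\<Oplus>i\<in>D. c i \<otimes> g i T))" by simp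
  also have "\<dots> = (\<lambda>T. F (\<lambda>T. c k \<otimes> g k T) T \<oplus> F (\<lambda>T. \<Oplus>i\<in>D. c i \<otimes> g i T) T)"
    by (rule klinearD(3)[OF F]) (use insert.prems(1) g in \<open>auto intro!: finsum_closed\<close>)
  also have "F (\<lambda>T. c k \<otimes> g k T) = (\<lambda>T. c k \<otimes> F (g k) T)"
    by (rule klinearD(4)[OF F]) (use insert.prems in auto)
  also have "F (\<lambda>T. \<Oplus>i\<in>D. c i \<otimes> g i T) = (\<lambda>T. \<Oplus>i\<in>D. c i \<otimes> F (g i) T)"
    using insert by simp
  also have "(\<lambda>T. c k \<otimes> F (g k) T \<oplus> (\<Oplus>i\<in>D. c i \<otimes> F (g i) T)) =
      (\<lambda>T. \<Oplus>i\<in>insert k D. c i \<otimes> F (g i) T)"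
    using insert.hyps insert.prems(1) Fg by (intro ext finsum_insert[symmetric]) auto
  finally show ?case .
qed

lemma klinear_sum:
  assumes D: "finite D" "\<And>i. i \<in> D \<Longrightarrow> c i \<in> carrier R" "\<And>i. i \<in> D \<Longrightarrow> klinear (F i)"
  shows "klinear (\<lambda>e T. \<Oplus>i\<in>D. c i \<otimes> F i e T)"
proof (rule klinearI)
  note cl = klinearD(2)[OF D(3)]
  fix e :: "nat set \<Rightarrow> 'a" and T assume e: "e \<in> UNIV \<rightarrow> carrier R"
  show "(\<Oplus>i\<in>D. c i \<otimes> F i e T) \<in> carrier R" using D(2) cl e by (auto intro!: finsum_closed)
next
  note cl = klinearD(2)[OF D(3)]
  fix e e' :: "nat set \<Rightarrow> 'a" and T assume e: "e \<in> UNIV \<rightarrow> carrier R" "e' \<in> UNIV \<rightarrow> carrier R"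
  have "(\<Oplus>i\<in>D. c i \<otimes> F i (\<lambda>T. e T \<oplus> e' T) T) = (\<Oplus>i\<in>D. c i \<otimes> F i e T \<oplus> c i \<otimes> F i e' T)"
    using D(2) cl e klinearD(3)[OF D(3) e(1) e(2)] by (intro finsum_cong') (auto simp: r_distr)
  then show "(\<Oplus>i\<in>D. c i \<otimes> F i (\<lambda>T. e T \<oplus> e' T) T) =
      (\<Oplus>i\<in>D. c i \<otimes> F i e T) \<oplus> (\<Oplus>i\<in>D. c i \<otimes> F i e' T)"
    using D(2) cl e by (simp add: finsum_addf Pi_iff)
next
  note cl = klinearD(2)[OF D(3)]
  fix b and e :: "nat set \<Rightarrow> 'a" and T assume e: "b \<in> carrier R" "e \<in> UNIV \<rightarrow> carrier R"
  have "(\<Oplus>i\<in>D. c i \<otimes> F i (\<lambda>T. b \<otimes> e T) T) = (\<Oplus>i\<in>D. b \<otimes> (c i \<otimes> F i e T))"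
    using D(2) cl e klinearD(4)[OF D(3) e(2) e(1)] by (intro finsum_cong') (auto simp: m_lcomm)
  then show "(\<Oplus>i\<in>D. c i \<otimes> F i (\<lambda>T. b \<otimes> e T) T) = b \<otimes> (\<Oplus>i\<in>D. c i \<otimes> F i e T)"
    using D e cl by (simp add: finsum_rdistr Pi_iff)
qed

end

definition below :: "nat set \<Rightarrow> nat \<Rightarrow> nat" where
  "below U j = card {t \<in> U. t < j}"

lemma below_insert:
  assumes "j \<notin> U"
  shows "below (insert j U) k = below U k + (if j < k then 1 else 0)"
proof (cases "j < k")
  case True
  then have "{t \<in> insert j U. t < k} = insert j {t \<in> U. t < k}" by auto
  then show ?thesis using True assms by (simp add: below_def)
next
  case False
  then have "{t \<in> insert j U. t < k} = {t \<in> U. t < k}" by auto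
  then show ?thesis using False by (simp add: below_def)
qed

lemma below_remove:
  assumes "j \<in> U"
  shows "below U k = below (U - {j}) k + (if j < k then 1 else 0)"
  using below_insert[of j "U - {j}" k] assms by (simp add: insert_absorb)

context cring
begin

text \<open>Contraction with, and left multiplication by, the \<open>j\<close>-th basis vector of the exterior algebra.\<close>

definition kpart :: "nat \<Rightarrow> (nat set \<Rightarrow> 'a) \<Rightarrow> nat set \<Rightarrow> 'a" where
  "kpart j e U = (if j \<in> U then \<zero> else rsign R (below U j) (e (insert j U)))"

definition kext :: "nat \<Rightarrow> (nat set \<Rightarrow> 'a) \<Rightarrow> nat set \<Rightarrow> 'a" where
  "kext a e U = (if a \<in> U then rsign R (below U a) (e (U - {a})) else \<zero>)"

lemma klinear_kpart: "klinear (kpart j)"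
  by (rule klinearI) (auto simp: kpart_def rsign_add rsign_mult Pi_iff)

lemma klinear_kext: "klinear (kext j)"
  by (rule klinearI) (auto simp: kext_def rsign_add rsign_mult Pi_iff)

lemma kpart_kpart_same: "kpart j (kpart j e) U = \<zero>"
  by (simp add: kpart_def)

lemma kext_kext_same: "kext j (kext j e) U = \<zero>"
  by (simp add: kext_def)

text \<open>Exactly one of j and k lies below the other, so exactly one of the two orders counts an
  extra index.\<close>

lemma kpart_kpart_swap:
  assumes e: "e \<in> UNIV \<rightarrow> carrier R"
  shows "kpart j (kpart k e) U = \<ominus> kpart k (kpart j e) U"
proof (cases "j = k \<or> j \<in> U \<or> k \<in> U")
  case True
  then show ?thesis by (auto simp: kpart_def)
next
  case False
  then have n: "j \<noteq> k" "j \<notin> U" "k \<notin> U" by auto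
  have ec: "\<And>T. e T \<in> carrier R" using e by auto
  have "kpart j (kpart k e) U = rsign R (below U j + below (insert j U) k) (e (insert k (insert j U)))"
    using n ec by (simp add: kpart_def rsign_rsign)
  also have "\<dots> = \<ominus> rsign R (below U k + below (insert k U) j) (e (insert k (insert j U)))"
    by (rule rsign_odd) (use n ec in \<open>auto simp: below_insert\<close>)
  also have "\<dots> = \<ominus> kpart k (kpart j e) U"
    using n ec by (simp add: kpart_def rsign_rsign insert_commute)
  finally show ?thesis .
qed

lemma kext_kext_swap:
  assumes e: "e \<in> UNIV \<rightarrow> carrier R"
  shows "kext j (kext k e) U = \<ominus> kext k (kext j e) U"
proof (cases "j = k \<or> j \<notin> U \<or> k \<notin> U")
  case True
  then show ?thesis by (auto simp: kext_def)
next
  case False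
  then have n: "j \<noteq> k" "j \<in> U" "k \<in> U" by auto
  have ec: "\<And>T. e T \<in> carrier R" using e by auto
  have "kext j (kext k e) U = rsign R (below U j + below (U - {j}) k) (e (U - {j} - {k}))"
    using n ec by (simp add: kext_def rsign_rsign)
  also have "\<dots> = \<ominus> rsign R (below U k + below (U - {k}) j) (e (U - {j} - {k}))"
  proof (rule rsign_odd)
    show "odd (below U j + below (U - {j}) k + (below U k + below (U - {k}) j))"
      using n(1) unfolding below_remove[OF n(2), of k] below_remove[OF n(3), of j]
      by (cases "j < k") auto
  qed (rule ec)
  also have "U - {j} - {k} = U - {k} - {j}" by blast
  also have "\<ominus> rsign R (below U k + below (U - {k}) j) (e (U - {k} - {j})) = \<ominus> kext k (kext j e) U"
    using n ec by (simp add: kext_def rsign_rsign)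
  finally show ?thesis .
qed

text \<open>The Clifford relation between contraction and multiplication by basis vectors. The
  Leibniz rule \<open>kd_kmul\<close> is its bilinear extension.\<close>

lemma kpart_kext:
  assumes e: "e \<in> UNIV \<rightarrow> carrier R"
  shows "kpart j (kext a e) U \<oplus> kext a (kpart j e) U = (if j = a then e U else \<zero>)"
proof (cases "j = a")
  case True
  have ec: "\<And>T. e T \<in> carrier R" using e by auto
  show ?thesis
  proof (cases "j \<in> U")
    case True
    have "below U j = below (U - {j}) j" using below_remove[OF True, of j] by simp
    then have "rsign R (below U j) (rsign R (below (U - {j}) j) (e U)) = e U"
      using ec by (simp add: rsign_rsign rsign_def)
    then show ?thesis using True \<open>j = a\<close> ec by (simp add: kpart_def kext_def insert_absorb)
  next
    case False
    have "below (insert j U) j = below U j" using below_insert[OF False, of j] by simp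
    then have "rsign R (below U j) (rsign R (below (insert j U) j) (e U)) = e U"
      using ec by (simp add: rsign_rsign rsign_def)
    then show ?thesis using False \<open>j = a\<close> ec by (simp add: kpart_def kext_def)
  qed
next
  case ja: False
  have ec: "\<And>T. e T \<in> carrier R" using e by auto
  show ?thesis
  proof (cases "j \<notin> U \<and> a \<in> U")
    case False
    then show ?thesis using ja by (auto simp: kpart_def kext_def)
  next
    case True
    have *: "insert j U - {a} = insert j (U - {a})" using ja by auto
    have "kpart j (kext a e) U = rsign R (below U j + below (insert j U) a) (e (insert j (U - {a})))"
      using True ja ec * by (simp add: kpart_def kext_def rsign_rsign)
    also have "\<dots> = \<ominus> rsign R (below U a + below (U - {a}) j) (e (insert j (U - {a})))"
    proof (rule rsign_odd)
      have "j \<notin> U" "a \<in> U" using True by auto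
      then show "odd (below U j + below (insert j U) a + (below U a + below (U - {a}) j))"
        using ja below_remove[of a U j] below_insert[of j U a] by (cases "j < a") auto
    qed (rule ec)
    also have "\<dots> = \<ominus> kext a (kpart j e) U"
      using True ja ec by (simp add: kpart_def kext_def rsign_rsign)
    moreover have "kext a (kpart j e) U \<in> carrier R" using ec by (simp add: kpart_def kext_def)
    ultimately show ?thesis using ja by (simp add: l_neg)
  qed
qed

text \<open>The Koszul differential as a combination of contractions, with no restriction on the
  support of the argument; \<open>kdiff_eq_kd\<close> identifies it with \<open>kdiff\<close> on
  homogeneous elements.\<close>

definition kd :: "(nat \<Rightarrow> 'a) \<Rightarrow> nat \<Rightarrow> (nat set \<Rightarrow> 'a) \<Rightarrow> nat set \<Rightarrow> 'a" where
  "kd f n e = (\<lambda>U. \<Oplus>j\<in>{..<n}. f j \<otimes> kpart j e U)"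

text \<open>Exterior multiplication from the left by the degree one element with coordinates
  v.\<close>

definition kmul :: "(nat \<Rightarrow> 'a) \<Rightarrow> nat \<Rightarrow> (nat set \<Rightarrow> 'a) \<Rightarrow> nat set \<Rightarrow> 'a" where
  "kmul v n e = (\<lambda>U. \<Oplus>a\<in>{..<n}. v a \<otimes> kext a e U)"

lemma klinear_kd: "f \<in> {..<n} \<rightarrow> carrier R \<Longrightarrow> klinear (kd f n)"
  unfolding kd_def by (rule klinear_sum) (auto simp: klinear_kpart)

lemma klinear_kmul: "v \<in> {..<n} \<rightarrow> carrier R \<Longrightarrow> klinear (kmul v n)"
  unfolding kmul_def by (rule klinear_sum) (auto simp: klinear_kext)

lemma kd_kd:
  assumes f: "f \<in> {..<n} \<rightarrow> carrier R" and e: "e \<in> UNIV \<rightarrow> carrier R"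
  shows "kd f n (kd f n e) = (\<lambda>U. \<zero>)"
proof
  fix U
  note cl = klinearD(1)[OF klinear_kpart] 
  have fc: "\<And>j. j < n \<Longrightarrow> f j \<in> carrier R" using f by auto
  have kc: "\<And>j k. kpart j (kpart k e) U \<in> carrier R"
    using klinearD(2)[OF klinear_kpart klinearD(1)[OF klinear_kpart e]] .
  have "kd f n (kd f n e) U = (\<Oplus>j\<in>{..<n}. \<Oplus>k\<in>{..<n}. f j \<otimes> (f k \<otimes> kpart j (kpart k e) U))"
    unfolding kd_def
  proof (rule finsum_cong')
    fix j assume j: "j \<in> {..<n}"
    have "kpart j (\<lambda>U. \<Oplus>k\<in>{..<n}. f k \<otimes> kpart k e U) U = (\<Oplus>k\<in>{..<n}. f k \<otimes> kpart j (kpart k e) U)"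
      by (subst klinear_lincomb[OF klinear_kpart]) (use fc cl[OF e] in auto)
    then show "f j \<otimes> kpart j (\<lambda>U. \<Oplus>k\<in>{..<n}. f k \<otimes> kpart k e U) U =
        (\<Oplus>k\<in>{..<n}. f j \<otimes> (f k \<otimes> kpart j (kpart k e) U))"
      using j fc kc by (simp add: finsum_rdistr Pi_iff)
  qed (use fc kc in \<open>auto intro!: finsum_closed\<close>)
  also have "\<dots> = \<zero>"
  proof (rule alternating_sum_zero)
    show "alternating {..<n} (\<lambda>j k. f j \<otimes> (f k \<otimes> kpart j (kpart k e) U))"
      unfolding alternating_def
    proof (intro ballI conjI)
      fix j k assume jk: "j \<in> {..<n}" "k \<in> {..<n}"
      show "f j \<otimes> (f k \<otimes> kpart j (kpart k e) U) \<in> carrier R" using jk fc kc by auto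
      show "f j \<otimes> (f j \<otimes> kpart j (kpart j e) U) = \<zero>" using jk fc by (simp add: kpart_kpart_same)
      show "f j \<otimes> (f k \<otimes> kpart j (kpart k e) U) = \<ominus> (f k \<otimes> (f j \<otimes> kpart k (kpart j e) U))"
        using jk fc kc[of k j] by (subst kpart_kpart_swap[OF e]) (simp add: r_minus m_lcomm)
    qed
  qed simp
  finally show "kd f n (kd f n e) U = \<zero>" .
qed

lemma kmul_kmul:
  assumes u: "u \<in> {..<n} \<rightarrow> carrier R" and v: "v \<in> {..<n} \<rightarrow> carrier R" and e: "e \<in> UNIV \<rightarrow> carrier R"
  shows "kmul u n (kmul v n e) U = (\<Oplus>j\<in>{..<n}. \<Oplus>k\<in>{..<n}. u j \<otimes> (v k \<otimes> kext j (kext k e) U))"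
  unfolding kmul_def
proof (rule finsum_cong')
  have uc: "\<And>j. j < n \<Longrightarrow> u j \<in> carrier R" "\<And>j. j < n \<Longrightarrow> v j \<in> carrier R" using u v by auto
  have kc: "\<And>j k. kext j (kext k e) U \<in> carrier R"
    using klinearD(2)[OF klinear_kext klinearD(1)[OF klinear_kext e]] .
  fix j assume j: "j \<in> {..<n}"
  have "kext j (\<lambda>U. \<Oplus>k\<in>{..<n}. v k \<otimes> kext k e U) U = (\<Oplus>k\<in>{..<n}. v k \<otimes> kext j (kext k e) U)"
    by (subst klinear_lincomb[OF klinear_kext]) (use uc klinearD(1)[OF klinear_kext e] in auto)
  then show "u j \<otimes> kext j (\<lambda>U. \<Oplus>k\<in>{..<n}. v k \<otimes> kext k e U) U =
      (\<Oplus>k\<in>{..<n}. u j \<otimes> (v k \<otimes> kext j (kext k e) U))"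
    using j uc kc by (simp add: finsum_rdistr Pi_iff)
next
  have "\<And>j k. kext j (kext k e) U \<in> carrier R"
    using klinearD(2)[OF klinear_kext klinearD(1)[OF klinear_kext e]] .
  then show "(\<lambda>j. \<Oplus>k\<in>{..<n}. u j \<otimes> (v k \<otimes> kext j (kext k e) U)) \<in> {..<n} \<rightarrow> carrier R"
    using u v by (auto intro!: finsum_closed m_closed simp: Pi_iff)
qed simp

lemma kmul_kmul_same:
  assumes v: "v \<in> {..<n} \<rightarrow> carrier R" and e: "e \<in> UNIV \<rightarrow> carrier R"
  shows "kmul v n (kmul v n e) = (\<lambda>U. \<zero>)"
proof
  fix U
  have vc: "\<And>j. j < n \<Longrightarrow> v j \<in> carrier R" using v by auto
  have kc: "\<And>j k. kext j (kext k e) U \<in> carrier R"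
    using klinearD(2)[OF klinear_kext klinearD(1)[OF klinear_kext e]] .
  show "kmul v n (kmul v n e) U = \<zero>"
    unfolding kmul_kmul[OF v v e]
  proof (rule alternating_sum_zero)
    show "alternating {..<n} (\<lambda>j k. v j \<otimes> (v k \<otimes> kext j (kext k e) U))"
      unfolding alternating_def
    proof (intro ballI conjI)
      fix j k assume jk: "j \<in> {..<n}" "k \<in> {..<n}"
      show "v j \<otimes> (v k \<otimes> kext j (kext k e) U) \<in> carrier R" using jk vc kc by auto
      show "v j \<otimes> (v j \<otimes> kext j (kext j e) U) = \<zero>" using jk vc by (simp add: kext_kext_same)
      show "v j \<otimes> (v k \<otimes> kext j (kext k e) U) = \<ominus> (v k \<otimes> (v j \<otimes> kext k (kext j e) U))"
        using jk vc kc[of k j] by (subst kext_kext_swap[OF e]) (simp add: r_minus m_lcomm)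
    qed
  qed simp
qed

text \<open>Polarization: expand the square of multiplication by u + v, which is zero.\<close>

lemma kmul_kmul_swap:
  assumes u: "u \<in> {..<n} \<rightarrow> carrier R" and v: "v \<in> {..<n} \<rightarrow> carrier R" and e: "e \<in> UNIV \<rightarrow> carrier R"
  shows "kmul u n (kmul v n e) = (\<lambda>U. \<ominus> kmul v n (kmul u n e) U)"
proof -
  have uv: "(\<lambda>j. u j \<oplus> v j) \<in> {..<n} \<rightarrow> carrier R" using u v by auto
  have add: "kmul (\<lambda>j. u j \<oplus> v j) n g = (\<lambda>U. kmul u n g U \<oplus> kmul v n g U)"
    if g: "g \<in> UNIV \<rightarrow> carrier R" for g
  proof
    fix U
    have kc: "\<And>a. kext a g U \<in> carrier R" using klinearD(2)[OF klinear_kext g] .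
    have "(\<Oplus>a\<in>{..<n}. (u a \<oplus> v a) \<otimes> kext a g U) =
        (\<Oplus>a\<in>{..<n}. u a \<otimes> kext a g U \<oplus> v a \<otimes> kext a g U)"
      using u v kc by (intro finsum_cong') (auto simp: l_distr Pi_iff)
    also have "\<dots> = (\<Oplus>a\<in>{..<n}. u a \<otimes> kext a g U) \<oplus> (\<Oplus>a\<in>{..<n}. v a \<otimes> kext a g U)"
      using u v kc by (intro finsum_addf) auto
    finally show "kmul (\<lambda>j. u j \<oplus> v j) n g U = kmul u n g U \<oplus> kmul v n g U" unfolding kmul_def .
  qed
  note lu = klinear_kmul[OF u] and lv = klinear_kmul[OF v]
  have ue: "kmul u n e \<in> UNIV \<rightarrow> carrier R" "kmul v n e \<in> UNIV \<rightarrow> carrier R"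
    using klinearD(1)[OF lu e] klinearD(1)[OF lv e] .
  have sum: "(\<lambda>U. kmul u n e U \<oplus> kmul v n e U) \<in> UNIV \<rightarrow> carrier R"
    using ue by auto
  have "(\<lambda>U. \<zero>) = kmul (\<lambda>j. u j \<oplus> v j) n (kmul (\<lambda>j. u j \<oplus> v j) n e)"
    using kmul_kmul_same[OF uv e] by simp
  also have "\<dots> = (\<lambda>U. (kmul u n (kmul u n e) U \<oplus> kmul u n (kmul v n e) U) \<oplus>
      (kmul v n (kmul u n e) U \<oplus> kmul v n (kmul v n e) U))"
    unfolding add[OF e] add[OF sum] klinearD(3)[OF lu ue] klinearD(3)[OF lv ue] ..
  also have "\<dots> = (\<lambda>U. kmul u n (kmul v n e) U \<oplus> kmul v n (kmul u n e) U)"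
    unfolding kmul_kmul_same[OF u e] kmul_kmul_same[OF v e]
    using klinearD(2)[OF lu ue(2)] klinearD(2)[OF lv ue(1)] by simp
  finally have "\<And>U. kmul u n (kmul v n e) U \<oplus> kmul v n (kmul u n e) U = \<zero>" by metis
  then show ?thesis
    using klinearD(2)[OF lu ue(2)] klinearD(2)[OF lv ue(1)] sum_zero_eq_neg by blast
qed

text \<open>Summing \<open>kpart_kext\<close> over all pairs of indices leaves only the diagonal
  pairs. This is the Leibniz rule for a factor v of degree one, whose boundary is a scalar.\<close>

lemma kd_kmul:
  assumes f: "f \<in> {..<n} \<rightarrow> carrier R" and v: "v \<in> {..<n} \<rightarrow> carrier R" and e: "e \<in> UNIV \<rightarrow> carrier R"
  shows "kd f n (kmul v n e) U \<oplus> kmul v n (kd f n e) U = (\<Oplus>j\<in>{..<n}. v j \<otimes> f j) \<otimes> e U"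
proof -
  have c: "\<And>j. j < n \<Longrightarrow> f j \<in> carrier R" "\<And>j. j < n \<Longrightarrow> v j \<in> carrier R" using f v by auto
  have ec: "e U \<in> carrier R" using e by auto
  note K = klinearD(1)[OF klinear_kext e] klinearD(1)[OF klinear_kpart e]
  have kc: "\<And>j k. kpart j (kext k e) U \<in> carrier R" "\<And>j k. kext j (kpart k e) U \<in> carrier R"
    using klinearD(2)[OF klinear_kpart K(1)] klinearD(2)[OF klinear_kext K(2)] .
  have 1: "kd f n (kmul v n e) U = (\<Oplus>j\<in>{..<n}. \<Oplus>k\<in>{..<n}. f j \<otimes> (v k \<otimes> kpart j (kext k e) U))"
    unfolding kd_def
  proof (rule finsum_cong')
    fix j assume j: "j \<in> {..<n}"
    have "kpart j (kmul v n e) U = (\<Oplus>k\<in>{..<n}. v k \<otimes> kpart j (kext k e) U)"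
      unfolding kmul_def by (subst klinear_lincomb[OF klinear_kpart]) (use c K in auto)
    then show "f j \<otimes> kpart j (kmul v n e) U = (\<Oplus>k\<in>{..<n}. f j \<otimes> (v k \<otimes> kpart j (kext k e) U))"
      using j c kc by (simp add: finsum_rdistr Pi_iff)
  qed (use c kc in \<open>auto intro!: finsum_closed\<close>)
  have 2: "kmul v n (kd f n e) U = (\<Oplus>j\<in>{..<n}. \<Oplus>k\<in>{..<n}. f j \<otimes> (v k \<otimes> kext k (kpart j e) U))"
  proof -
    have "kmul v n (kd f n e) = (\<lambda>U. \<Oplus>j\<in>{..<n}. f j \<otimes> kmul v n (kpart j e) U)"
      unfolding kd_def by (rule klinear_lincomb[OF klinear_kmul[OF v]]) (use c K in auto)
    then have "kmul v n (kd f n e) U = (\<Oplus>j\<in>{..<n}. f j \<otimes> kmul v n (kpart j e) U)" by simp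
    also have "\<dots> = (\<Oplus>j\<in>{..<n}. \<Oplus>k\<in>{..<n}. f j \<otimes> (v k \<otimes> kext k (kpart j e) U))"
      using c kc by (intro finsum_cong') (auto simp: kmul_def finsum_rdistr Pi_iff intro!: finsum_closed)
    finally show ?thesis .
  qed
  have "kd f n (kmul v n e) U \<oplus> kmul v n (kd f n e) U =
      (\<Oplus>j\<in>{..<n}. (\<Oplus>k\<in>{..<n}. f j \<otimes> (v k \<otimes> kpart j (kext k e) U)) \<oplus>
        (\<Oplus>k\<in>{..<n}. f j \<otimes> (v k \<otimes> kext k (kpart j e) U)))"
    unfolding 1 2 using c kc by (intro finsum_addf[symmetric]) (auto intro!: finsum_closed)
  also have "\<dots> = (\<Oplus>j\<in>{..<n}. v j \<otimes> f j \<otimes> e U)"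
  proof (rule finsum_cong')
    fix j assume j: "j \<in> {..<n}"
    have "(\<Oplus>k\<in>{..<n}. f j \<otimes> (v k \<otimes> kpart j (kext k e) U)) \<oplus>
        (\<Oplus>k\<in>{..<n}. f j \<otimes> (v k \<otimes> kext k (kpart j e) U)) =
        (\<Oplus>k\<in>{..<n}. f j \<otimes> (v k \<otimes> kpart j (kext k e) U) \<oplus> f j \<otimes> (v k \<otimes> kext k (kpart j e) U))"
      using c kc j by (intro finsum_addf[symmetric]) auto
    also have "\<dots> = (\<Oplus>k\<in>{..<n}. if j = k then v k \<otimes> f k \<otimes> e U else \<zero>)"
    proof (rule finsum_cong')
      fix k assume k: "k \<in> {..<n}"
      have "f j \<otimes> (v k \<otimes> kpart j (kext k e) U) \<oplus> f j \<otimes> (v k \<otimes> kext k (kpart j e) U) =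
          f j \<otimes> (v k \<otimes> (kpart j (kext k e) U \<oplus> kext k (kpart j e) U))"
        using c kc j k by (simp add: r_distr)
      then show "f j \<otimes> (v k \<otimes> kpart j (kext k e) U) \<oplus> f j \<otimes> (v k \<otimes> kext k (kpart j e) U) =
          (if j = k then v k \<otimes> f k \<otimes> e U else \<zero>)"
        using c j k ec unfolding kpart_kext[OF e] by (auto simp: m_ac)
    qed (use c ec in auto)
    also have "\<dots> = v j \<otimes> f j \<otimes> e U"
      using j c ec finsum_singleton[of j "{..<n}" "\<lambda>k. v k \<otimes> f k \<otimes> e U"] by auto
    finally show "(\<Oplus>k\<in>{..<n}. f j \<otimes> (v k \<otimes> kpart j (kext k e) U)) \<oplus>
        (\<Oplus>k\<in>{..<n}. f j \<otimes> (v k \<otimes> kext k (kpart j e) U)) = v j \<otimes> f j \<otimes> e U" .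
  qed (use c ec in auto)
  also have "\<dots> = (\<Oplus>j\<in>{..<n}. v j \<otimes> f j) \<otimes> e U"
    using c ec by (intro finsum_ldistr[symmetric]) auto
  finally show ?thesis .
qed

end

section \<open>Divided powers of bivectors\<close>

context cring
begin

lemma kmul_closed:
  assumes "v \<in> {..<n} \<rightarrow> carrier R" "e \<in> UNIV \<rightarrow> carrier R"
  shows "kmul v n e \<in> UNIV \<rightarrow> carrier R" "kmul v n e U \<in> carrier R"
  using klinearD(1,2)[OF klinear_kmul[OF assms(1)] assms(2)] .

lemma kd_closed:
  assumes "f \<in> {..<n} \<rightarrow> carrier R" "e \<in> UNIV \<rightarrow> carrier R"
  shows "kd f n e \<in> UNIV \<rightarrow> carrier R" "kd f n e U \<in> carrier R"
  using klinearD(1,2)[OF klinear_kd[OF assms(1)] assms(2)] .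

lemma kmul_lincomb:
  assumes D: "finite D" "\<And>i. i \<in> D \<Longrightarrow> c i \<in> carrier R" "\<And>i. i \<in> D \<Longrightarrow> v i \<in> {..<n} \<rightarrow> carrier R"
    and e: "e \<in> UNIV \<rightarrow> carrier R"
  shows "kmul (\<lambda>b. \<Oplus>i\<in>D. c i \<otimes> v i b) n e U = (\<Oplus>i\<in>D. c i \<otimes> kmul (v i) n e U)"
  using D
proof (induction D)
  case empty
  then show ?case using klinearD(2)[OF klinear_kext e] by (simp add: kmul_def)
next
  case (insert k D)
  have kc: "\<And>a. kext a e U \<in> carrier R" using klinearD(2)[OF klinear_kext e] .
  have c: "\<And>i. i \<in> D \<Longrightarrow> c i \<in> carrier R" "c k \<in> carrier R"
    "\<And>i b. i \<in> D \<Longrightarrow> b < n \<Longrightarrow> v i b \<in> carrier R" "\<And>b. b < n \<Longrightarrow> v k b \<in> carrier R"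
    using insert.prems by auto
  have s: "(\<Oplus>i\<in>D. c i \<otimes> v i b) \<in> carrier R" if "b < n" for b
    using c that by (auto intro!: finsum_closed)
  have "kmul (\<lambda>b. \<Oplus>i\<in>insert k D. c i \<otimes> v i b) n e U =
      (\<Oplus>b\<in>{..<n}. c k \<otimes> (v k b \<otimes> kext b e U) \<oplus> (\<Oplus>i\<in>D. c i \<otimes> v i b) \<otimes> kext b e U)"
    unfolding kmul_def
  proof (rule finsum_cong')
    fix b assume b: "b \<in> {..<n}"
    have "(\<Oplus>i\<in>insert k D. c i \<otimes> v i b) = c k \<otimes> v k b \<oplus> (\<Oplus>i\<in>D. c i \<otimes> v i b)"
      using insert.hyps c b by (intro finsum_insert) auto
    then show "(\<Oplus>i\<in>insert k D. c i \<otimes> v i b) \<otimes> kext b e U =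
        c k \<otimes> (v k b \<otimes> kext b e U) \<oplus> (\<Oplus>i\<in>D. c i \<otimes> v i b) \<otimes> kext b e U"
      using c s b kc by (simp add: l_distr m_assoc)
  qed (use c s kc in auto)
  also have "\<dots> = (\<Oplus>b\<in>{..<n}. c k \<otimes> (v k b \<otimes> kext b e U)) \<oplus>
      (\<Oplus>b\<in>{..<n}. (\<Oplus>i\<in>D. c i \<otimes> v i b) \<otimes> kext b e U)"
    using c s kc by (intro finsum_addf) auto
  also have "(\<Oplus>b\<in>{..<n}. (\<Oplus>i\<in>D. c i \<otimes> v i b) \<otimes> kext b e U) = (\<Oplus>i\<in>D. c i \<otimes> kmul (v i) n e U)"
    using insert by (simp add: kmul_def)
  also have "(\<Oplus>b\<in>{..<n}. c k \<otimes> (v k b \<otimes> kext b e U)) = c k \<otimes> kmul (v k) n e U"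
    unfolding kmul_def using c kc by (intro finsum_rdistr[symmetric]) auto
  also have "c k \<otimes> kmul (v k) n e U \<oplus> (\<Oplus>i\<in>D. c i \<otimes> kmul (v i) n e U) =
      (\<Oplus>i\<in>insert k D. c i \<otimes> kmul (v i) n e U)"
    using insert.hyps insert.prems kmul_closed(2)[OF insert.prems(2) e]
    by (intro finsum_insert[symmetric]) auto
  finally show ?case .
qed

lemma kmul_cong:
  assumes "\<And>b. b < n \<Longrightarrow> v b = v' b" "v' \<in> {..<n} \<rightarrow> carrier R" "e \<in> UNIV \<rightarrow> carrier R"
  shows "kmul v n e = kmul v' n e"
  unfolding kmul_def using assms klinearD(2)[OF klinear_kext assms(3)]
  by (intro ext finsum_cong') auto

lemma kmul_add:
  assumes "u \<in> {..<n} \<rightarrow> carrier R" "v \<in> {..<n} \<rightarrow> carrier R" "e \<in> UNIV \<rightarrow> carrier R"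
  shows "kmul (\<lambda>b. u b \<oplus> v b) n e U = kmul u n e U \<oplus> kmul v n e U"
proof -
  have kc: "\<And>a. kext a e U \<in> carrier R" using klinearD(2)[OF klinear_kext assms(3)] .
  have "(\<Oplus>a\<in>{..<n}. (u a \<oplus> v a) \<otimes> kext a e U) =
      (\<Oplus>a\<in>{..<n}. u a \<otimes> kext a e U \<oplus> v a \<otimes> kext a e U)"
    using assms kc by (intro finsum_cong') (auto simp: l_distr Pi_iff)
  also have "\<dots> = (\<Oplus>a\<in>{..<n}. u a \<otimes> kext a e U) \<oplus> (\<Oplus>a\<in>{..<n}. v a \<otimes> kext a e U)"
    using assms kc by (intro finsum_addf) auto
  finally show ?thesis unfolding kmul_def .
qed

lemma kmul_smult:
  assumes "c \<in> carrier R" "v \<in> {..<n} \<rightarrow> carrier R" "e \<in> UNIV \<rightarrow> carrier R"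
  shows "kmul (\<lambda>b. c \<otimes> v b) n e U = c \<otimes> kmul v n e U"
proof -
  have kc: "\<And>a. kext a e U \<in> carrier R" using klinearD(2)[OF klinear_kext assms(3)] .
  have "kmul (\<lambda>b. c \<otimes> v b) n e U = (\<Oplus>a\<in>{..<n}. c \<otimes> (v a \<otimes> kext a e U))"
    unfolding kmul_def using assms kc by (intro finsum_cong') (auto simp: m_assoc Pi_iff)
  also have "\<dots> = c \<otimes> kmul v n e U"
    unfolding kmul_def using assms kc by (intro finsum_rdistr[symmetric]) auto
  finally show ?thesis .
qed

text \<open>Besides being a pairing, this is the boundary of the degree one element u in the Koszul
  complex of x.\<close>

definition dot :: "nat \<Rightarrow> (nat \<Rightarrow> 'a) \<Rightarrow> (nat \<Rightarrow> 'a) \<Rightarrow> 'a" where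
  "dot n u x = (\<Oplus>j\<in>{..<n}. u j \<otimes> x j)"

lemma dot_closed: "u \<in> {..<n} \<rightarrow> carrier R \<Longrightarrow> x \<in> {..<n} \<rightarrow> carrier R \<Longrightarrow> dot n u x \<in> carrier R"
  unfolding dot_def by (auto intro!: finsum_closed)

lemma kd_kmul':
  assumes "x \<in> {..<n} \<rightarrow> carrier R" "v \<in> {..<n} \<rightarrow> carrier R" "e \<in> UNIV \<rightarrow> carrier R"
  shows "kd x n (kmul v n e) = (\<lambda>U. dot n v x \<otimes> e U \<ominus> kmul v n (kd x n e) U)"
proof
  fix U
  have c: "kd x n (kmul v n e) U \<in> carrier R" "kmul v n (kd x n e) U \<in> carrier R"
    using kd_closed(2)[OF assms(1) kmul_closed(1)[OF assms(2,3)]]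
      kmul_closed(2)[OF assms(2) kd_closed(1)[OF assms(1,3)]] .
  show "kd x n (kmul v n e) U = dot n v x \<otimes> e U \<ominus> kmul v n (kd x n e) U"
    using add_minus_cancel[OF c] kd_kmul[OF assms, of U] unfolding dot_def by simp
qed

text \<open>The coordinates of the boundary of the exterior product of u and v, again of degree
  one.\<close>

definition koszul_rel :: "nat \<Rightarrow> (nat \<Rightarrow> 'a) \<Rightarrow> (nat \<Rightarrow> 'a) \<Rightarrow> (nat \<Rightarrow> 'a) \<Rightarrow> nat \<Rightarrow> 'a" where
  "koszul_rel n x u v = (\<lambda>b. dot n u x \<otimes> v b \<oplus> (\<ominus> dot n v x) \<otimes> u b)"

lemma koszul_rel_closed:
  assumes "x \<in> {..<n} \<rightarrow> carrier R" "u \<in> {..<n} \<rightarrow> carrier R" "v \<in> {..<n} \<rightarrow> carrier R"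
  shows "koszul_rel n x u v \<in> {..<n} \<rightarrow> carrier R"
  using assms dot_closed[OF assms(2,1)] dot_closed[OF assms(3,1)] unfolding koszul_rel_def by (auto simp: Pi_iff)

lemma kmul_koszul_rel:
  assumes x: "x \<in> {..<n} \<rightarrow> carrier R" and u: "u \<in> {..<n} \<rightarrow> carrier R" and v: "v \<in> {..<n} \<rightarrow> carrier R"
    and e: "e \<in> UNIV \<rightarrow> carrier R"
  shows "kmul (koszul_rel n x u v) n e U = dot n u x \<otimes> kmul v n e U \<oplus> (\<ominus> dot n v x) \<otimes> kmul u n e U"
proof -
  have c: "dot n u x \<in> carrier R" "\<ominus> dot n v x \<in> carrier R" using dot_closed u v x by auto
  show ?thesis unfolding koszul_rel_def using c u v e
    by (subst kmul_add) (auto simp: kmul_smult)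
qed

text \<open>Leibniz rule for the product of u and v: a factor of even degree passes the differential
  without a sign.\<close>

lemma kd_kmul_kmul:
  assumes x: "x \<in> {..<n} \<rightarrow> carrier R" and u: "u \<in> {..<n} \<rightarrow> carrier R" and v: "v \<in> {..<n} \<rightarrow> carrier R"
    and e: "e \<in> UNIV \<rightarrow> carrier R"
  shows "kd x n (kmul u n (kmul v n e)) U =
    kmul (koszul_rel n x u v) n e U \<oplus> kmul u n (kmul v n (kd x n e)) U"
proof -
  have ve: "kmul v n e \<in> UNIV \<rightarrow> carrier R" and de: "kd x n e \<in> UNIV \<rightarrow> carrier R"
    using kmul_closed[OF v e] kd_closed[OF x e] by auto
  have vde: "kmul v n (kd x n e) \<in> UNIV \<rightarrow> carrier R" using kmul_closed[OF v de] by auto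
  have c: "dot n u x \<in> carrier R" "dot n v x \<in> carrier R" using dot_closed u v x by auto
  have ce: "(\<lambda>U. dot n v x \<otimes> e U) \<in> UNIV \<rightarrow> carrier R" using c e by auto
  have "kmul u n (kd x n (kmul v n e)) U = kmul u n (\<lambda>U. dot n v x \<otimes> e U \<ominus> kmul v n (kd x n e) U) U"
    using kd_kmul'[OF x v e] by simp
  also have "\<dots> = kmul u n (\<lambda>U. dot n v x \<otimes> e U) U \<ominus> kmul u n (kmul v n (kd x n e)) U"
    using klinear_minus[OF klinear_kmul[OF u] ce vde] by simp
  also have "kmul u n (\<lambda>U. dot n v x \<otimes> e U) U = dot n v x \<otimes> kmul u n e U"
    using klinearD(4)[OF klinear_kmul[OF u] e c(2)] by simp
  finally have 1: "kmul u n (kd x n (kmul v n e)) U =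
      dot n v x \<otimes> kmul u n e U \<ominus> kmul u n (kmul v n (kd x n e)) U" .
  have 2: "kd x n (kmul u n (kmul v n e)) U = dot n u x \<otimes> kmul v n e U \<ominus> kmul u n (kd x n (kmul v n e)) U"
    using kd_kmul'[OF x u ve] by simp
  have 3: "p \<otimes> a \<ominus> (q \<otimes> b \<ominus> z) = (p \<otimes> a \<oplus> (\<ominus> q) \<otimes> b) \<oplus> z"
    if "p \<in> carrier R" "q \<in> carrier R" "a \<in> carrier R" "b \<in> carrier R" "z \<in> carrier R" for p q a b z
    using that by algebra
  show ?thesis
    unfolding kmul_koszul_rel[OF x u v e] 2 1
    by (rule 3) (use c kmul_closed(2)[OF v e] kmul_closed(2)[OF u e] kmul_closed(2)[OF u vde] in auto)
qed

text \<open>The \<open>i\<close>-th divided power of the bivector \<open>w\<close> that is the sum of the \<open>u s \<and> v s\<close> for \<open>s < t\<close>, read off from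
  \<open>exp w\<close>, the product of the factors \<open>1 + u s \<and> v s\<close>.\<close>

primrec divpow :: "nat \<Rightarrow> (nat \<Rightarrow> nat \<Rightarrow> 'a) \<Rightarrow> (nat \<Rightarrow> nat \<Rightarrow> 'a) \<Rightarrow> nat \<Rightarrow> nat \<Rightarrow> nat set \<Rightarrow> 'a" where
  "divpow n u v 0 = (\<lambda>i. if i = 0 then kone R else (\<lambda>T. \<zero>))"
| "divpow n u v (Suc t) = (\<lambda>i. case i of 0 \<Rightarrow> kone R
    | Suc i' \<Rightarrow> (\<lambda>T. divpow n u v t i T \<oplus> kmul (u t) n (kmul (v t) n (divpow n u v t i')) T))"

lemma kone_closed: "kone R \<in> UNIV \<rightarrow> carrier R"
  by (auto simp: kone_def)

lemma kd_kone: "x \<in> {..<n} \<rightarrow> carrier R \<Longrightarrow> kd x n (kone R) = (\<lambda>U. \<zero>)"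
  unfolding kd_def kpart_def kone_def
  by (intro ext, subst finsum_cong'[OF refl, of "\<lambda>_. \<zero>"]) (auto simp: Pi_iff)

lemma divpow_0: "divpow n u v t 0 = kone R"
  by (cases t) auto

text \<open>Each of the t simple bivectors can be used at most once.\<close>

lemma divpow_beyond: "t < i \<Longrightarrow> (\<And>s. s < t \<Longrightarrow> u s \<in> {..<n} \<rightarrow> carrier R) \<Longrightarrow>
   (\<And>s. s < t \<Longrightarrow> v s \<in> {..<n} \<rightarrow> carrier R) \<Longrightarrow> divpow n u v t i = (\<lambda>T. \<zero>)"
proof (induction t arbitrary: i)
  case (Suc t)
  then obtain i' where i: "i = Suc i'" "t < i'" by (cases i) auto
  have "divpow n u v t i = (\<lambda>T. \<zero>)" "divpow n u v t i' = (\<lambda>T. \<zero>)"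
    using Suc i by simp_all
  moreover have "kmul (u t) n (kmul (v t) n (\<lambda>T. \<zero>)) = (\<lambda>T. \<zero>)"
    using klinear_zero[OF klinear_kmul] Suc.prems by simp
  ultimately show ?case using i by simp
qed simp

text \<open>The boundary of the bivector \<open>w\<close> above.\<close>

definition omega :: "nat \<Rightarrow> (nat \<Rightarrow> 'a) \<Rightarrow> (nat \<Rightarrow> nat \<Rightarrow> 'a) \<Rightarrow> (nat \<Rightarrow> nat \<Rightarrow> 'a) \<Rightarrow> nat \<Rightarrow> nat \<Rightarrow> 'a" where
  "omega n x u v t = (\<lambda>b. \<Oplus>s\<in>{..<t}. koszul_rel n x (u s) (v s) b)"

context
  fixes n :: nat and x :: "nat \<Rightarrow> 'a" and u v :: "nat \<Rightarrow> nat \<Rightarrow> 'a"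
  assumes x: "x \<in> {..<n} \<rightarrow> carrier R"
    and u: "\<And>s. u s \<in> {..<n} \<rightarrow> carrier R" and v: "\<And>s. v s \<in> {..<n} \<rightarrow> carrier R"
begin

lemma divpow_closed: "divpow n u v t i \<in> UNIV \<rightarrow> carrier R"
proof (induction t arbitrary: i)
  case 0
  then show ?case using kone_closed by auto
next
  case (Suc t)
  have "kmul (u t) n (kmul (v t) n (divpow n u v t i')) T \<in> carrier R" for i' T
    using kmul_closed(2)[OF u kmul_closed(1)[OF v Suc]] .
  then show ?case using Suc kone_closed by (auto split: nat.split simp: Pi_iff)
qed

text \<open>The boundary of u v is a combination of u and v, each of which kills u v.\<close>

lemma kmul_koszul_rel_kmul_kmul:
  assumes e: "e \<in> UNIV \<rightarrow> carrier R"
  shows "kmul (koszul_rel n x (u s) (v s)) n (kmul (u s) n (kmul (v s) n e)) U = \<zero>"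
proof -
  have ve: "kmul (v s) n e \<in> UNIV \<rightarrow> carrier R" using kmul_closed[OF v e] by auto
  have uve: "kmul (u s) n (kmul (v s) n e) \<in> UNIV \<rightarrow> carrier R" using kmul_closed[OF u ve] by auto
  have "kmul (v s) n (kmul (u s) n (kmul (v s) n e)) = (\<lambda>U. \<ominus> kmul (u s) n (kmul (v s) n (kmul (v s) n e)) U)"
    by (rule kmul_kmul_swap[OF v u ve])
  also have "\<dots> = (\<lambda>U. \<zero>)"
    using kmul_kmul_same[OF v e] klinear_zero[OF klinear_kmul[OF u]] by simp
  finally show ?thesis
    unfolding kmul_koszul_rel[OF x u v uve] kmul_kmul_same[OF u ve]
    using dot_closed[OF u x] dot_closed[OF v x] by simp
qed

lemma kmul_commute_pair:
  assumes y: "y \<in> {..<n} \<rightarrow> carrier R" and e: "e \<in> UNIV \<rightarrow> carrier R"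
  shows "kmul (u s) n (kmul (v s) n (kmul y n e)) = kmul y n (kmul (u s) n (kmul (v s) n e))"
proof -
  have ve: "kmul (v s) n e \<in> UNIV \<rightarrow> carrier R" using kmul_closed[OF v e] by auto
  have yve: "kmul y n (kmul (v s) n e) \<in> UNIV \<rightarrow> carrier R" using kmul_closed[OF y ve] by auto
  have "kmul (u s) n (kmul (v s) n (kmul y n e)) = kmul (u s) n (\<lambda>U. \<ominus> kmul y n (kmul (v s) n e) U)"
    using kmul_kmul_swap[OF v y e] by simp
  also have "\<dots> = (\<lambda>U. \<ominus> kmul (u s) n (kmul y n (kmul (v s) n e)) U)"
    by (rule klinear_uminus[OF klinear_kmul[OF u] yve])
  also have "\<dots> = (\<lambda>U. \<ominus> (\<ominus> kmul y n (kmul (u s) n (kmul (v s) n e)) U))"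
    unfolding kmul_kmul_swap[OF u y ve] ..
  also have "\<dots> = kmul y n (kmul (u s) n (kmul (v s) n e))"
    using kmul_closed(2)[OF y kmul_closed(1)[OF u ve]] by simp
  finally show ?thesis .
qed

lemma omega_closed: "omega n x u v t \<in> {..<n} \<rightarrow> carrier R"
  unfolding omega_def using koszul_rel_closed[OF x u v] by (auto intro!: finsum_closed simp: Pi_iff)

lemma kmul_omega_Suc:
  assumes e: "e \<in> UNIV \<rightarrow> carrier R"
  shows "kmul (omega n x u v (Suc t)) n e U = kmul (omega n x u v t) n e U \<oplus> kmul (koszul_rel n x (u t) (v t)) n e U"
proof -
  note k = koszul_rel_closed[OF x u v]
  have "kmul (omega n x u v (Suc t)) n e = kmul (\<lambda>b. omega n x u v t b \<oplus> koszul_rel n x (u t) (v t) b) n e"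
  proof (rule kmul_cong[OF _ _ e])
    fix b assume b: "b < n"
    have "(\<Oplus>s\<in>insert t {..<t}. koszul_rel n x (u s) (v s) b) =
        koszul_rel n x (u t) (v t) b \<oplus> omega n x u v t b"
      unfolding omega_def using k b by (intro finsum_insert) (auto simp: Pi_iff)
    then show "omega n x u v (Suc t) b = omega n x u v t b \<oplus> koszul_rel n x (u t) (v t) b"
      using k omega_closed[of t] b unfolding omega_def[of n x u v "Suc t"] lessThan_Suc
      by (simp add: a_comm Pi_iff)
  qed (use omega_closed[of t] k in \<open>auto simp: Pi_iff\<close>)
  then show ?thesis using kmul_add[OF omega_closed k e] by simp
qed

text \<open>Induction on the number of simple bivectors. A new one contributes its boundary times
  the old powers; the product of that boundary with the new bivector, which is needed to complete
  the formula, is zero by \<open>kmul_koszul_rel_kmul_kmul\<close>. No integer factors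
  arise.\<close>

lemma kd_divpow:
  "kd x n (divpow n u v t (Suc i)) = kmul (omega n x u v t) n (divpow n u v t i)"
proof (induction t arbitrary: i)
  case 0
  have "kmul (omega n x u v 0) n e = (\<lambda>U. \<zero>)" if "e \<in> UNIV \<rightarrow> carrier R" for e
    using klinearD(2)[OF klinear_kext that] by (simp add: kmul_def omega_def)
  then show ?case using klinear_zero[OF klinear_kd[OF x]] divpow_closed[of 0 i] by simp
next
  case (Suc t)
  let ?W = "divpow n u v t" and ?y = "koszul_rel n x (u t) (v t)"
  let ?B = "\<lambda>e. kmul (u t) n (kmul (v t) n e)"
  have Bc: "?B e \<in> UNIV \<rightarrow> carrier R" "?B e U \<in> carrier R" if "e \<in> UNIV \<rightarrow> carrier R" for e U
    using kmul_closed[OF u kmul_closed(1)[OF v that]] .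
  note W = divpow_closed[of t]
  note yc = koszul_rel_closed[OF x u[of t] v[of t]]
  have "kd x n (divpow n u v (Suc t) (Suc i)) U = kmul (omega n x u v (Suc t)) n (divpow n u v (Suc t) i) U" for U
  proof -
    have "kd x n (divpow n u v (Suc t) (Suc i)) U = kd x n (\<lambda>T. ?W (Suc i) T \<oplus> ?B (?W i) T) U" by simp
    also have "\<dots> = kd x n (?W (Suc i)) U \<oplus> kd x n (?B (?W i)) U"
      using klinearD(3)[OF klinear_kd[OF x] W Bc(1)[OF W]] by simp
    also have "\<dots> = kmul (omega n x u v t) n (?W i) U \<oplus> (kmul ?y n (?W i) U \<oplus> ?B (kd x n (?W i)) U)"
      using Suc.IH kd_kmul_kmul[OF x u v W] by simp
    also have "\<dots> = kmul (omega n x u v (Suc t)) n (?W i) U \<oplus> ?B (kd x n (?W i)) U"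
      using kmul_omega_Suc[OF W] kmul_closed(2)[OF omega_closed W] kmul_closed(2)[OF yc W]
        Bc(2)[OF kd_closed(1)[OF x W]] by (simp add: a_assoc)
    also have "\<dots> = kmul (omega n x u v (Suc t)) n (divpow n u v (Suc t) i) U"
    proof (cases i)
      case 0
      have "?B (\<lambda>U. \<zero>) U = \<zero>"
        using klinear_zero[OF klinear_kmul[OF u]] klinear_zero[OF klinear_kmul[OF v]] by simp
      then show ?thesis
        using kd_kone[OF x] kmul_closed(2)[OF omega_closed kone_closed] 0 by (simp add: divpow_0)
    next
      case (Suc i')
      have "?B (kd x n (?W i)) U = kmul (omega n x u v t) n (?B (?W i')) U"
        using Suc.IH Suc kmul_commute_pair[OF omega_closed W] by simp
      also have "\<dots> = kmul (omega n x u v (Suc t)) n (?B (?W i')) U"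
        using kmul_omega_Suc[OF Bc(1)[OF W]] kmul_koszul_rel_kmul_kmul[OF W]
          kmul_closed(2)[OF omega_closed Bc(1)[OF W]] by simp
      finally show ?thesis
        using klinearD(3)[OF klinear_kmul[OF omega_closed] W Bc(1)[OF W]] Suc by simp
    qed
    finally show ?thesis .
  qed
  then show ?case by blast
qed

end


lemma finsum_minus:
  assumes "f \<in> D \<rightarrow> carrier R" "g \<in> D \<rightarrow> carrier R"
  shows "(\<Oplus>i\<in>D. f i \<ominus> g i) = (\<Oplus>i\<in>D. f i) \<ominus> (\<Oplus>i\<in>D. g i)"
proof (cases "finite D")
  case True
  have "(\<Oplus>i\<in>D. f i \<ominus> g i) = (\<Oplus>i\<in>D. f i \<oplus> (\<ominus> \<one>) \<otimes> g i)"
    using assms by (intro finsum_cong') (auto simp: minus_eq l_minus Pi_iff)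
  also have "\<dots> = (\<Oplus>i\<in>D. f i) \<oplus> (\<Oplus>i\<in>D. (\<ominus> \<one>) \<otimes> g i)"
    using assms by (intro finsum_addf) auto
  also have "(\<Oplus>i\<in>D. (\<ominus> \<one>) \<otimes> g i) = (\<ominus> \<one>) \<otimes> (\<Oplus>i\<in>D. g i)"
    using assms True by (intro finsum_rdistr[symmetric]) auto
  finally show ?thesis using assms by (simp add: minus_eq l_minus)
qed (simp add: minus_eq)

lemma genideal_finite_image:
  assumes "finite D" "f \<in> D \<rightarrow> carrier R"
  shows "y \<in> Idl (f ` D) \<longleftrightarrow> (\<exists>b\<in>D \<rightarrow> carrier R. y = (\<Oplus>s\<in>D. b s \<otimes> f s))"
  using assms
proof (induction D arbitrary: y)
  case empty
  have "Idl {} = {\<zero>}" using genideal_zero genideal_minimal[OF zeroideal, of "{}"]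
      additive_subgroup.zero_closed[OF ideal.axioms(1)[OF genideal_ideal[of "{}"]]] by blast
  then show ?case by auto
next
  case (insert k D)
  have f: "f \<in> D \<rightarrow> carrier R" "f k \<in> carrier R" "f ` D \<subseteq> carrier R" using insert.prems by auto
  have sum: "(\<Oplus>s\<in>insert k D. b s \<otimes> f s) = (\<Oplus>s\<in>D. b s \<otimes> f s) \<oplus> b k \<otimes> f k"
    if "b \<in> insert k D \<rightarrow> carrier R" for b
    using that insert.hyps f(1,2) by (subst finsum_insert) (auto simp: Pi_iff a_comm intro!: finsum_closed)
  have "y \<in> Idl (f ` insert k D) \<longleftrightarrow>
      (\<exists>u\<in>Idl (f ` D). \<exists>r\<in>carrier R. y = u \<oplus> r \<otimes> f k)"
    using genideal_insert[OF f(3,2)] add_principal_mem[OF genideal_ideal[OF f(3)] f(2)] by simp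
  also have "\<dots> \<longleftrightarrow> (\<exists>b\<in>insert k D \<rightarrow> carrier R. y = (\<Oplus>s\<in>insert k D. b s \<otimes> f s))"
  proof
    assume "\<exists>u\<in>Idl (f ` D). \<exists>r\<in>carrier R. y = u \<oplus> r \<otimes> f k"
    then obtain b r where b: "b \<in> D \<rightarrow> carrier R" "r \<in> carrier R" "y = (\<Oplus>s\<in>D. b s \<otimes> f s) \<oplus> r \<otimes> f k"
      using insert.IH[OF f(1)] by auto
    have b': "b(k := r) \<in> insert k D \<rightarrow> carrier R" using b(1,2) by auto
    have "(\<Oplus>s\<in>D. (b(k := r)) s \<otimes> f s) = (\<Oplus>s\<in>D. b s \<otimes> f s)"
      using b(1) f(1) insert.hyps by (intro finsum_cong') (auto simp: Pi_iff)
    then show "\<exists>b\<in>insert k D \<rightarrow> carrier R. y = (\<Oplus>s\<in>insert k D. b s \<otimes> f s)"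
      using sum[OF b'] b(3) b' by (intro bexI[of _ "b(k := r)"]) simp_all
  next
    assume "\<exists>b\<in>insert k D \<rightarrow> carrier R. y = (\<Oplus>s\<in>insert k D. b s \<otimes> f s)"
    then obtain b where b: "b \<in> insert k D \<rightarrow> carrier R" "y = (\<Oplus>s\<in>insert k D. b s \<otimes> f s)" by blast
    then have "b \<in> D \<rightarrow> carrier R" "b k \<in> carrier R" by auto
    then show "\<exists>u\<in>Idl (f ` D). \<exists>r\<in>carrier R. y = u \<oplus> r \<otimes> f k"
      using insert.IH[OF f(1)] sum[OF b(1)] b(2) by blast
  qed
  finally show ?case .
qed

text \<open>Decomposes w, as \<open>divpow\<close> requires, into products of the basis vectors e_t
  with the part of column t above the diagonal. Summing the boundaries returns row b of w applied to
  x: entries right of the diagonal come from the vectors v, those left of it from the basis vectors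
  and antisymmetry.\<close>

lemma alternating_as_koszul_relations:
  assumes x: "x \<in> {..<d} \<rightarrow> carrier R" and w: "alternating {..<d} w"
  obtains u v where "\<And>s. u s \<in> {..<d} \<rightarrow> carrier R" "\<And>s. v s \<in> {..<d} \<rightarrow> carrier R"
    "\<And>b. b < d \<Longrightarrow> omega d x u v d b = (\<Oplus>c\<in>{..<d}. w b c \<otimes> x c)"
proof -
  have wc: "w i j \<in> carrier R" "w i i = \<zero>" if "i < d" "j < d" for i j
    using alternatingD(1,2)[OF w] that by auto
  have ws: "w i j = \<ominus> w j i" if "i < d" "j < d" for i j
    by (rule alternatingD(3)[OF w]) (use that in auto)
  have xc: "\<And>i. i < d \<Longrightarrow> x i \<in> carrier R" using x by auto
  define u where "u t b = (if b = t then \<one> else \<zero>)" for t b :: nat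
  \<comment> \<open>The guard \<open>t < d\<close> makes v t a family in the ring for every t, as
    the facts on \<open>divpow\<close> assume.\<close>
  define v where "v t b = (if b < t \<and> t < d then w b t else \<zero>)" for t b :: nat
  have uc: "u s \<in> {..<d} \<rightarrow> carrier R" "\<And>b. u s b \<in> carrier R" for s unfolding u_def by auto
  have vc: "v s \<in> {..<d} \<rightarrow> carrier R" "\<And>b. b < d \<Longrightarrow> v s b \<in> carrier R" for s unfolding v_def using wc by auto
  have du: "dot d (u t) x = x t" if t: "t < d" for t
  proof -
    have "dot d (u t) x = (\<Oplus>j\<in>{..<d}. if t = j then x j else \<zero>)"
      unfolding dot_def u_def using xc by (intro finsum_cong') auto
    then show ?thesis using finsum_singleton[of t "{..<d}" x] t x by simp
  qed
  have "omega d x u v d b = (\<Oplus>c\<in>{..<d}. w b c \<otimes> x c)" if b: "b < d" for b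
  proof -
    have dv: "dot d (v t) x \<in> carrier R" for t using dot_closed[OF vc(1) x] .
    have "omega d x u v d b = (\<Oplus>t\<in>{..<d}. x t \<otimes> v t b \<oplus> (if b = t then \<ominus> dot d (v t) x else \<zero>))"
      unfolding omega_def koszul_rel_def
      by (rule finsum_cong') (use b xc vc dv du in \<open>auto simp: u_def\<close>)
    also have "\<dots> = (\<Oplus>t\<in>{..<d}. x t \<otimes> v t b) \<oplus> (\<Oplus>t\<in>{..<d}. if b = t then \<ominus> dot d (v t) x else \<zero>)"
      using b xc vc dv by (intro finsum_addf) auto
    also have "(\<Oplus>t\<in>{..<d}. if b = t then \<ominus> dot d (v t) x else \<zero>) = \<ominus> dot d (v b) x"
      using b dv finsum_singleton[of b "{..<d}" "\<lambda>t. \<ominus> dot d (v t) x"] by simp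
    also have "(\<Oplus>t\<in>{..<d}. x t \<otimes> v t b) \<oplus> \<ominus> dot d (v b) x =
        (\<Oplus>t\<in>{..<d}. x t \<otimes> v t b \<ominus> v b t \<otimes> x t)"
      unfolding dot_def minus_eq[symmetric] using b xc vc by (intro finsum_minus[symmetric]) auto
    also have "\<dots> = (\<Oplus>c\<in>{..<d}. w b c \<otimes> x c)"
    proof (rule finsum_cong')
      fix c assume c: "c \<in> {..<d}"
      consider "b < c" | "b = c" | "c < b" by linarith
      then show "x c \<otimes> v c b \<ominus> v b c \<otimes> x c = w b c \<otimes> x c"
      proof cases
        case 1
        then show ?thesis using b c wc(1)[of b c] xc[of c] by (simp add: v_def m_comm minus_eq)
      next
        case 2
        then show ?thesis using b c wc(2)[of b b] xc[of c] by (simp add: v_def minus_eq)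
      next
        case 3
        have cd: "c < d" using c by simp
        show ?thesis using 3 b cd wc(1)[of c b] xc[of c]
          unfolding ws[OF b cd] by (simp add: v_def minus_eq l_minus)
      qed
    qed (use wc xc b in auto)
    finally show ?thesis .
  qed
  then show thesis using that[of u v] uc(1) vc(1) by blast
qed

end

section \<open>Free first Koszul homology\<close>

context cring
begin

text \<open>The classes of the \<open>Z j\<close> with \<open>j < m\<close> are a basis of the first Koszul homology of \<open>f\<close> over the quotient
  by \<open>(f)\<close>. Since 1-boundaries are the combinations of \<open>f\<close> with alternating coefficient matrix,
  no elements of degree 2 occur.\<close>

definition free_H1 :: "nat \<Rightarrow> (nat \<Rightarrow> 'a) \<Rightarrow> nat \<Rightarrow> (nat \<Rightarrow> nat \<Rightarrow> 'a) \<Rightarrow> bool" where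
  "free_H1 n f m Z \<longleftrightarrow> (\<forall>j<m. Z j \<in> {..<n} \<rightarrow> carrier R \<and> dot n (Z j) f = \<zero>) \<and>
    (\<forall>r\<in>{..<n} \<rightarrow> carrier R. dot n r f = \<zero> \<longrightarrow>
      (\<exists>a w. a \<in> {..<m} \<rightarrow> carrier R \<and> alternating {..<n} w \<and>
        (\<forall>s<n. r s = (\<Oplus>j\<in>{..<m}. a j \<otimes> Z j s) \<oplus> dot n (w s) f))) \<and>
    (\<forall>a w. a \<in> {..<m} \<rightarrow> carrier R \<longrightarrow> alternating {..<n} w \<longrightarrow>
      (\<forall>s<n. (\<Oplus>j\<in>{..<m}. a j \<otimes> Z j s) = dot n (w s) f) \<longrightarrow> (\<forall>j<m. a j \<in> Idl (f ` {..<n})))"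

text \<open>\<open>W'\<close>, \<open>W\<close>, \<open>G\<close> are consecutive divided powers. Writing \<open>c W' = dV + \<Sum>s. f s B s\<close> and applying \<open>d\<close>, the
  elements \<open>c \<rho> s W - d (B s)\<close> form a family of 1-cycles of \<open>f\<close>; expand it in the basis \<open>Z\<close>, apply \<open>d\<close>
  again and compare coefficients.\<close>

lemma free_H1_step:
  assumes free: "free_H1 n f m Z" and f: "f \<in> {..<n} \<rightarrow> carrier R"
    and x: "x \<in> {..<d} \<rightarrow> carrier R"
    and \<rho>: "\<And>s. s < n \<Longrightarrow> \<rho> s \<in> {..<d} \<rightarrow> carrier R"
    and a: "a \<in> {..<m} \<rightarrow> carrier R"
    and rel: "\<And>s. s < n \<Longrightarrow> (\<Oplus>j\<in>{..<m}. a j \<otimes> Z j s) = dot d (\<rho> s) x"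
    and \<omega>: "\<omega> \<in> {..<d} \<rightarrow> carrier R" "\<And>b. b < d \<Longrightarrow> \<omega> b = (\<Oplus>s\<in>{..<n}. f s \<otimes> \<rho> s b)"
    and W: "W \<in> UNIV \<rightarrow> carrier R" "W' \<in> UNIV \<rightarrow> carrier R" "G \<in> UNIV \<rightarrow> carrier R"
      "kd x d W' = kmul \<omega> d W" "kd x d W = kmul \<omega> d G"
    and c: "c \<in> carrier R" and V: "V \<in> UNIV \<rightarrow> carrier R"
      "\<And>T. c \<otimes> W' T \<ominus> kd x d V T \<in> Idl (f ` {..<n})"
    and k: "k < m"
  shows "\<exists>V\<in>UNIV \<rightarrow> carrier R. \<forall>T. (c \<otimes> a k) \<otimes> W T \<ominus> kd x d V T \<in> Idl (f ` {..<n})"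
proof -
  note lin = klinear_kd[OF x]
  note lr = klinear_kmul[OF \<rho>]
  have fc: "\<And>s. s < n \<Longrightarrow> f s \<in> carrier R" using f by auto
  have Z: "\<And>j s. j < m \<Longrightarrow> s < n \<Longrightarrow> Z j s \<in> carrier R" and ac: "\<And>j. j < m \<Longrightarrow> a j \<in> carrier R"
    using free a unfolding free_H1_def by (auto simp: Pi_iff)
  have Wc: "\<And>T. W T \<in> carrier R" "\<And>T. W' T \<in> carrier R" "\<And>T. G T \<in> carrier R" using W by auto
  have "\<forall>T. \<exists>b. b \<in> {..<n} \<rightarrow> carrier R \<and> c \<otimes> W' T \<ominus> kd x d V T = (\<Oplus>s\<in>{..<n}. b s \<otimes> f s)"
    using V(2) genideal_finite_image[OF finite_lessThan f] by blast
  from choice[OF this] obtain b where b: "\<And>T. b T \<in> {..<n} \<rightarrow> carrier R"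
    "\<And>T. c \<otimes> W' T \<ominus> kd x d V T = (\<Oplus>s\<in>{..<n}. b T s \<otimes> f s)" by blast
  define B where "B s T = b T s" for s T
  have Bc: "B s \<in> UNIV \<rightarrow> carrier R" if "s < n" for s using b(1) that unfolding B_def by auto
  have BT: "\<And>s T. s < n \<Longrightarrow> B s T \<in> carrier R" using Bc by auto
  have cW': "(\<lambda>T. c \<otimes> W' T) \<in> UNIV \<rightarrow> carrier R" using Wc c by auto
  have LW: "\<And>s T. s < n \<Longrightarrow> kmul (\<rho> s) d W T \<in> carrier R" using kmul_closed(2)[OF \<rho> W(1)] .
  have dB: "\<And>s T. s < n \<Longrightarrow> kd x d (B s) T \<in> carrier R" using kd_closed(2)[OF x Bc] .
  have kmul\<omega>: "kmul \<omega> d e T = (\<Oplus>s\<in>{..<n}. f s \<otimes> kmul (\<rho> s) d e T)" if e: "e \<in> UNIV \<rightarrow> carrier R" for e T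
  proof -
    have "(\<lambda>b. \<Oplus>s\<in>{..<n}. f s \<otimes> \<rho> s b) \<in> {..<d} \<rightarrow> carrier R"
      using fc \<rho> by (auto intro!: finsum_closed simp: Pi_iff)
    then have "kmul \<omega> d e = kmul (\<lambda>b. \<Oplus>s\<in>{..<n}. f s \<otimes> \<rho> s b) d e"
      by (intro kmul_cong \<omega>(2) e)
    then show ?thesis using kmul_lincomb[OF _ _ _ e, of "{..<n}" f \<rho> d T] fc \<rho> by simp
  qed
  define z where "z s T = c \<otimes> kmul (\<rho> s) d W T \<ominus> kd x d (B s) T" for s T
  have zc: "\<And>s T. s < n \<Longrightarrow> z s T \<in> carrier R" unfolding z_def using c LW dB by auto
  have cycle: "dot n (\<lambda>s. z s T) f = \<zero>" for T
  proof -
    have "kd x d (\<lambda>T. c \<otimes> W' T \<ominus> kd x d V T) = (\<lambda>T. c \<otimes> kmul \<omega> d W T)"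
    proof
      fix T
      have "kd x d (\<lambda>T. c \<otimes> W' T \<ominus> kd x d V T) T =
          kd x d (\<lambda>T. c \<otimes> W' T) T \<ominus> kd x d (kd x d V) T"
        using klinear_minus[OF lin cW' kd_closed(1)[OF x V(1)]] by simp
      also have "\<dots> = c \<otimes> kmul \<omega> d W T \<ominus> \<zero>"
        using klinearD(4)[OF lin W(2) c] W(4) kd_kd[OF x V(1)] by simp
      finally show "kd x d (\<lambda>T. c \<otimes> W' T \<ominus> kd x d V T) T = c \<otimes> kmul \<omega> d W T"
        using c kmul_closed(2)[OF \<omega>(1) W(1)] by (simp add: minus_eq)
    qed
    moreover have "(\<lambda>T. c \<otimes> W' T \<ominus> kd x d V T) = (\<lambda>T. \<Oplus>s\<in>{..<n}. f s \<otimes> B s T)"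
      unfolding b(2) B_def using b(1) fc by (intro ext finsum_cong') (auto simp: m_comm Pi_iff)
    moreover have "kd x d (\<lambda>T. \<Oplus>s\<in>{..<n}. f s \<otimes> B s T) = (\<lambda>T. \<Oplus>s\<in>{..<n}. f s \<otimes> kd x d (B s) T)"
      by (rule klinear_lincomb[OF lin]) (use fc Bc in auto)
    ultimately have "(\<lambda>T. \<Oplus>s\<in>{..<n}. f s \<otimes> kd x d (B s) T) = (\<lambda>T. c \<otimes> kmul \<omega> d W T)" by simp
    then have 1: "(\<Oplus>s\<in>{..<n}. f s \<otimes> kd x d (B s) T) = c \<otimes> kmul \<omega> d W T" by (rule fun_cong)
    have "dot n (\<lambda>s. z s T) f = (\<Oplus>s\<in>{..<n}. c \<otimes> (f s \<otimes> kmul (\<rho> s) d W T) \<ominus> f s \<otimes> kd x d (B s) T)"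
      unfolding dot_def
    proof (rule finsum_cong')
      fix s assume "s \<in> {..<n}"
      then have "f s \<in> carrier R" "kmul (\<rho> s) d W T \<in> carrier R" "kd x d (B s) T \<in> carrier R"
        using fc LW dB by auto
      moreover have "(c \<otimes> p \<ominus> q) \<otimes> g = c \<otimes> (g \<otimes> p) \<ominus> g \<otimes> q"
        if "p \<in> carrier R" "q \<in> carrier R" "g \<in> carrier R" for p q g using that c by algebra
      ultimately show "z s T \<otimes> f s = c \<otimes> (f s \<otimes> kmul (\<rho> s) d W T) \<ominus> f s \<otimes> kd x d (B s) T"
        unfolding z_def by blast
    qed (use c fc LW dB in auto)
    also have "\<dots> = (\<Oplus>s\<in>{..<n}. c \<otimes> (f s \<otimes> kmul (\<rho> s) d W T)) \<ominus> (\<Oplus>s\<in>{..<n}. f s \<otimes> kd x d (B s) T)"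
      using c fc LW dB by (intro finsum_minus) auto
    also have "(\<Oplus>s\<in>{..<n}. c \<otimes> (f s \<otimes> kmul (\<rho> s) d W T)) = c \<otimes> kmul \<omega> d W T"
      unfolding kmul\<omega>[OF W(1)] using c fc LW by (intro finsum_rdistr[symmetric]) auto
    finally show ?thesis unfolding 1 using c kmul_closed(2)[OF \<omega>(1) W(1)] by (simp add: minus_eq r_neg)
  qed
  \<comment> \<open>Freeness is applied separately at each index set T, with no linearity in T.
    Collecting the chosen coefficients in A and Y turns them into elements of the exterior algebra
    again.\<close>
  define P where "P T \<alpha> w \<longleftrightarrow> \<alpha> \<in> {..<m} \<rightarrow> carrier R \<and> alternating {..<n} w \<and>
      (\<forall>s<n. z s T = (\<Oplus>j\<in>{..<m}. \<alpha> j \<otimes> Z j s) \<oplus> dot n (w s) f)" for T \<alpha> w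
  have "\<exists>\<alpha> w. P T \<alpha> w" for T
  proof -
    have "(\<lambda>s. z s T) \<in> {..<n} \<rightarrow> carrier R" using zc by auto
    then show ?thesis using free cycle[of T] unfolding free_H1_def P_def by blast
  qed
  then have "\<forall>T. \<exists>\<alpha>. \<exists>w. P T \<alpha> w" by simp
  from choice[OF this] obtain \<alpha> where "\<forall>T. \<exists>w. P T (\<alpha> T) w" by (rule exE)
  from choice[OF this] obtain w where P: "\<forall>T. P T (\<alpha> T) (w T)" by (rule exE)
  have \<alpha>: "\<And>T. \<alpha> T \<in> {..<m} \<rightarrow> carrier R" and w: "\<And>T. alternating {..<n} (w T)"
    and z: "\<And>T s. s < n \<Longrightarrow> z s T = (\<Oplus>j\<in>{..<m}. \<alpha> T j \<otimes> Z j s) \<oplus> dot n (w T s) f"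
    using P unfolding P_def by blast+
  define A where "A j T = \<alpha> T j" for j T
  define Y where "Y s t T = w T s t" for s t T
  have Ac: "A j \<in> UNIV \<rightarrow> carrier R" if "j < m" for j unfolding A_def using \<alpha> that by (auto simp: Pi_iff)
  have AT: "\<And>j T. j < m \<Longrightarrow> A j T \<in> carrier R" using Ac by auto
  have Yc: "Y s t \<in> UNIV \<rightarrow> carrier R" if "s < n" "t < n" for s t
    unfolding Y_def using alternatingD(1)[OF w] that by auto
  have YT: "\<And>s t T. s < n \<Longrightarrow> t < n \<Longrightarrow> Y s t T \<in> carrier R" using Yc by auto
  have dA: "\<And>j T. j < m \<Longrightarrow> kd x d (A j) T \<in> carrier R" using kd_closed(2)[OF x Ac] .
  have dY: "\<And>s t T. s < n \<Longrightarrow> t < n \<Longrightarrow> kd x d (Y s t) T \<in> carrier R" using kd_closed(2)[OF x Yc] .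
  \<comment> \<open>The boundary of z s is computed twice: here from its expansion through Z and f,
    and in \<open>dz2\<close> from its definition. There a enters through \<open>rel\<close>, and
    the double boundary of B s vanishes.\<close>
  have dz1: "kd x d (z s) U = (\<Oplus>j\<in>{..<m}. Z j s \<otimes> kd x d (A j) U) \<oplus> (\<Oplus>t\<in>{..<n}. f t \<otimes> kd x d (Y s t) U)"
    if s: "s < n" for s U
  proof -
    have "z s = (\<lambda>T. (\<Oplus>j\<in>{..<m}. Z j s \<otimes> A j T) \<oplus> (\<Oplus>t\<in>{..<n}. f t \<otimes> Y s t T))"
    proof
      fix T
      have "(\<Oplus>j\<in>{..<m}. \<alpha> T j \<otimes> Z j s) = (\<Oplus>j\<in>{..<m}. Z j s \<otimes> A j T)"
        using Z[OF _ s] AT unfolding A_def by (intro finsum_cong') (auto simp: m_comm)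
      moreover have "dot n (w T s) f = (\<Oplus>t\<in>{..<n}. f t \<otimes> Y s t T)"
        using fc YT[OF s] unfolding Y_def dot_def by (intro finsum_cong') (auto simp: m_comm)
      ultimately show "z s T = (\<Oplus>j\<in>{..<m}. Z j s \<otimes> A j T) \<oplus> (\<Oplus>t\<in>{..<n}. f t \<otimes> Y s t T)"
        using z[OF s] by simp
    qed
    moreover have "(\<lambda>T. \<Oplus>j\<in>{..<m}. Z j s \<otimes> A j T) \<in> UNIV \<rightarrow> carrier R"
      "(\<lambda>T. \<Oplus>t\<in>{..<n}. f t \<otimes> Y s t T) \<in> UNIV \<rightarrow> carrier R"
      using Z[OF _ s] AT fc YT[OF s] by (auto intro!: finsum_closed)
    ultimately have "kd x d (z s) = (\<lambda>U. kd x d (\<lambda>T. \<Oplus>j\<in>{..<m}. Z j s \<otimes> A j T) U \<oplus>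
        kd x d (\<lambda>T. \<Oplus>t\<in>{..<n}. f t \<otimes> Y s t T) U)"
      using klinearD(3)[OF lin] by simp
    also have "kd x d (\<lambda>T. \<Oplus>j\<in>{..<m}. Z j s \<otimes> A j T) = (\<lambda>U. \<Oplus>j\<in>{..<m}. Z j s \<otimes> kd x d (A j) U)"
      by (rule klinear_lincomb[OF lin]) (use Z[OF _ s] Ac in auto)
    also have "kd x d (\<lambda>T. \<Oplus>t\<in>{..<n}. f t \<otimes> Y s t T) = (\<lambda>U. \<Oplus>t\<in>{..<n}. f t \<otimes> kd x d (Y s t) U)"
      by (rule klinear_lincomb[OF lin]) (use fc Yc[OF s] in auto)
    finally show ?thesis by simp
  qed
  have LLG: "\<And>s t U. s < n \<Longrightarrow> t < n \<Longrightarrow> kmul (\<rho> s) d (kmul (\<rho> t) d G) U \<in> carrier R"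
    using kmul_closed(2)[OF \<rho> kmul_closed(1)[OF \<rho> W(3)]] .
  have dz2: "kd x d (z s) U = c \<otimes> (\<Oplus>j\<in>{..<m}. a j \<otimes> Z j s) \<otimes> W U \<ominus>
      (\<Oplus>t\<in>{..<n}. f t \<otimes> (c \<otimes> kmul (\<rho> s) d (kmul (\<rho> t) d G) U))" if s: "s < n" for s U
  proof -
    have LWs: "kmul (\<rho> s) d W \<in> UNIV \<rightarrow> carrier R" using kmul_closed(1)[OF \<rho>[OF s] W(1)] .
    have cLW: "(\<lambda>T. c \<otimes> kmul (\<rho> s) d W T) \<in> UNIV \<rightarrow> carrier R" using c LW s by auto
    have "kd x d (z s) U = kd x d (\<lambda>T. c \<otimes> kmul (\<rho> s) d W T) U \<ominus> kd x d (kd x d (B s)) U"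
      unfolding z_def[abs_def] using klinear_minus[OF lin cLW kd_closed(1)[OF x Bc[OF s]]] by simp
    also have "\<dots> = c \<otimes> kd x d (kmul (\<rho> s) d W) U \<ominus> \<zero>"
      using klinearD(4)[OF lin LWs c] kd_kd[OF x Bc[OF s]] by simp
    also have "kd x d (kmul (\<rho> s) d W) U = dot d (\<rho> s) x \<otimes> W U \<ominus> kmul (\<rho> s) d (kmul \<omega> d G) U"
      using kd_kmul'[OF x \<rho>[OF s] W(1)] W(5) by simp
    also have "kmul (\<rho> s) d (kmul \<omega> d G) U = (\<Oplus>t\<in>{..<n}. f t \<otimes> kmul (\<rho> s) d (kmul (\<rho> t) d G) U)"
    proof -
      have "kmul \<omega> d G = (\<lambda>U. \<Oplus>t\<in>{..<n}. f t \<otimes> kmul (\<rho> t) d G U)" using kmul\<omega>[OF W(3)] by blast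
      then show ?thesis
        using klinear_lincomb[OF lr[OF s], of "{..<n}" f "\<lambda>t. kmul (\<rho> t) d G"] fc kmul_closed(1)[OF \<rho> W(3)]
        by simp
    qed
    also have "c \<otimes> (dot d (\<rho> s) x \<otimes> W U \<ominus> (\<Oplus>t\<in>{..<n}. f t \<otimes> kmul (\<rho> s) d (kmul (\<rho> t) d G) U)) \<ominus> \<zero> =
        c \<otimes> dot d (\<rho> s) x \<otimes> W U \<ominus> c \<otimes> (\<Oplus>t\<in>{..<n}. f t \<otimes> kmul (\<rho> s) d (kmul (\<rho> t) d G) U)"
    proof -
      have "c \<otimes> (p \<otimes> q \<ominus> r) \<ominus> \<zero> = c \<otimes> p \<otimes> q \<ominus> c \<otimes> r"
        if "p \<in> carrier R" "q \<in> carrier R" "r \<in> carrier R" for p q r using that c by algebra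
      then show ?thesis using dot_closed[OF \<rho>[OF s] x] Wc(1) fc LLG[OF s] by (simp add: Pi_iff)
    qed
    also have "c \<otimes> (\<Oplus>t\<in>{..<n}. f t \<otimes> kmul (\<rho> s) d (kmul (\<rho> t) d G) U) =
        (\<Oplus>t\<in>{..<n}. c \<otimes> (f t \<otimes> kmul (\<rho> s) d (kmul (\<rho> t) d G) U))"
      using c fc LLG[OF s] by (intro finsum_rdistr) auto
    also have "\<dots> = (\<Oplus>t\<in>{..<n}. f t \<otimes> (c \<otimes> kmul (\<rho> s) d (kmul (\<rho> t) d G) U))"
      using c fc LLG[OF s] by (intro finsum_cong') (auto simp: m_lcomm)
    finally show ?thesis unfolding rel[OF s] .
  qed
  have "(c \<otimes> a k) \<otimes> W U \<ominus> kd x d (A k) U \<in> Idl (f ` {..<n})" for U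
  proof -
    let ?a = "\<lambda>j. (c \<otimes> a j) \<otimes> W U \<ominus> kd x d (A j) U"
    let ?L = "\<lambda>s t. c \<otimes> kmul (\<rho> s) d (kmul (\<rho> t) d G) U"
    \<comment> \<open>Comparing the two formulas expresses a combination of the Z j through f. The
      matrix involved is alternating because the choices Y are, and because multiplications by
      \<open>\<rho> s\<close> and \<open>\<rho> t\<close> anticommute.\<close>
    let ?w = "\<lambda>s t. kd x d (Y s t) U \<oplus> ?L s t"
    have aC: "?a \<in> {..<m} \<rightarrow> carrier R" using c ac Wc dA by auto
    have alt: "alternating {..<n} ?w"
      unfolding alternating_def
    proof (intro ballI conjI)
      fix s t assume st: "s \<in> {..<n}" "t \<in> {..<n}"
      then have s: "s < n" and t: "t < n" by auto
      show "?w s t \<in> carrier R" using dY[OF s t] LLG[OF s t] c by simp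
      have "Y s s = (\<lambda>T. \<zero>)" unfolding Y_def using alternatingD(2)[OF w st(1) st(1)] by simp
      then have "kd x d (Y s s) U = \<zero>" using klinear_zero[OF lin] by simp
      then show "?w s s = \<zero>" using kmul_kmul_same[OF \<rho>[OF s] W(3)] c by simp
      have "Y s t = (\<lambda>T. \<ominus> Y t s T)" unfolding Y_def by (rule ext) (rule alternatingD(3)[OF w st])
      then have 1: "kd x d (Y s t) U = \<ominus> kd x d (Y t s) U" using klinear_uminus[OF lin Yc[OF t s]] by simp
      have 2: "?L s t = \<ominus> ?L t s"
        using kmul_kmul_swap[OF \<rho>[OF s] \<rho>[OF t] W(3)] c LLG[OF t s] by (simp add: r_minus)
      have "?L t s \<in> carrier R" using c LLG[OF t s] by simp
      then show "?w s t = \<ominus> ?w t s" unfolding 1 2 using dY[OF t s] by (simp add: minus_add)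
    qed
    have eq: "(\<Oplus>j\<in>{..<m}. ?a j \<otimes> Z j s) = dot n (?w s) f" if s: "s < n" for s
    proof -
      define P where "P = c \<otimes> (\<Oplus>j\<in>{..<m}. a j \<otimes> Z j s) \<otimes> W U"
      define Q where "Q = (\<Oplus>j\<in>{..<m}. Z j s \<otimes> kd x d (A j) U)"
      define M where "M = (\<Oplus>t\<in>{..<n}. f t \<otimes> kd x d (Y s t) U)"
      define L where "L = (\<Oplus>t\<in>{..<n}. f t \<otimes> ?L s t)"
      have sumc: "(\<Oplus>j\<in>{..<m}. a j \<otimes> Z j s) \<in> carrier R" using ac Z[OF _ s] by (auto intro!: finsum_closed)
      have C: "P \<in> carrier R" "Q \<in> carrier R" "M \<in> carrier R" "L \<in> carrier R"
        unfolding P_def Q_def M_def L_def using c sumc Wc Z[OF _ s] dA fc dY[OF s] LLG[OF s]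
        by (auto intro!: finsum_closed)
      have E: "P \<ominus> L = Q \<oplus> M"
        using dz1[OF s] dz2[OF s] unfolding P_def Q_def M_def L_def by simp
      have "(\<Oplus>j\<in>{..<m}. ?a j \<otimes> Z j s) =
          (\<Oplus>j\<in>{..<m}. c \<otimes> W U \<otimes> (a j \<otimes> Z j s) \<ominus> Z j s \<otimes> kd x d (A j) U)"
      proof (rule finsum_cong')
        fix j assume "j \<in> {..<m}"
        then have "a j \<in> carrier R" "Z j s \<in> carrier R" "kd x d (A j) U \<in> carrier R" using ac Z[OF _ s] dA by auto
        moreover have "((c \<otimes> p) \<otimes> W U \<ominus> q) \<otimes> g = c \<otimes> W U \<otimes> (p \<otimes> g) \<ominus> g \<otimes> q"
          if "p \<in> carrier R" "q \<in> carrier R" "g \<in> carrier R" for p q g using that c Wc(1)[of U] by algebra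
        ultimately show "?a j \<otimes> Z j s = c \<otimes> W U \<otimes> (a j \<otimes> Z j s) \<ominus> Z j s \<otimes> kd x d (A j) U" by blast
      qed (use c Wc ac Z[OF _ s] dA in auto)
      also have "\<dots> = (\<Oplus>j\<in>{..<m}. c \<otimes> W U \<otimes> (a j \<otimes> Z j s)) \<ominus> Q"
        unfolding Q_def using c Wc ac Z[OF _ s] dA by (intro finsum_minus) auto
      also have "(\<Oplus>j\<in>{..<m}. c \<otimes> W U \<otimes> (a j \<otimes> Z j s)) = c \<otimes> W U \<otimes> (\<Oplus>j\<in>{..<m}. a j \<otimes> Z j s)"
        using c Wc ac Z[OF _ s] by (intro finsum_rdistr[symmetric]) auto
      also have "\<dots> = P" unfolding P_def using c Wc(1)[of U] sumc by (simp add: m_ac)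
      also have "P \<ominus> Q = M \<oplus> L" by (rule minus_eq_add_swap[OF C E])
      also have "M \<oplus> L = (\<Oplus>t\<in>{..<n}. f t \<otimes> kd x d (Y s t) U \<oplus> f t \<otimes> ?L s t)"
        unfolding M_def L_def using fc dY[OF s] LLG[OF s] c by (intro finsum_addf[symmetric]) auto
      also have "\<dots> = dot n (?w s) f"
        unfolding dot_def using fc dY[OF s] LLG[OF s] c
        by (intro finsum_cong') (auto simp: r_distr m_comm[of _ "f _"])
      finally show ?thesis .
    qed
    show ?thesis using free aC alt eq k unfolding free_H1_def by blast
  qed
  then show ?thesis using Ac[OF k] by blast
qed

text \<open>Iterates \<open>free_H1_step\<close> from the power d + 1 of w, which is zero, down to
  the power 0, which is one. Each descent costs a factor a k, so the power d + 1 of a k differs from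
  the coefficient of a boundary at the empty set by an element of (f), and such a coefficient lies
  in (x).\<close>

lemma free_H1_coefficient_in_prime:
  assumes free: "free_H1 n f m Z" and f: "f \<in> {..<n} \<rightarrow> carrier R"
    and x: "x \<in> {..<d} \<rightarrow> carrier R"
    and \<rho>: "\<And>s. s < n \<Longrightarrow> \<rho> s \<in> {..<d} \<rightarrow> carrier R"
    and a: "a \<in> {..<m} \<rightarrow> carrier R"
    and rel: "\<And>s. s < n \<Longrightarrow> (\<Oplus>j\<in>{..<m}. a j \<otimes> Z j s) = dot d (\<rho> s) x"
    and w: "alternating {..<d} w" "\<And>b. b < d \<Longrightarrow> (\<Oplus>s\<in>{..<n}. f s \<otimes> \<rho> s b) = dot d (w b) x"
    and M: "primeideal M R" "f ` {..<n} \<subseteq> M" "x ` {..<d} \<subseteq> M"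
    and k: "k < m"
  shows "a k \<in> M"
proof -
  interpret M: primeideal M R by fact
  have ak: "a k \<in> carrier R" using a k by auto
  obtain u v where uv: "\<And>s. u s \<in> {..<d} \<rightarrow> carrier R" "\<And>s. v s \<in> {..<d} \<rightarrow> carrier R"
    "\<And>b. b < d \<Longrightarrow> omega d x u v d b = (\<Oplus>c\<in>{..<d}. w b c \<otimes> x c)"
    using alternating_as_koszul_relations[OF x w(1)] by blast
  let ?W = "divpow d u v d" and ?\<omega> = "omega d x u v d" and ?I = "Idl (f ` {..<n})"
  note W = divpow_closed[OF x uv(1,2)] and \<omega> = omega_closed[OF x uv(1,2)]
  have fI: "f ` {..<n} \<subseteq> carrier R" using f by auto
  have I: "ideal ?I R" by (rule genideal_ideal[OF fI])
  interpret I: ideal ?I R by (rule I)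
  have \<omega>': "\<And>b. b < d \<Longrightarrow> ?\<omega> b = (\<Oplus>s\<in>{..<n}. f s \<otimes> \<rho> s b)"
    using uv(3) w(2) by (simp add: dot_def)
  have pc: "a k [^] i \<in> carrier R" for i :: nat using ak by simp
  have "\<exists>V\<in>UNIV \<rightarrow> carrier R. \<forall>T. (a k [^] i) \<otimes> ?W (Suc d - i) T \<ominus> kd x d V T \<in> ?I"
    if "i \<le> Suc d" for i
    using that
  proof (induction i)
    case 0
    have "?W (Suc d) = (\<lambda>T. \<zero>)" by (rule divpow_beyond) (use uv in auto)
    then show ?case using klinear_zero[OF klinear_kd[OF x]] I.zero_closed
      by (intro bexI[of _ "\<lambda>T. \<zero>"]) (auto simp: minus_eq)
  next
    case (Suc i)
    then obtain V where V: "V \<in> UNIV \<rightarrow> carrier R"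
      "\<And>T. (a k [^] i) \<otimes> ?W (Suc d - i) T \<ominus> kd x d V T \<in> ?I" by auto
    obtain j where j: "Suc d - i = Suc j" "Suc d - Suc i = j" using Suc.prems by (metis Suc_diff_Suc diff_Suc_Suc Suc_le_eq)
    \<comment> \<open>The power before the current one. Before the power 0 it is zero, in accordance
      with one having boundary zero.\<close>
    define G where "G = (case j of 0 \<Rightarrow> (\<lambda>T. \<zero>) | Suc j' \<Rightarrow> ?W j')"
    have Gc: "G \<in> UNIV \<rightarrow> carrier R" unfolding G_def using W by (auto split: nat.split)
    have dG: "kd x d (?W j) = kmul ?\<omega> d G"
      unfolding G_def using kd_divpow[OF x uv(1,2)] kd_kone[OF x] klinear_zero[OF klinear_kmul[OF \<omega>]]
      by (auto split: nat.split simp: divpow_0)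
    have "\<exists>V\<in>UNIV \<rightarrow> carrier R. \<forall>T. ((a k [^] i) \<otimes> a k) \<otimes> ?W j T \<ominus> kd x d V T \<in> ?I"
      by (rule free_H1_step[OF free f x \<rho> a rel \<omega> \<omega>' W W Gc kd_divpow[OF x uv(1,2)] dG pc V(1) V(2)[unfolded j(1)] k])
    then show ?case using j(2) by simp
  qed
  from this[of "Suc d"] obtain V where V: "V \<in> UNIV \<rightarrow> carrier R"
    "(a k [^] Suc d) \<otimes> ?W 0 {} \<ominus> kd x d V {} \<in> ?I" by auto
  have Vd: "kd x d V {} \<in> M"
    unfolding kd_def
  proof (rule ideal_finsum[OF M.is_ideal])
    fix j assume "j \<in> {..<d}"
    then have "x j \<in> M" using M(3) by auto
    then show "x j \<otimes> kpart j V {} \<in> M" using M.I_r_closed klinearD(2)[OF klinear_kpart V(1)] by auto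
  qed
  have IM: "?I \<subseteq> M" by (rule genideal_minimal[OF M.is_ideal M(2)])
  have W0: "?W 0 {} = \<one>" by (simp add: divpow_0 kone_def)
  have dV: "kd x d V {} \<in> carrier R" using kd_closed(2)[OF x V(1)] .
  have "a k [^] Suc d \<ominus> kd x d V {} \<in> M"
    using V(2) IM pc[of "Suc d"] unfolding W0 by auto
  then have "(a k [^] Suc d \<ominus> kd x d V {}) \<oplus> kd x d V {} \<in> M"
    using Vd M.a_closed by blast
  then have "a k [^] Suc d \<in> M" by (simp only: minus_add_cancel[OF pc dV])
  then have "a k [^] i \<in> M \<Longrightarrow> a k \<in> M" for i :: nat
  proof (induction i)
    case 0
    then show ?case using primeideal_one_notin[OF M(1)] by simp
  next
    case (Suc i)
    then show ?case using M.I_prime[OF pc ak] by auto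
  qed
  then show ?thesis using \<open>a k [^] Suc d \<in> M\<close> .
qed

end

section \<open>Depth sensitivity of the Koszul complex\<close>

context cring
begin

lemma kdeg_iff:
  "e \<in> kdeg R n i \<longleftrightarrow> e \<in> UNIV \<rightarrow> carrier R \<and> (\<forall>T. \<not> (T \<subseteq> {..<n} \<and> card T = i) \<longrightarrow> e T = \<zero>)"
proof
  assume "e \<in> kdeg R n i"
  then have e: "\<And>T. T \<subseteq> {..<n} \<Longrightarrow> e T \<in> carrier R" "\<And>T. \<not> T \<subseteq> {..<n} \<Longrightarrow> e T = \<zero>"
    "\<And>T. card T \<noteq> i \<Longrightarrow> e T = \<zero>"
    unfolding kdeg_def kelems_def by blast+
  have "e T \<in> carrier R" for T
    by (cases "T \<subseteq> {..<n}") (simp_all add: e(1,2))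
  then show "e \<in> UNIV \<rightarrow> carrier R \<and> (\<forall>T. \<not> (T \<subseteq> {..<n} \<and> card T = i) \<longrightarrow> e T = \<zero>)"
    using e(2,3) by blast
qed (auto simp: kdeg_def kelems_def)

lemma kdegD:
  assumes "e \<in> kdeg R n i"
  shows "e \<in> UNIV \<rightarrow> carrier R" "e T \<in> carrier R" "\<not> (T \<subseteq> {..<n} \<and> card T = i) \<Longrightarrow> e T = \<zero>"
  using assms unfolding kdeg_iff by auto

text \<open>Transfers the operator calculus to the given differential. Off the subsets of {..<n}
  \<open>kdiff\<close> is zero by definition, and \<open>kd\<close> is zero because e vanishes
  there.\<close>

lemma kdiff_eq_kd:
  assumes f: "f \<in> {..<n} \<rightarrow> carrier R" and e: "e \<in> kdeg R n i"
  shows "kdiff R f n e = kd f n e"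
proof
  fix U
  have ec: "\<And>T. e T \<in> carrier R" using kdegD[OF e] by auto
  have fc: "\<And>j. j < n \<Longrightarrow> f j \<in> carrier R" using f by auto
  show "kdiff R f n e U = kd f n e U"
  proof (cases "U \<subseteq> {..<n}")
    case True
    have "kd f n e U = (\<Oplus>j\<in>{..<n} - U. f j \<otimes> kpart j e U)"
      unfolding kd_def
    proof (rule add.finprod_mono_neutral_cong_right)
      show "(\<lambda>j. f j \<otimes> kpart j e U) \<in> {..<n} \<rightarrow> carrier R"
        using fc ec by (auto simp: kpart_def)
    qed (use fc in \<open>auto simp: kpart_def\<close>)
    also have "\<dots> = (\<Oplus>j\<in>{..<n} - U. rsign R (card {t \<in> U. t < j}) (f j \<otimes> e (insert j U)))"
      using fc ec by (intro finsum_cong') (auto simp: kpart_def below_def rsign_mult)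
    finally show ?thesis using True by (simp add: kdiff_def)
  next
    case False
    have "e (insert j U) = \<zero>" for j by (rule kdegD(3)[OF e]) (use False in blast)
    then have "kd f n e U = \<zero>"
      unfolding kd_def using fc by (intro add.finprod_one_eqI) (auto simp: kpart_def)
    then show ?thesis using False by (simp add: kdiff_def)
  qed
qed

lemma kd_kdeg:
  assumes f: "f \<in> {..<n} \<rightarrow> carrier R" and e: "e \<in> kdeg R n (Suc i)"
  shows "kd f n e \<in> kdeg R n i"
  unfolding kdeg_iff
proof (intro conjI allI impI)
  show "kd f n e \<in> UNIV \<rightarrow> carrier R" using kd_closed(1)[OF f] kdegD[OF e] by blast
  fix T assume T: "\<not> (T \<subseteq> {..<n} \<and> card T = i)"
  show "kd f n e T = \<zero>"
    unfolding kd_def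
  proof (rule add.finprod_one_eqI)
    fix j assume j: "j \<in> {..<n}"
    have "j \<notin> T \<Longrightarrow> \<not> (insert j T \<subseteq> {..<n} \<and> card (insert j T) = Suc i)"
      using T finite_subset[of T "{..<n}"] by auto
    then have "kpart j e T = \<zero>" using kdegD(3)[OF e] by (auto simp: kpart_def)
    then show "f j \<otimes> kpart j e T = \<zero>" using f j by (auto simp: Pi_iff)
  qed
qed

lemma kmul_kdeg:
  assumes v: "v \<in> {..<n} \<rightarrow> carrier R" and e: "e \<in> kdeg R n i"
  shows "kmul v n e \<in> kdeg R n (Suc i)"
  unfolding kdeg_iff
proof (intro conjI allI impI)
  show "kmul v n e \<in> UNIV \<rightarrow> carrier R" using kmul_closed(1)[OF v] kdegD[OF e] by blast
  fix T assume T: "\<not> (T \<subseteq> {..<n} \<and> card T = Suc i)"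
  show "kmul v n e T = \<zero>"
    unfolding kmul_def
  proof (rule add.finprod_one_eqI)
    fix j assume j: "j \<in> {..<n}"
    have "\<not> (T - {j} \<subseteq> {..<n} \<and> card (T - {j}) = i)" if jT: "j \<in> T"
    proof
      assume *: "T - {j} \<subseteq> {..<n} \<and> card (T - {j}) = i"
      then have "T \<subseteq> {..<n}" using j by auto
      then have "card T = Suc i" using * jT finite_subset[of T "{..<n}"] card_Suc_Diff1[of T j] by simp
      then show False using T \<open>T \<subseteq> {..<n}\<close> by blast
    qed
    then have "kext j e T = \<zero>" using kdegD(3)[OF e] by (auto simp: kext_def)
    then show "v j \<otimes> kext j e T = \<zero>" using v j by (auto simp: Pi_iff)
  qed
qed

lemma kdeg_beyond: "n < i \<Longrightarrow> e \<in> kdeg R n i \<Longrightarrow> e T = \<zero>"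
proof (rule kdegD(3))
  assume "n < i"
  then show "\<not> (T \<subseteq> {..<n} \<and> card T = i)" using card_mono[of "{..<n}" T] by auto
qed

lemma zero_kdeg: "(\<lambda>T. \<zero>) \<in> kdeg R n i"
  by (auto simp: kdeg_iff)

text \<open>The \<open>i\<close>-th homology of the Koszul complex of \<open>f\<close> with coefficients in \<open>R/b\<close> vanishes.\<close>

definition acyclic_mod :: "(nat \<Rightarrow> 'a) \<Rightarrow> nat \<Rightarrow> 'a set \<Rightarrow> nat \<Rightarrow> bool" where
  "acyclic_mod f n b i \<longleftrightarrow> (\<forall>e\<in>kdeg R n i. (\<forall>T. kd f n e T \<in> b) \<longrightarrow>
     (\<exists>v\<in>kdeg R n (Suc i). \<forall>T. e T \<ominus> kd f n v T \<in> b))"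

lemma kd_in_ideal:
  assumes b: "ideal b R" and f: "f \<in> {..<n} \<rightarrow> carrier R" and e: "\<And>T. e T \<in> b"
  shows "kd f n e T \<in> b"
  unfolding kd_def
proof (rule ideal_finsum[OF b])
  interpret b: ideal b R by fact
  fix j assume "j \<in> {..<n}"
  moreover have "kpart j e T \<in> b" using e b.a_inv_closed by (auto simp: kpart_def rsign_def)
  ultimately show "f j \<otimes> kpart j e T \<in> b" using f b.I_l_closed by auto
qed

lemma kmul_in_ideal:
  assumes b: "ideal b R" and v: "v \<in> {..<n} \<rightarrow> carrier R" and e: "\<And>T. e T \<in> b"
  shows "kmul v n e T \<in> b"
  unfolding kmul_def
proof (rule ideal_finsum[OF b])
  interpret b: ideal b R by fact
  fix j assume "j \<in> {..<n}"
  moreover have "kext j e T \<in> b" using e b.a_inv_closed by (auto simp: kext_def rsign_def)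
  ultimately show "v j \<otimes> kext j e T \<in> b" using v b.I_l_closed by auto
qed

text \<open>The quotients r T are chosen zero where g vanishes for reasons of degree, so that r is
  again homogeneous.\<close>

lemma split_mod_principal:
  assumes b: "ideal b R" and x: "x \<in> carrier R" and g: "g \<in> kdeg R n i"
    and gx: "\<And>T. g T \<in> b <+>\<^bsub>R\<^esub> PIdl x"
  obtains r u where "r \<in> kdeg R n i" "\<And>T. u T \<in> b" "\<And>T. g T = u T \<oplus> x \<otimes> r T"
proof -
  interpret b: ideal b R by fact
  have "\<exists>r u. r \<in> carrier R \<and> u \<in> b \<and> g T = u \<oplus> x \<otimes> r \<and> (\<not> (T \<subseteq> {..<n} \<and> card T = i) \<longrightarrow> r = \<zero>)" for T
  proof (cases "T \<subseteq> {..<n} \<and> card T = i")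
    case True
    obtain u r where "u \<in> b" "r \<in> carrier R" "g T = u \<oplus> r \<otimes> x"
      using gx[of T] add_principal_mem[OF b x] by blast
    then show ?thesis using True m_comm[OF x, of r] by (intro exI[of _ r] exI[of _ u]) simp
  next
    case False
    then have "g T = \<zero> \<oplus> x \<otimes> \<zero>" using kdegD(3)[OF g] x by simp
    then show ?thesis using b.zero_closed by blast
  qed
  then obtain r u where ru: "\<And>T. r T \<in> carrier R \<and> u T \<in> b \<and> g T = u T \<oplus> x \<otimes> r T \<and>
      (\<not> (T \<subseteq> {..<n} \<and> card T = i) \<longrightarrow> r T = \<zero>)" by metis
  then have "r \<in> kdeg R n i" unfolding kdeg_iff by auto
  then show thesis using that[of r u] ru by blast
qed

text \<open>Multiplication by x is homotopic to zero because x is the boundary of a degree one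
  element s: for a cycle e modulo b, the product s e is a cycle modulo b + (x). Writing it as dv + u
  + x r and applying d leaves x (e - dr) in b, and x is cancelled. In the long exact sequence,
  homology modulo b in degree p is a quotient of that modulo b + (x) in degree p + 1.\<close>

lemma acyclic_mod_step_down:
  assumes b: "ideal b R" and f: "f \<in> {..<n} \<rightarrow> carrier R"
    and x: "x \<in> Idl (f ` {..<n})" and reg: "\<And>y. y \<in> carrier R \<Longrightarrow> x \<otimes> y \<in> b \<Longrightarrow> y \<in> b"
    and ac: "acyclic_mod f n (b <+>\<^bsub>R\<^esub> PIdl x) (Suc p)"
  shows "acyclic_mod f n b p"
  unfolding acyclic_mod_def
proof (intro ballI impI)
  fix e assume e: "e \<in> kdeg R n p" "\<forall>T. kd f n e T \<in> b"
  interpret b: ideal b R by fact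
  note ec = kdegD[OF e(1)]
  have xc: "x \<in> carrier R" using x ideal.Icarr[OF genideal_ideal, of "f ` {..<n}"] f by auto
  obtain s where s: "s \<in> {..<n} \<rightarrow> carrier R" "x = dot n s f"
    using x genideal_finite_image[OF _ f] unfolding dot_def by auto
  let ?B = "b <+>\<^bsub>R\<^esub> PIdl x"
  note A = add_principal_ideal[OF b xc]
  interpret B: ideal ?B R by (rule A(1))
  note sd = kmul_kdeg[OF s(1) e(1)]
  have 1: "kd f n (kmul s n e) T = x \<otimes> e T \<ominus> kmul s n (kd f n e) T" for T
    using kd_kmul'[OF f s(1) ec(1)] s(2) by simp
  have 2: "kmul s n (kd f n e) T \<in> b" for T by (rule kmul_in_ideal[OF b s(1)]) (use e(2) in auto)
  have "kd f n (kmul s n e) T \<in> ?B" for T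
  proof -
    have "kmul s n (kd f n e) T \<in> ?B" using 2 A(2) by (rule subsetD[rotated])
    from B.a_closed[OF B.I_r_closed[OF A(3) ec(2)] B.a_inv_closed[OF this]]
    show ?thesis unfolding 1 minus_eq .
  qed
  then obtain v where v: "v \<in> kdeg R n (Suc (Suc p))" "\<And>T. kmul s n e T \<ominus> kd f n v T \<in> ?B"
    using ac sd unfolding acyclic_mod_def by blast
  note dv = kd_kdeg[OF f v(1)]
  have diff: "(\<lambda>T. kmul s n e T \<ominus> kd f n v T) \<in> kdeg R n (Suc p)"
    using sd dv unfolding kdeg_iff by (auto simp: minus_eq Pi_iff)
  obtain r u where r: "r \<in> kdeg R n (Suc p)" and u: "\<And>T. u T \<in> b"
    and eq: "\<And>T. kmul s n e T \<ominus> kd f n v T = u T \<oplus> x \<otimes> r T"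
    by (rule split_mod_principal[OF b xc diff v(2)]) blast
  have uc: "u \<in> UNIV \<rightarrow> carrier R" using u b.Icarr by auto
  have xr: "(\<lambda>T. x \<otimes> r T) \<in> UNIV \<rightarrow> carrier R" using xc kdegD[OF r] by auto
  note lin = klinear_kd[OF f]
  have "kd f n (\<lambda>T. kmul s n e T \<ominus> kd f n v T) T = kd f n (\<lambda>T. u T \<oplus> x \<otimes> r T) T" for T
    unfolding eq ..
  then have 3: "kd f n (kmul s n e) T \<ominus> \<zero> = kd f n u T \<oplus> x \<otimes> kd f n r T" for T
    using klinear_minus[OF lin kdegD(1)[OF sd] kdegD(1)[OF dv]] kd_kd[OF f kdegD(1)[OF v(1)]]
      klinearD(3)[OF lin uc xr] klinearD(4)[OF lin kdegD(1)[OF r] xc] by simp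
  have "e T \<ominus> kd f n r T \<in> b" for T
  proof (rule reg)
    define P where "P = e T"
    define K where "K = kd f n r T"
    define \<beta> where "\<beta> = kmul s n (kd f n e) T"
    define \<gamma> where "\<gamma> = kd f n u T"
    have \<gamma>b: "\<gamma> \<in> b" unfolding \<gamma>_def by (rule kd_in_ideal[OF b f u])
    have Kc: "K \<in> carrier R" unfolding K_def using kd_closed(2)[OF f kdegD(1)[OF r]] .
    have Pc: "P \<in> carrier R" unfolding P_def using ec by simp
    have \<beta>c: "\<beta> \<in> carrier R" using 2 b.Icarr unfolding \<beta>_def by blast
    have \<gamma>c: "\<gamma> \<in> carrier R" using \<gamma>b b.Icarr by blast
    show "e T \<ominus> kd f n r T \<in> carrier R" using Pc Kc unfolding P_def K_def by simp
    have xPK: "x \<otimes> P \<in> carrier R" "x \<otimes> K \<in> carrier R" using Pc Kc xc by auto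
    have E: "x \<otimes> P \<ominus> \<beta> = x \<otimes> K \<oplus> \<gamma>"
      using 3[of T] 1[of T] xPK \<beta>c \<gamma>c unfolding P_def K_def \<beta>_def \<gamma>_def by (simp add: minus_eq a_comm)
    have "x \<otimes> (P \<ominus> K) = x \<otimes> P \<ominus> x \<otimes> K" using Pc Kc xc by algebra
    also have "\<dots> = \<gamma> \<oplus> \<beta>" by (rule minus_eq_add_swap[OF xPK \<gamma>c \<beta>c E])
    also have "\<dots> \<in> b" using \<gamma>b 2 b.a_closed unfolding \<beta>_def by blast
    finally show "x \<otimes> (e T \<ominus> kd f n r T) \<in> b" unfolding P_def K_def .
  qed
  then show "\<exists>v\<in>kdeg R n (Suc p). \<forall>T. e T \<ominus> kd f n v T \<in> b" using r by blast
qed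

text \<open>The other part of the long exact sequence. The boundary of a cycle e modulo b + (x) is x
  r up to b, where r is a cycle modulo b because x is regular; a v with r = dv modulo b corrects e
  to the cycle e - x v modulo b.\<close>

lemma acyclic_mod_step_up:
  assumes b: "ideal b R" and f: "f \<in> {..<n} \<rightarrow> carrier R"
    and x: "x \<in> carrier R" and reg: "\<And>y. y \<in> carrier R \<Longrightarrow> x \<otimes> y \<in> b \<Longrightarrow> y \<in> b"
    and ac: "acyclic_mod f n b i" "acyclic_mod f n b (Suc i)"
  shows "acyclic_mod f n (b <+>\<^bsub>R\<^esub> PIdl x) (Suc i)"
  unfolding acyclic_mod_def
proof (intro ballI impI)
  let ?B = "b <+>\<^bsub>R\<^esub> PIdl x"
  fix e assume e: "e \<in> kdeg R n (Suc i)" "\<forall>T. kd f n e T \<in> ?B"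
  interpret b: ideal b R by fact
  note A = add_principal_ideal[OF b x]
  interpret B: ideal ?B R by (rule A(1))
  note ec = kdegD[OF e(1)] and lin = klinear_kd[OF f]
  note de = kd_kdeg[OF f e(1)]
  obtain r u where r: "r \<in> kdeg R n i" and u: "\<And>T. u T \<in> b"
    and eq: "\<And>T. kd f n e T = u T \<oplus> x \<otimes> r T"
    by (rule split_mod_principal[OF b x de]) (use e(2) in auto)
  have uc: "u \<in> UNIV \<rightarrow> carrier R" using u b.Icarr by auto
  have xr: "(\<lambda>T. x \<otimes> r T) \<in> UNIV \<rightarrow> carrier R" using x kdegD[OF r] by auto
  have rb: "kd f n r T \<in> b" for T
  proof (rule reg)
    show rc: "kd f n r T \<in> carrier R" using kd_closed(2)[OF f kdegD(1)[OF r]] .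
    have ub: "kd f n u T \<in> b" by (rule kd_in_ideal[OF b f u])
    have "kd f n e = (\<lambda>T. u T \<oplus> x \<otimes> r T)" using eq by blast
    then have "kd f n (kd f n e) T = kd f n u T \<oplus> x \<otimes> kd f n r T"
      using klinearD(3)[OF lin uc xr] klinearD(4)[OF lin kdegD(1)[OF r] x] by simp
    then have "\<zero> = kd f n u T \<oplus> x \<otimes> kd f n r T" using kd_kd[OF f ec(1)] by simp
    then have "x \<otimes> kd f n r T = \<ominus> kd f n u T"
      using minus_equality[of "x \<otimes> kd f n r T" "kd f n u T"] rc x b.Icarr[OF ub] by (simp add: a_comm)
    then show "x \<otimes> kd f n r T \<in> b" using ub b.a_inv_closed by simp
  qed
  then obtain v where v: "v \<in> kdeg R n (Suc i)" "\<And>T. r T \<ominus> kd f n v T \<in> b"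
    using ac(1) r unfolding acyclic_mod_def by blast
  have xv: "(\<lambda>T. x \<otimes> v T) \<in> UNIV \<rightarrow> carrier R" using x kdegD[OF v(1)] by auto
  have e': "(\<lambda>T. e T \<ominus> x \<otimes> v T) \<in> kdeg R n (Suc i)"
    using e(1) v(1) x unfolding kdeg_iff by (auto simp: minus_eq Pi_iff)
  have "kd f n (\<lambda>T. e T \<ominus> x \<otimes> v T) T \<in> b" for T
  proof -
    have "kd f n (\<lambda>T. e T \<ominus> x \<otimes> v T) T = (u T \<oplus> x \<otimes> r T) \<ominus> x \<otimes> kd f n v T"
      using klinear_minus[OF lin ec(1) xv] klinearD(4)[OF lin kdegD(1)[OF v(1)] x] eq by simp
    also have "\<dots> = u T \<oplus> x \<otimes> (r T \<ominus> kd f n v T)"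
    proof -
      have "u T \<in> carrier R" "r T \<in> carrier R" "kd f n v T \<in> carrier R"
        using u b.Icarr kdegD[OF r] kd_closed(2)[OF f kdegD(1)[OF v(1)]] by auto
      moreover have "(p \<oplus> x \<otimes> q) \<ominus> x \<otimes> s = p \<oplus> x \<otimes> (q \<ominus> s)"
        if "p \<in> carrier R" "q \<in> carrier R" "s \<in> carrier R" for p q s using that x by algebra
      ultimately show ?thesis by blast
    qed
    also have "\<dots> \<in> b" using u v(2) b.I_l_closed x b.a_closed by blast
    finally show ?thesis .
  qed
  then obtain w where w: "w \<in> kdeg R n (Suc (Suc i))" "\<And>T. (e T \<ominus> x \<otimes> v T) \<ominus> kd f n w T \<in> b"
    using ac(2) e' unfolding acyclic_mod_def by blast
  have "e T \<ominus> kd f n w T \<in> ?B" for T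
  proof -
    have c: "e T \<in> carrier R" "v T \<in> carrier R" "kd f n w T \<in> carrier R"
      using ec kdegD[OF v(1)] kd_closed(2)[OF f kdegD(1)[OF w(1)]] by auto
    have "p \<ominus> s = ((p \<ominus> x \<otimes> q) \<ominus> s) \<oplus> x \<otimes> q"
      if "p \<in> carrier R" "q \<in> carrier R" "s \<in> carrier R" for p q s
      using that x minus_add_cancel[of "p \<ominus> s" "x \<otimes> q"] by (simp add: minus_eq a_ac)
    then have "e T \<ominus> kd f n w T = ((e T \<ominus> x \<otimes> v T) \<ominus> kd f n w T) \<oplus> x \<otimes> v T" using c by blast
    moreover have "x \<otimes> v T \<in> ?B" using B.I_r_closed[OF A(3) c(2)] .
    ultimately show ?thesis using w(2) A(2) B.a_closed by auto
  qed
  then show "\<exists>v\<in>kdeg R n (Suc (Suc i)). \<forall>T. e T \<ominus> kd f n v T \<in> ?B" using w(1) by blast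
qed

lemma acyclic_mod_beyond:
  assumes b: "ideal b R" and f: "f \<in> {..<n} \<rightarrow> carrier R" and "n < i"
  shows "acyclic_mod f n b i"
  unfolding acyclic_mod_def
proof (intro ballI impI)
  fix e assume e: "e \<in> kdeg R n i"
  have "e T \<ominus> kd f n (\<lambda>T. \<zero>) T \<in> b" for T
    using kdeg_beyond[OF assms(3) e] klinear_zero[OF klinear_kd[OF f]]
      additive_subgroup.zero_closed[OF ideal.axioms(1)[OF b]] by (simp add: minus_eq)
  then show "\<exists>v\<in>kdeg R n (Suc i). \<forall>T. e T \<ominus> kd f n v T \<in> b" using zero_kdeg by blast
qed

text \<open>Elements y with all f s y in b are the cycles of top degree modulo b, and there are no
  nonzero boundaries in that degree.\<close>

lemma acyclic_mod_top:
  assumes b: "ideal b R" and f: "f \<in> {..<n} \<rightarrow> carrier R" and ac: "acyclic_mod f n b n"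
    and y: "y \<in> carrier R" "\<And>s. s < n \<Longrightarrow> f s \<otimes> y \<in> b"
  shows "y \<in> b"
proof -
  interpret b: ideal b R by fact
  define e where "e T = (if T = {..<n} then y else \<zero>)" for T
  have e: "e \<in> kdeg R n n" unfolding kdeg_iff e_def using y by auto
  have "kd f n e T \<in> b" for T
    unfolding kd_def
  proof (rule ideal_finsum[OF b])
    fix j assume "j \<in> {..<n}"
    then have "f j \<in> carrier R" "f j \<otimes> y \<in> b" using f y by auto
    then show "f j \<otimes> kpart j e T \<in> b"
      using b.zero_closed b.a_inv_closed y(1) by (auto simp: kpart_def rsign_def e_def r_minus)
  qed
  then obtain v where v: "v \<in> kdeg R n (Suc n)" "\<And>T. e T \<ominus> kd f n v T \<in> b"
    using ac e unfolding acyclic_mod_def by blast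
  have "v = (\<lambda>T. \<zero>)" using kdeg_beyond[OF _ v(1)] by auto
  then have "kd f n v {..<n} = \<zero>" using klinear_zero[OF klinear_kd[OF f]] by simp
  then have "y \<ominus> \<zero> \<in> b" using v(2)[of "{..<n}"] by (simp add: e_def)
  then show ?thesis using y by (simp add: minus_eq)
qed

section \<open>Regular sequences and grade\<close>

lemma regular_seq_snoc:
  "regular_seq R (xs @ [x]) \<longleftrightarrow> set xs \<subseteq> carrier R \<and> x \<in> carrier R \<and>
    Idl (insert x (set xs)) \<noteq> carrier R \<and>
    (\<forall>i < length xs. \<forall>y \<in> carrier R. xs ! i \<otimes> y \<in> Idl (set (take i xs)) \<longrightarrow> y \<in> Idl (set (take i xs))) \<and>
    (\<forall>y \<in> carrier R. x \<otimes> y \<in> Idl (set xs) \<longrightarrow> y \<in> Idl (set xs))"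
  unfolding regular_seq_def by (auto simp: nth_append less_Suc_eq)

lemma regular_seq_butlast: "regular_seq R (xs @ [x]) \<Longrightarrow> regular_seq R xs"
proof -
  assume r: "regular_seq R (xs @ [x])"
  then have c: "insert x (set xs) \<subseteq> carrier R" unfolding regular_seq_snoc by blast
  have "Idl (set xs) \<subseteq> Idl (insert x (set xs))" using subset_Idl_subset[OF c] by blast
  moreover have "Idl (insert x (set xs)) \<subseteq> carrier R" using ideal.Icarr[OF genideal_ideal[OF c]] by blast
  moreover have "Idl (insert x (set xs)) \<noteq> carrier R" using r unfolding regular_seq_snoc by blast
  ultimately have "Idl (set xs) \<noteq> carrier R" by blast
  then show ?thesis using r unfolding regular_seq_snoc regular_seq_def[of R xs] by blast
qed

lemma genideal_empty: "Idl {} = {\<zero>}"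
  using genideal_minimal[OF zeroideal, of "{}"]
    additive_subgroup.zero_closed[OF ideal.axioms(1)[OF genideal_ideal[of "{}"]]] by blast

text \<open>Contrapositive of \<open>acyclic_mod_step_down\<close>, once for each member of the
  sequence: nonvanishing homology climbs by one degree.\<close>

lemma not_acyclic_regular_seq:
  assumes f: "f \<in> {..<n} \<rightarrow> carrier R" and na: "\<not> acyclic_mod f n {\<zero>} m"
    and "regular_seq R xs" "set xs \<subseteq> Idl (f ` {..<n})"
  shows "\<not> acyclic_mod f n (Idl (set xs)) (m + length xs)"
  using assms(3,4)
proof (induction xs rule: rev_induct)
  case Nil
  then show ?case using na by (simp add: genideal_empty)
next
  case (snoc x xs)
  have r: "x \<in> carrier R" "set xs \<subseteq> carrier R" "x \<in> Idl (f ` {..<n})"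
    "\<And>y. y \<in> carrier R \<Longrightarrow> x \<otimes> y \<in> Idl (set xs) \<Longrightarrow> y \<in> Idl (set xs)"
    using snoc.prems unfolding regular_seq_snoc by auto
  have "\<not> acyclic_mod f n (Idl (set xs)) (m + length xs)"
    using snoc.IH[OF regular_seq_butlast[OF snoc.prems(1)]] snoc.prems(2) by simp
  then have "\<not> acyclic_mod f n (Idl (set xs) <+>\<^bsub>R\<^esub> PIdl x) (Suc (m + length xs))"
    using acyclic_mod_step_down[OF genideal_ideal[OF r(2)] f r(3,4)] by blast
  then show ?case using genideal_insert[OF r(2,1)] by simp
qed

end

text \<open>As long as m + g < n, homology in the top degree n vanishes modulo the sequence found so
  far, so no nonzero class is killed by the whole ideal and a further regular element exists. Each
  use of \<open>acyclic_mod_step_up\<close> loses one degree of vanishing.\<close>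

lemma (in noetherian_cring) exists_regular_seq:
  assumes f: "f \<in> {..<n} \<rightarrow> carrier R" and proper: "\<one> \<notin> Idl (f ` {..<n})"
    and ac: "\<And>i. m < i \<Longrightarrow> acyclic_mod f n {\<zero>} i" and "m + g \<le> n"
  shows "\<exists>xs. regular_seq R xs \<and> set xs \<subseteq> Idl (f ` {..<n}) \<and> length xs = g \<and>
    (\<forall>i > m + g. acyclic_mod f n (Idl (set xs)) i)"
  using assms(4)
proof (induction g)
  case 0
  have fI: "f ` {..<n} \<subseteq> carrier R" using f by auto
  have "\<zero> \<in> Idl (f ` {..<n})"
    using additive_subgroup.zero_closed[OF ideal.axioms(1)[OF genideal_ideal[OF fI]]] .
  then have "\<one> \<noteq> \<zero>" using proper by metis
  then have "\<one> \<notin> Idl {}" by (simp add: genideal_empty)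
  then have "Idl {} \<noteq> carrier R" using one_closed by blast
  then have "regular_seq R []" by (simp add: regular_seq_def)
  then show ?case using ac by (intro exI[of _ "[]"]) (auto simp: genideal_empty)
next
  case (Suc g)
  let ?I = "Idl (f ` {..<n})"
  have fI: "f ` {..<n} \<subseteq> carrier R" using f by auto
  have I: "ideal ?I R" by (rule genideal_ideal[OF fI])
  obtain xs where xs: "regular_seq R xs" "set xs \<subseteq> ?I" "length xs = g"
    "\<forall>i > m + g. acyclic_mod f n (Idl (set xs)) i" using Suc by auto
  have c: "set xs \<subseteq> carrier R" using xs(1) unfolding regular_seq_def by blast
  have b: "ideal (Idl (set xs)) R" by (rule genideal_ideal[OF c])
  have ann: "y \<in> Idl (set xs)" if y: "y \<in> carrier R" "\<And>x. x \<in> ?I \<Longrightarrow> x \<otimes> y \<in> Idl (set xs)" for y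
    by (rule acyclic_mod_top[OF b f]) (use xs(4) Suc.prems y genideal_self[OF fI] in auto)
  obtain x where x: "x \<in> ?I" "\<And>y. y \<in> carrier R \<Longrightarrow> x \<otimes> y \<in> Idl (set xs) \<Longrightarrow> y \<in> Idl (set xs)"
    using exists_regular_element[OF b I ann] by blast
  have xc: "x \<in> carrier R" using ideal.Icarr[OF I x(1)] .
  have "Idl (insert x (set xs)) \<subseteq> ?I" using genideal_minimal[OF I] x(1) xs(2) by simp
  then have "Idl (insert x (set xs)) \<noteq> carrier R" using proper one_closed by blast
  then have r: "regular_seq R (xs @ [x])"
    using xs(1) xc x(2) unfolding regular_seq_snoc regular_seq_def[of R xs] by blast
  have "acyclic_mod f n (Idl (set (xs @ [x]))) i" if "i > m + Suc g" for i
  proof -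
    define i' where "i' = i - 1"
    have i': "i = Suc i'" "i' > m + g" using that by (auto simp: i'_def)
    have "acyclic_mod f n (Idl (set xs) <+>\<^bsub>R\<^esub> PIdl x) (Suc i')"
      by (rule acyclic_mod_step_up[OF b f xc x(2)]) (use xs(4) i' in auto)
    then show ?thesis using genideal_insert[OF c xc] i' by simp
  qed
  then show ?case using r x(1) xs(2,3) by (intro exI[of _ "xs @ [x]"]) auto
qed

text \<open>A regular sequence of length g in the ideal forces nonzero homology in degree m + g,
  which cannot exceed n; conversely a sequence can be built until m + g = n.\<close>

theorem (in noetherian_cring) grade_eq_koszul:
  assumes f: "f \<in> {..<n} \<rightarrow> carrier R" and proper: "\<one> \<notin> Idl (f ` {..<n})"
    and ac: "\<And>i. m < i \<Longrightarrow> acyclic_mod f n {\<zero>} i" and na: "\<not> acyclic_mod f n {\<zero>} m"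
  shows "m \<le> n" "grade R (Idl (f ` {..<n})) = enat (n - m)"
proof -
  show mn: "m \<le> n" using acyclic_mod_beyond[OF zeroideal f] na by (meson not_le)
  show "grade R (Idl (f ` {..<n})) = enat (n - m)"
  proof (rule antisym)
    show "grade R (Idl (f ` {..<n})) \<le> enat (n - m)"
      unfolding grade_def
    proof (rule SUP_least)
      fix xs assume "xs \<in> {xs. regular_seq R xs \<and> set xs \<subseteq> Idl (f ` {..<n})}"
      then have xs: "regular_seq R xs" "set xs \<subseteq> Idl (f ` {..<n})" by auto
      then have "set xs \<subseteq> carrier R" by (simp add: regular_seq_def)
      then have "m + length xs \<le> n"
        using not_acyclic_regular_seq[OF f na xs] acyclic_mod_beyond[OF genideal_ideal f] by (meson not_le)
      then show "enat (length xs) \<le> enat (n - m)" by simp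
    qed
    have "m + (n - m) \<le> n" using mn by simp
    from exists_regular_seq[OF f proper ac this]
    obtain xs where "regular_seq R xs" "set xs \<subseteq> Idl (f ` {..<n})" "length xs = n - m" by blast
    then show "enat (n - m) \<le> grade R (Idl (f ` {..<n}))"
      unfolding grade_def by (intro SUP_upper2[of xs]) auto
  qed
qed

section \<open>Quasi-complete intersection ideals\<close>

context cring
begin

lemma kcycles_iff:
  assumes "f \<in> {..<n} \<rightarrow> carrier R"
  shows "e \<in> kcycles R f n i \<longleftrightarrow> e \<in> kdeg R n i \<and> kd f n e = (\<lambda>T. \<zero>)"
  unfolding kcycles_def kzero_def using kdiff_eq_kd[OF assms] by auto

lemma kbounds_iff:
  assumes "f \<in> {..<n} \<rightarrow> carrier R"
  shows "c \<in> kbounds R f n i \<longleftrightarrow> (\<exists>v\<in>kdeg R n (Suc i). c = kd f n v)"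
  unfolding kbounds_def image_iff using kdiff_eq_kd[OF assms] by auto

text \<open>Only singletons contribute to the product since z has degree one, and for them the
  inversion count is \<open>below\<close>.\<close>

lemma kmult_eq_kmul:
  assumes z: "z \<in> kdeg R n 1" and e: "e \<in> kdeg R n i"
  shows "kmult R z e = kmul (\<lambda>a. z {a}) n e"
proof
  fix W
  have zc: "\<And>T. z T \<in> carrier R" and ec: "\<And>T. e T \<in> carrier R" using kdegD[OF z] kdegD[OF e] by auto
  let ?h = "\<lambda>S. rsign R (card {(s, t). s \<in> S \<and> t \<in> W - S \<and> t < s}) (z S \<otimes> e (W - S))"
  have hc: "?h S \<in> carrier R" for S using zc ec by simp
  show "kmult R z e W = kmul (\<lambda>a. z {a}) n e W"
  proof (cases "finite W")
    case True
    let ?D = "W \<inter> {..<n}"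
    have "kmult R z e W = (\<Oplus>S\<in>(\<lambda>a. {a}) ` ?D. ?h S)"
      unfolding kmult_def
    proof (rule add.finprod_mono_neutral_cong_right)
      show "finite (Pow W)" using True by simp
      show "\<And>S. S \<in> Pow W - (\<lambda>a. {a}) ` ?D \<Longrightarrow> ?h S = \<zero>\<^bsub>R\<^esub>"
      proof -
        fix S assume S: "S \<in> Pow W - (\<lambda>a. {a}) ` ?D"
        have "\<not> (S \<subseteq> {..<n} \<and> card S = 1)"
        proof
          assume *: "S \<subseteq> {..<n} \<and> card S = 1"
          then obtain a where "S = {a}" by (auto simp: card_1_singleton_iff)
          then show False using S * by auto
        qed
        then have "z S = \<zero>" by (rule kdegD(3)[OF z])
        then show "?h S = \<zero>" using ec by simp
      qed
    qed (use hc in auto)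
    also have "\<dots> = (\<Oplus>a\<in>?D. ?h {a})"
      by (rule finsum_reindex) (use hc in \<open>auto simp: inj_on_def\<close>)
    also have "\<dots> = (\<Oplus>a\<in>?D. z {a} \<otimes> kext a e W)"
    proof (rule finsum_cong')
      fix a assume a: "a \<in> ?D"
      have "{(s, t). s \<in> {a} \<and> t \<in> W - {a} \<and> t < s} = (\<lambda>t. (a, t)) ` {t \<in> W. t < a}" by auto
      then have "card {(s, t). s \<in> {a} \<and> t \<in> W - {a} \<and> t < s} = below W a"
        by (simp add: card_image inj_on_def below_def)
      then show "?h {a} = z {a} \<otimes> kext a e W"
        using a zc ec by (simp add: kext_def rsign_mult)
    qed (use zc klinearD(2)[OF klinear_kext kdegD(1)[OF e]] in auto)
    also have "\<dots> = kmul (\<lambda>a. z {a}) n e W"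
      unfolding kmul_def
    proof (rule add.finprod_mono_neutral_cong_right[symmetric])
      show "(\<lambda>a. z {a} \<otimes> kext a e W) \<in> {..<n} \<rightarrow> carrier R"
        using zc klinearD(2)[OF klinear_kext kdegD(1)[OF e]] by auto
    qed (use zc in \<open>auto simp: kext_def\<close>)
    finally show ?thesis .
  next
    case False
    \<comment> \<open>For infinite W the product \<open>kmult\<close> is zero because a sum over the
      infinite set \<open>Pow W\<close> is zero by convention, and \<open>kmul\<close> is zero
      because e is supported on finite sets.\<close>
    have "kext a e W = \<zero>" for a
    proof -
      have "\<not> W - {a} \<subseteq> {..<n}" using False finite_subset[of "W - {a}" "{..<n}"] by auto
      then show ?thesis using kdegD(3)[OF e] by (simp add: kext_def)
    qed
    then have "kmul (\<lambda>a. z {a}) n e W = \<zero>" unfolding kmul_def using zc by simp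
    moreover have "kmult R z e W = \<zero>" unfolding kmult_def using False by simp
    ultimately show ?thesis by simp
  qed
qed

lemma kone_kdeg: "kone R \<in> kdeg R n 0"
  unfolding kdeg_iff using finite_subset[of _ "{..<n}"] by (auto simp: kone_def)

lemma kmul_kone:
  assumes "z \<in> kdeg R n 1"
  shows "kmul (\<lambda>a. z {a}) n (kone R) = z"
proof
  fix W
  have zc: "\<And>T. z T \<in> carrier R" using kdegD[OF assms] by auto
  have b: "below {a} a = 0" for a by (simp add: below_def)
  have k: "kext a (kone R) W = (if W = {a} then \<one> else \<zero>)" for a
    using b[of a] by (auto simp: kext_def kone_def rsign_def)
  show "kmul (\<lambda>a. z {a}) n (kone R) W = z W"
  proof (cases "W \<subseteq> {..<n} \<and> card W = 1")
    case True
    then obtain a where a: "W = {a}" "a < n" by (auto simp: card_1_singleton_iff)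
    have "kmul (\<lambda>a. z {a}) n (kone R) W = (\<Oplus>b\<in>{..<n}. if a = b then z {b} else \<zero>)"
      unfolding kmul_def k using a(1) zc by (intro finsum_cong') auto
    then show ?thesis using a finsum_singleton[of a "{..<n}" "\<lambda>b. z {b}"] zc by simp
  next
    case False
    then have "z W = \<zero>" by (rule kdegD(3)[OF assms])
    moreover have "kmul (\<lambda>a. z {a}) n (kone R) W = \<zero>"
      unfolding kmul_def k using False zc by (intro add.finprod_one_eqI) auto
    ultimately show ?thesis by simp
  qed
qed

lemma dot_kcycle:
  assumes f: "f \<in> {..<n} \<rightarrow> carrier R" and z: "z \<in> kcycles R f n 1"
  shows "dot n (\<lambda>a. z {a}) f = \<zero>"
proof -
  have zd: "z \<in> kdeg R n 1" "kd f n z {} = \<zero>" using z kcycles_iff[OF f] by auto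
  have "below {} j = 0" for j by (simp add: below_def)
  then have "dot n (\<lambda>a. z {a}) f = kd f n z {}"
    unfolding dot_def kd_def kpart_def using f kdegD(2)[OF zd(1)]
    by (intro finsum_cong') (auto simp: rsign_def m_comm Pi_iff)
  then show ?thesis using zd by simp
qed

lemma kmul_kcycles:
  assumes f: "f \<in> {..<n} \<rightarrow> carrier R" and z: "z \<in> kcycles R f n 1" and e: "e \<in> kcycles R f n i"
  shows "kmult R z e \<in> kcycles R f n (Suc i)"
proof -
  have zd: "z \<in> kdeg R n 1" and ed: "e \<in> kdeg R n i" "kd f n e = (\<lambda>T. \<zero>)"
    using z e kcycles_iff[OF f] by auto
  have v: "(\<lambda>a. z {a}) \<in> {..<n} \<rightarrow> carrier R" using kdegD(2)[OF zd] by auto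
  have "kd f n (kmul (\<lambda>a. z {a}) n e) = (\<lambda>T. \<zero>)"
    using kd_kmul'[OF f v kdegD(1)[OF ed(1)]] dot_kcycle[OF f z] ed(2)
      klinear_zero[OF klinear_kmul[OF v]] kdegD(2)[OF ed(1)] by (simp add: minus_eq)
  then show ?thesis unfolding kmult_eq_kmul[OF zd ed(1)] kcycles_iff[OF f]
    using kmul_kdeg[OF v ed(1)] by blast
qed

lemma foldr_kmult_kcycles:
  assumes f: "f \<in> {..<n} \<rightarrow> carrier R" and z: "\<And>j. j \<in> set js \<Longrightarrow> z j \<in> kcycles R f n 1"
  shows "foldr (\<lambda>j acc. kmult R (z j) acc) js (kone R) \<in> kcycles R f n (length js)"
  using z
proof (induction js)
  case Nil
  then show ?case using kone_kdeg kd_kone[OF f] kcycles_iff[OF f] by simp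
next
  case (Cons j js)
  then show ?case using kmul_kcycles[OF f] by simp
qed

lemma klincomb_one:
  assumes z: "\<And>j. j < m \<Longrightarrow> z j \<in> kdeg R n 1" and a: "\<And>T. a T \<in> carrier R"
  shows "klincomb R z m 1 a W = (\<Oplus>j\<in>{..<m}. a {j} \<otimes> z j W)"
proof -
  have zc: "\<And>j T. j < m \<Longrightarrow> z j T \<in> carrier R" using kdegD(2)[OF z] .
  have kp: "kprod R z {j} = z j" if "j < m" for j
    using kmul_kone[OF z[OF that]] kmult_eq_kmul[OF z[OF that] kone_kdeg] by (simp add: kprod_def)
  have "{T. T \<subseteq> {..<m} \<and> card T = 1} = (\<lambda>j. {j}) ` {..<m}"
    by (auto simp: card_1_singleton_iff)
  then have "klincomb R z m 1 a W = (\<Oplus>T\<in>(\<lambda>j. {j}) ` {..<m}. a T \<otimes> kprod R z T W)"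
    unfolding klincomb_def by simp
  also have "\<dots> = (\<Oplus>j\<in>{..<m}. a {j} \<otimes> kprod R z {j} W)"
    by (rule finsum_reindex) (use a kp zc in \<open>auto simp: inj_on_def\<close>)
  also have "\<dots> = (\<Oplus>j\<in>{..<m}. a {j} \<otimes> z j W)"
    using a kp zc by (intro finsum_cong') auto
  finally show ?thesis .
qed

lemma klincomb_beyond:
  assumes "m < i"
  shows "klincomb R z m i a W = \<zero>"
proof -
  have "card T \<noteq> i" if "T \<subseteq> {..<m}" for T using card_mono[OF _ that] assms by simp
  then have "{T. T \<subseteq> {..<m} \<and> card T = i} = {}" by blast
  then show ?thesis unfolding klincomb_def by (simp only: finsum_empty)
qed

section \<open>Degrees one and two as vectors and alternating matrices\<close>

definition degree_one :: "nat \<Rightarrow> (nat \<Rightarrow> 'a) \<Rightarrow> nat set \<Rightarrow> 'a" where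
  "degree_one n r T = (if T \<subseteq> {..<n} \<and> card T = 1 then r (the_elem T) else \<zero>)"

text \<open>With \<open>Max\<close> as row and \<open>Min\<close> as column index, contraction with
  t reads off w s t at {s}: there is no sign for t < s, and antisymmetry absorbs the sign for s <
  t.\<close>

definition degree_two :: "nat \<Rightarrow> (nat \<Rightarrow> nat \<Rightarrow> 'a) \<Rightarrow> nat set \<Rightarrow> 'a" where
  "degree_two n w T = (if T \<subseteq> {..<n} \<and> card T = 2 then w (Max T) (Min T) else \<zero>)"

lemma degree_one_kdeg: "r \<in> {..<n} \<rightarrow> carrier R \<Longrightarrow> degree_one n r \<in> kdeg R n 1"
  unfolding kdeg_iff degree_one_def by (auto simp: card_1_singleton_iff Pi_iff)

lemma degree_one_apply: "s < n \<Longrightarrow> degree_one n r {s} = r s"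
  by (simp add: degree_one_def)

lemma kdeg_one_eqI:
  assumes "e \<in> kdeg R n 1" "e' \<in> kdeg R n 1" "\<And>s. s < n \<Longrightarrow> e {s} = e' {s}"
  shows "e = e'"
proof
  fix T
  show "e T = e' T"
  proof (cases "T \<subseteq> {..<n} \<and> card T = 1")
    case True
    then obtain s where "T = {s}" "s < n" by (auto simp: card_1_singleton_iff)
    then show ?thesis using assms by simp
  qed (use kdegD(3)[OF assms(1)] kdegD(3)[OF assms(2)] in simp)
qed

lemma degree_one_kcycles:
  assumes f: "f \<in> {..<n} \<rightarrow> carrier R" and r: "r \<in> {..<n} \<rightarrow> carrier R" "dot n r f = \<zero>"
  shows "degree_one n r \<in> kcycles R f n 1"
proof -
  note d = degree_one_kdeg[OF r(1)]
  have "below {} j = 0" for j by (simp add: below_def)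
  then have e: "kd f n (degree_one n r) {} = dot n r f"
    unfolding dot_def kd_def kpart_def using f r(1) by (intro finsum_cong')
      (auto simp: rsign_def m_comm degree_one_apply Pi_iff)
  have dd: "kd f n (degree_one n r) \<in> kdeg R n 0" by (rule kd_kdeg[OF f]) (use d in simp)
  have "kd f n (degree_one n r) T = \<zero>" for T
  proof (cases "T = {}")
    case False
    then have "\<not> (T \<subseteq> {..<n} \<and> card T = 0)" using finite_subset[of T "{..<n}"] by auto
    then show ?thesis using kdegD(3)[OF dd] by blast
  qed (use e r(2) in simp)
  then show ?thesis using d kcycles_iff[OF f] by blast
qed

lemma kd_degree_two:
  assumes f: "f \<in> {..<n} \<rightarrow> carrier R" and e: "e \<in> kdeg R n 2"
  obtains w where "alternating {..<n} w" "\<And>s. s < n \<Longrightarrow> kd f n e {s} = dot n (w s) f"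
proof -
  have ec: "\<And>T. e T \<in> carrier R" using kdegD(2)[OF e] .
  define w where "w s t = kpart t e {s}" for s t
  have wc: "\<And>s t. w s t \<in> carrier R" unfolding w_def using klinearD(2)[OF klinear_kpart kdegD(1)[OF e]] .
  have "alternating {..<n} w"
    unfolding alternating_def
  proof (intro ballI conjI)
    fix s t :: nat
    show "w s t \<in> carrier R" by (rule wc)
    show "w s s = \<zero>" by (simp add: w_def kpart_def)
    show "w s t = \<ominus> w t s"
    proof (cases "s = t")
      case False
      have "below {s} t = (if s < t then 1 else 0)" "below {t} s = (if t < s then 1 else 0)"
        using below_insert[of s "{}" t] below_insert[of t "{}" s] by (simp_all add: below_def)
      then show ?thesis using False ec by (auto simp: w_def kpart_def rsign_def insert_commute)
    qed (simp add: w_def kpart_def)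
  qed
  moreover have "kd f n e {s} = dot n (w s) f" for s
    unfolding kd_def dot_def using f wc by (intro finsum_cong') (auto simp: w_def m_comm Pi_iff)
  ultimately show thesis using that by blast
qed

lemma degree_two_kd:
  assumes f: "f \<in> {..<n} \<rightarrow> carrier R" and w: "alternating {..<n} w"
  shows "degree_two n w \<in> kdeg R n 2" "s < n \<Longrightarrow> kd f n (degree_two n w) {s} = dot n (w s) f"
proof -
  have wc: "w s t \<in> carrier R" "w s s = \<zero>" if "s < n" "t < n" for s t
    using alternatingD(1,2)[OF w] that by auto
  have ws: "w s t = \<ominus> w t s" if "s < n" "t < n" for s t
    by (rule alternatingD(3)[OF w]) (use that in auto)
  show "degree_two n w \<in> kdeg R n 2"
    unfolding kdeg_iff
  proof (intro conjI Pi_I)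
    fix T :: "nat set"
    show "degree_two n w T \<in> carrier R"
    proof (cases "T \<subseteq> {..<n} \<and> card T = 2")
      case True
      then have "finite T" "T \<noteq> {}" using finite_subset[of T "{..<n}"] by auto
      then have "Max T \<in> T" "Min T \<in> T" by simp_all
      then have "Max T < n" "Min T < n" using True by blast+
      then show ?thesis using True wc by (simp add: degree_two_def)
    qed (auto simp: degree_two_def)
  qed (auto simp: degree_two_def)
  have dc: "degree_two n w \<in> kdeg R n 2" by fact
  have k: "kpart t (degree_two n w) {s} = w s t" if s: "s < n" and t: "t < n" for s t
  proof (cases "s = t")
    case True
    then show ?thesis using wc(2) s by (simp add: kpart_def)
  next
    case False
    have b: "below {s} t = (if s < t then 1 else 0)"
      using below_insert[of s "{}" t] by (simp add: below_def)
    have "degree_two n w {t, s} = w (max t s) (min t s)"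
      using False s t by (simp add: degree_two_def)
    then have "kpart t (degree_two n w) {s} = rsign R (if s < t then 1 else 0) (w (max t s) (min t s))"
      using False b by (simp add: kpart_def)
    also have "\<dots> = w s t"
    proof (cases "s < t")
      case True
      then show ?thesis using ws[OF s t] by (simp add: rsign_def max_def min_def)
    next
      case False
      then show ?thesis by (simp add: rsign_def max_def min_def)
    qed
    finally show ?thesis .
  qed
  assume s: "s < n"
  show "kd f n (degree_two n w) {s} = dot n (w s) f"
    unfolding kd_def dot_def using f wc k s by (intro finsum_cong') (auto simp: m_comm Pi_iff)
qed

end

text \<open>Above degree m there are no index sets, so spanning makes every cycle a boundary. In
  degree m the product of all z j is the combination with coefficient one; were it a boundary,
  independence would put one into I. These two facts give the grade, and the condition in degree one
  becomes \<open>free_H1\<close>.\<close>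

lemma (in noetherian_cring) qci_ideal_data:
  assumes qci: "qci_ideal R I" and proper: "\<one> \<notin> I"
  obtains f m Z where "f \<in> {..<num_gens R I} \<rightarrow> carrier R" "Idl (f ` {..<num_gens R I}) = I"
    "free_H1 (num_gens R I) f m Z" "m \<le> num_gens R I" "grade R I = enat (num_gens R I - m)"
proof -
  define n where "n = num_gens R I"
  have I: "ideal I R" using qci unfolding qci_ideal_def by blast
  obtain f n' m z where H: "n' = num_gens R I" "f ` {..<n'} \<subseteq> I" "Idl (f ` {..<n'}) = I"
    "\<forall>j<m. z j \<in> kcycles R f n' 1"
    "\<forall>i. (\<forall>c \<in> kcycles R f n' i. \<exists>a. (\<forall>T. a T \<in> carrier R) \<and>
                 kminus R c (klincomb R z m i a) \<in> kbounds R f n' i) \<and>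
             (\<forall>a. (\<forall>T. a T \<in> carrier R) \<longrightarrow> klincomb R z m i a \<in> kbounds R f n' i \<longrightarrow>
                 (\<forall>T. T \<subseteq> {..<m} \<and> card T = i \<longrightarrow> a T \<in> I))"
    using qci unfolding qci_ideal_def by (elim conjE exE) (rule that)
  note H = H(2-5)[unfolded H(1) n_def[symmetric]]
  have fI: "f ` {..<n} \<subseteq> I" "Idl (f ` {..<n}) = I"
    and z: "\<And>j. j < m \<Longrightarrow> z j \<in> kcycles R f n 1"
    and span: "\<And>i c. c \<in> kcycles R f n i \<Longrightarrow> \<exists>a. (\<forall>T. a T \<in> carrier R) \<and>
                 kminus R c (klincomb R z m i a) \<in> kbounds R f n i"
    and indep: "\<And>i a. \<forall>T. a T \<in> carrier R \<Longrightarrow> klincomb R z m i a \<in> kbounds R f n i \<Longrightarrow>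
                 (\<forall>T. T \<subseteq> {..<m} \<and> card T = i \<longrightarrow> a T \<in> I)"
    using H by simp_all
  have f: "f \<in> {..<n} \<rightarrow> carrier R" using fI(1) ideal.Icarr[OF I] by auto
  have zd: "\<And>j. j < m \<Longrightarrow> z j \<in> kdeg R n 1" using z kcycles_iff[OF f] by blast
  have zc: "\<And>j T. j < m \<Longrightarrow> z j T \<in> carrier R" using kdegD(2)[OF zd] .
  define Z where "Z j s = z j {s}" for j s
  have "acyclic_mod f n {\<zero>} i" if "m < i" for i
    unfolding acyclic_mod_def
  proof (intro ballI impI)
    fix e assume e: "e \<in> kdeg R n i" "\<forall>T. kd f n e T \<in> {\<zero>}"
    then have "e \<in> kcycles R f n i" using kcycles_iff[OF f] by auto
    then obtain a where "kminus R e (klincomb R z m i a) \<in> kbounds R f n i" using span by blast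
    moreover have "kminus R e (klincomb R z m i a) = e"
      unfolding kminus_def using kdegD(2)[OF e(1)] klincomb_beyond[OF that] by (simp add: minus_eq)
    ultimately obtain v where v: "v \<in> kdeg R n (Suc i)" "e = kd f n v" using kbounds_iff[OF f] by auto
    then have "e T \<ominus> kd f n v T \<in> {\<zero>}" for T
      using kdegD(2)[OF e(1)] r_neg by (simp add: minus_eq)
    then show "\<exists>v\<in>kdeg R n (Suc i). \<forall>T. e T \<ominus> kd f n v T \<in> {\<zero>}" using v by blast
  qed
  moreover have "\<not> acyclic_mod f n {\<zero>} m"
  proof
    assume ac: "acyclic_mod f n {\<zero>} m"
    have kp: "kprod R z T \<in> kcycles R f n (card T)" if "T \<subseteq> {..<m}" for T
    proof -
      have "finite T" using finite_subset[OF that] by simp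
      then show ?thesis
        using foldr_kmult_kcycles[OF f, of "sorted_list_of_set T" z] z that by (auto simp: kprod_def)
    qed
    have P: "kprod R z {..<m} \<in> kcycles R f n m" using kp[of "{..<m}"] by simp
    then have Pd: "kprod R z {..<m} \<in> kdeg R n m" "kd f n (kprod R z {..<m}) = (\<lambda>T. \<zero>)"
      using kcycles_iff[OF f] by auto
    then obtain v where v: "v \<in> kdeg R n (Suc m)" "\<And>T. kprod R z {..<m} T \<ominus> kd f n v T \<in> {\<zero>}"
      using ac unfolding acyclic_mod_def by auto
    have dv: "\<And>T. kd f n v T \<in> carrier R" using kd_closed(2)[OF f kdegD(1)[OF v(1)]] .
    have "kprod R z {..<m} T = kd f n v T" for T
    proof -
      show ?thesis
        using minus_add_cancel[OF kdegD(2)[OF Pd(1)] dv, of T T] v(2)[of T] dv by simp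
    qed
    then have "kprod R z {..<m} \<in> kbounds R f n m" using v(1) kbounds_iff[OF f] by blast
    moreover have "klincomb R z m m (\<lambda>T. \<one>) = kprod R z {..<m}"
    proof
      fix W
      have "{T. T \<subseteq> {..<m} \<and> card T = m} = {{..<m}}" using card_subset_eq[of "{..<m}"] by auto
      then show "klincomb R z m m (\<lambda>T. \<one>) W = kprod R z {..<m} W"
        using kdegD(2)[OF Pd(1)] by (simp add: klincomb_def)
    qed
    ultimately have "\<forall>T. T \<subseteq> {..<m} \<and> card T = m \<longrightarrow> \<one> \<in> I" using indep[of "\<lambda>T. \<one>" m] by simp
    then show False using proper by (metis card_lessThan order_refl)
  qed
  ultimately have "m \<le> n" "grade R (Idl (f ` {..<n})) = enat (n - m)"
    using grade_eq_koszul[OF f, of m] proper fI(2) by auto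
  moreover have "free_H1 n f m Z"
    unfolding free_H1_def
  proof (intro conjI allI ballI impI)
    show "\<And>j. j < m \<Longrightarrow> Z j \<in> {..<n} \<rightarrow> carrier R" unfolding Z_def using zc by auto
    show "\<And>j. j < m \<Longrightarrow> dot n (Z j) f = \<zero>" using dot_kcycle[OF f z] by (simp add: Z_def[abs_def])
  next
    fix r assume r: "r \<in> {..<n} \<rightarrow> carrier R" "dot n r f = \<zero>"
    obtain a where a: "\<And>T. a T \<in> carrier R"
      "kminus R (degree_one n r) (klincomb R z m 1 a) \<in> kbounds R f n 1"
      using span[OF degree_one_kcycles[OF f r]] by blast
    then obtain v where v: "v \<in> kdeg R n 2" "kminus R (degree_one n r) (klincomb R z m 1 a) = kd f n v"
      using kbounds_iff[OF f] by (auto simp: numeral_2_eq_2)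
    obtain w where w: "alternating {..<n} w" "\<And>s. s < n \<Longrightarrow> kd f n v {s} = dot n (w s) f"
      using kd_degree_two[OF f v(1)] by blast
    have "r s = (\<Oplus>j\<in>{..<m}. a {j} \<otimes> Z j s) \<oplus> dot n (w s) f" if s: "s < n" for s
    proof -
      have c: "(\<Oplus>j\<in>{..<m}. a {j} \<otimes> Z j s) \<in> carrier R" unfolding Z_def using a zc by (auto intro!: finsum_closed)
      have e: "r s \<ominus> (\<Oplus>j\<in>{..<m}. a {j} \<otimes> Z j s) = dot n (w s) f"
        using fun_cong[OF v(2), of "{s}"] w(2)[OF s] klincomb_one[OF zd a(1), where m = m] degree_one_apply[OF s]
        unfolding kminus_def Z_def by simp
      have rs: "r s \<in> carrier R" using r(1) s by auto
      have "r s = (\<Oplus>j\<in>{..<m}. a {j} \<otimes> Z j s) \<oplus> (r s \<ominus> (\<Oplus>j\<in>{..<m}. a {j} \<otimes> Z j s))"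
        using minus_add_cancel[OF rs c] rs c by (simp add: a_comm)
      then show ?thesis by (simp only: e)
    qed
    then show "\<exists>a w. a \<in> {..<m} \<rightarrow> carrier R \<and> alternating {..<n} w \<and>
        (\<forall>s<n. r s = (\<Oplus>j\<in>{..<m}. a j \<otimes> Z j s) \<oplus> dot n (w s) f)"
      using a(1) w(1) by (intro exI[of _ "\<lambda>j. a {j}"] exI[of _ w]) auto
  next
    fix a w j assume a: "a \<in> {..<m} \<rightarrow> carrier R" and w: "alternating {..<n} w"
      and eq: "\<forall>s<n. (\<Oplus>j\<in>{..<m}. a j \<otimes> Z j s) = dot n (w s) f" and j: "j < m"
    define b where "b = degree_one m a"
    have b: "b T \<in> carrier R" for T unfolding b_def using kdegD(2)[OF degree_one_kdeg[OF a]] .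
    have L: "klincomb R z m 1 b W = (\<Oplus>j\<in>{..<m}. a j \<otimes> z j W)" for W
    proof -
      have "klincomb R z m 1 b W = (\<Oplus>j\<in>{..<m}. b {j} \<otimes> z j W)" by (rule klincomb_one[OF zd b])
      also have "\<dots> = (\<Oplus>j\<in>{..<m}. a j \<otimes> z j W)"
        unfolding b_def using a zc by (intro finsum_cong') (auto simp: degree_one_apply)
      finally show ?thesis .
    qed
    have "klincomb R z m 1 b \<in> kdeg R n 1"
      unfolding kdeg_iff
    proof (intro conjI Pi_I allI impI)
      fix T
      show "klincomb R z m 1 b T \<in> carrier R" unfolding L using a zc by (auto intro!: finsum_closed)
      assume "\<not> (T \<subseteq> {..<n} \<and> card T = 1)"
      then have "\<And>j. j < m \<Longrightarrow> z j T = \<zero>" using kdegD(3)[OF zd] by blast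
      then show "klincomb R z m 1 b T = \<zero>" unfolding L using a by (intro add.finprod_one_eqI) (auto simp: Pi_iff)
    qed
    moreover have "kd f n (degree_two n w) \<in> kdeg R n 1"
      using kd_kdeg[OF f, of "degree_two n w" 1] degree_two_kd(1)[OF f w] by (simp add: numeral_2_eq_2)
    ultimately have "klincomb R z m 1 b = kd f n (degree_two n w)"
      by (rule kdeg_one_eqI) (use L eq degree_two_kd(2)[OF f w] in \<open>simp add: Z_def\<close>)
    then have "klincomb R z m 1 b \<in> kbounds R f n 1"
      using degree_two_kd(1)[OF f w] kbounds_iff[OF f] by (auto simp: numeral_2_eq_2)
    then have "b {j} \<in> I" using indep[of b 1] b j by simp
    then show "a j \<in> Idl (f ` {..<n})" using j fI(2) by (simp add: b_def degree_one_apply)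
  qed
  ultimately show thesis using that[of f m Z] f fI(2) unfolding n_def by simp
qed

section \<open>Minimal generators over a local ring\<close>

definition append_family :: "nat \<Rightarrow> (nat \<Rightarrow> 'a) \<Rightarrow> (nat \<Rightarrow> 'a) \<Rightarrow> nat \<Rightarrow> 'a" where
  "append_family k F G i = (if i < k then F i else G (i - k))"

lemma append_family_image:
  "append_family k F G ` {..<k + l} = F ` {..<k} \<union> G ` {..<l}"
proof
  show "F ` {..<k} \<union> G ` {..<l} \<subseteq> append_family k F G ` {..<k + l}"
  proof
    fix y assume "y \<in> F ` {..<k} \<union> G ` {..<l}"
    then consider i where "i < k" "y = F i" | i where "i < l" "y = G i" by auto
    then show "y \<in> append_family k F G ` {..<k + l}"
    proof cases
      case 1
      then show ?thesis by (intro image_eqI[of _ _ i]) (auto simp: append_family_def)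
    next
      case 2
      then show ?thesis by (intro image_eqI[of _ _ "k + i"]) (auto simp: append_family_def)
    qed
  qed
qed (auto simp: append_family_def)

context cring
begin

lemma finsum_append:
  fixes \<phi> :: "nat \<Rightarrow> 'a"
  assumes "\<phi> \<in> {..<k + l} \<rightarrow> carrier R"
  shows "(\<Oplus>i\<in>{..<k + l}. \<phi> i) = (\<Oplus>i\<in>{..<k}. \<phi> i) \<oplus> (\<Oplus>i\<in>{..<l}. \<phi> (k + i))"
  using assms
proof (induction l)
  case 0
  then show ?case by (simp add: Pi_iff)
next
  case (Suc l)
  have c: "\<phi> \<in> {..<k} \<rightarrow> carrier R" "(\<lambda>i. \<phi> (k + i)) \<in> {..<l} \<rightarrow> carrier R" "\<phi> (k + l) \<in> carrier R"
    "\<phi> \<in> {..<k + l} \<rightarrow> carrier R" using Suc.prems by auto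
  have s: "finsum R \<phi> {..<k} \<in> carrier R" "(\<Oplus>i\<in>{..<l}. \<phi> (k + i)) \<in> carrier R"
    using c by (auto intro!: finsum_closed)
  have 1: "(\<Oplus>i\<in>{..<k + Suc l}. \<phi> i) = \<phi> (k + l) \<oplus> (\<Oplus>i\<in>{..<k + l}. \<phi> i)"
    using c by (simp add: lessThan_Suc finsum_insert)
  have 2: "(\<Oplus>i\<in>{..<Suc l}. \<phi> (k + i)) = \<phi> (k + l) \<oplus> (\<Oplus>i\<in>{..<l}. \<phi> (k + i))"
    using c unfolding lessThan_Suc by (intro finsum_insert) auto
  show ?case unfolding 1 2 Suc.IH[OF c(4)] using s c(3) by (simp add: a_ac)
qed

lemma dot_append:
  assumes "c \<in> {..<k + l} \<rightarrow> carrier R" "F \<in> {..<k} \<rightarrow> carrier R" "G \<in> {..<l} \<rightarrow> carrier R"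
  shows "dot (k + l) c (append_family k F G) = dot k c F \<oplus> dot l (\<lambda>i. c (k + i)) G"
proof -
  have "(\<lambda>i. c i \<otimes> append_family k F G i) \<in> {..<k + l} \<rightarrow> carrier R"
    using assms by (auto simp: append_family_def Pi_iff)
  moreover have "(\<Oplus>i\<in>{..<k}. c i \<otimes> append_family k F G i) = dot k c F"
    unfolding dot_def using assms by (intro finsum_cong') (auto simp: append_family_def Pi_iff)
  moreover have "(\<Oplus>i\<in>{..<l}. c (k + i) \<otimes> append_family k F G (k + i)) = dot l (\<lambda>i. c (k + i)) G"
    unfolding dot_def using assms by (intro finsum_cong') (auto simp: append_family_def Pi_iff)
  ultimately show ?thesis using finsum_append[of "\<lambda>i. c i \<otimes> append_family k F G i" k l] by (simp add: dot_def[of "k + l"])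
qed

lemma append_family_closed:
  "F \<in> {..<k} \<rightarrow> carrier R \<Longrightarrow> G \<in> {..<l} \<rightarrow> carrier R \<Longrightarrow> append_family k F G \<in> {..<k + l} \<rightarrow> carrier R"
  by (auto simp: append_family_def Pi_iff)

lemma dot_cong:
  assumes "\<And>i. i < k \<Longrightarrow> c i = c' i" "c' \<in> {..<k} \<rightarrow> carrier R" "F \<in> {..<k} \<rightarrow> carrier R"
  shows "dot k c F = dot k c' F"
  unfolding dot_def using assms by (intro finsum_cong') auto

lemma dot_minus:
  assumes "c \<in> {..<k} \<rightarrow> carrier R" "c' \<in> {..<k} \<rightarrow> carrier R" "F \<in> {..<k} \<rightarrow> carrier R"
  shows "dot k (\<lambda>i. c i \<ominus> c' i) F = dot k c F \<ominus> dot k c' F"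
proof -
  have "dot k (\<lambda>i. c i \<ominus> c' i) F = (\<Oplus>i\<in>{..<k}. c i \<otimes> F i \<ominus> c' i \<otimes> F i)"
    unfolding dot_def using assms by (intro finsum_cong') (auto simp: minus_eq l_distr l_minus Pi_iff)
  also have "\<dots> = dot k c F \<ominus> dot k c' F"
    unfolding dot_def using assms by (intro finsum_minus) auto
  finally show ?thesis .
qed

lemma dot_zero: "F \<in> {..<k} \<rightarrow> carrier R \<Longrightarrow> (\<And>i. i < k \<Longrightarrow> c i = \<zero>) \<Longrightarrow> dot k c F = \<zero>"
  unfolding dot_def by (intro add.finprod_one_eqI) (auto simp: Pi_iff)

lemma dot_remove:
  assumes "c \<in> {..<k} \<rightarrow> carrier R" "F \<in> {..<k} \<rightarrow> carrier R" "e < k"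
  shows "dot k c F = c e \<otimes> F e \<oplus> (\<Oplus>i\<in>{..<k} - {e}. c i \<otimes> F i)"
proof -
  have "{..<k} = insert e ({..<k} - {e})" using assms(3) by auto
  then show ?thesis
    unfolding dot_def using assms finsum_insert[of "{..<k} - {e}" e "\<lambda>i. c i \<otimes> F i"] by (auto simp: Pi_iff)
qed

lemma genideal_family:
  assumes "F \<in> {..<k} \<rightarrow> carrier R"
  shows "y \<in> Idl (F ` {..<k}) \<longleftrightarrow> (\<exists>c\<in>{..<k} \<rightarrow> carrier R. y = dot k c F)"
  using genideal_finite_image[OF _ assms] unfolding dot_def by simp

lemma dot_in_ideal:
  assumes "ideal b R" "c \<in> {..<k} \<rightarrow> carrier R" "\<And>i. i < k \<Longrightarrow> F i \<in> b"
  shows "dot k c F \<in> b"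
  unfolding dot_def using assms(2,3) ideal.I_l_closed[OF assms(1)] by (intro ideal_finsum[OF assms(1)]) auto

lemma dot_in_ideal_prod:
  assumes "ideal b R" "ideal I R" "\<And>i. i < k \<Longrightarrow> c i \<in> b" "\<And>i. i < k \<Longrightarrow> F i \<in> I"
  shows "dot k c F \<in> b \<cdot>\<^bsub>R\<^esub> I"
  unfolding dot_def
  using assms(3,4) by (intro ideal_finsum[OF ideal_prod_is_ideal[OF assms(1,2)]]) (auto intro: ideal_prod.prod)

lemma ideal_prod_family:
  assumes b: "ideal b R" and F: "F \<in> {..<k} \<rightarrow> carrier R" and y: "y \<in> b \<cdot>\<^bsub>R\<^esub> (Idl (F ` {..<k}))"
  obtains c where "c \<in> {..<k} \<rightarrow> b" "y = dot k c F"
proof -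
  interpret b: ideal b R by fact
  from y have "\<exists>c\<in>{..<k} \<rightarrow> b. y = dot k c F"
  proof (induction rule: ideal_prod.induct)
    case (prod i j)
    then obtain a where a: "a \<in> {..<k} \<rightarrow> carrier R" "j = dot k a F" using genideal_family[OF F] by blast
    have "i \<otimes> j = dot k (\<lambda>s. i \<otimes> a s) F"
      unfolding a(2) dot_def
    proof (subst finsum_rdistr)
      show "(\<Oplus>s\<in>{..<k}. i \<otimes> (a s \<otimes> F s)) = (\<Oplus>s\<in>{..<k}. i \<otimes> a s \<otimes> F s)"
        using a(1) F b.Icarr[OF prod(1)] by (intro finsum_cong') (auto simp: m_assoc Pi_iff)
    qed (use a(1) F b.Icarr[OF prod(1)] in auto)
    moreover have "(\<lambda>s. i \<otimes> a s) \<in> {..<k} \<rightarrow> b" using a(1) prod(1) b.I_r_closed by auto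
    ultimately show ?case by blast
  next
    case (sum s1 s2)
    then obtain c1 c2 where c: "c1 \<in> {..<k} \<rightarrow> b" "s1 = dot k c1 F" "c2 \<in> {..<k} \<rightarrow> b" "s2 = dot k c2 F" by blast
    have cc: "c1 \<in> {..<k} \<rightarrow> carrier R" "c2 \<in> {..<k} \<rightarrow> carrier R" using c(1,3) b.Icarr by (auto simp: Pi_iff)
    have "dot k (\<lambda>s. c1 s \<oplus> c2 s) F = (\<Oplus>s\<in>{..<k}. c1 s \<otimes> F s \<oplus> c2 s \<otimes> F s)"
      unfolding dot_def using cc F by (intro finsum_cong') (auto simp: l_distr Pi_iff)
    also have "\<dots> = s1 \<oplus> s2" unfolding c dot_def using cc F by (intro finsum_addf) auto
    finally have "s1 \<oplus> s2 = dot k (\<lambda>s. c1 s \<oplus> c2 s) F" by simp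
    moreover have "(\<lambda>s. c1 s \<oplus> c2 s) \<in> {..<k} \<rightarrow> b" using c b.a_closed by auto
    ultimately show ?case by blast
  qed
  then show thesis using that by blast
qed

lemma num_gens_le:
  assumes "finite D" "F ` D \<subseteq> carrier R" "Idl (F ` D) = I"
  shows "num_gens R I \<le> card D"
proof -
  have "F ` D \<subseteq> I" using genideal_self[OF assms(2)] assms(3) by simp
  then have "num_gens R I \<le> card (F ` D)"
    unfolding num_gens_def using assms(1,3) by (intro Least_le exI[of _ "F ` D"]) simp
  also have "\<dots> \<le> card D" using assms(1) by (rule card_image_le)
  finally show ?thesis .
qed

text \<open>A unit coefficient in a relation makes its generator redundant. The setting is not
  local, so that the quotient ring is covered as well.\<close>

lemma minimal_generators_no_unit:
  assumes F: "F \<in> {..<k} \<rightarrow> carrier R" "Idl (F ` {..<k}) = I" "k = num_gens R I"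
    and c: "c \<in> {..<k} \<rightarrow> carrier R" "dot k c F = \<zero>"
    and e: "e < k" "t \<in> carrier R" "t \<otimes> c e = \<one>"
  shows False
proof -
  let ?D = "{..<k} - {e}"
  have D: "F ` ?D \<subseteq> carrier R" using F by auto
  have bI: "ideal (Idl (F ` ?D)) R" by (rule genideal_ideal[OF D])
  interpret b: ideal "Idl (F ` ?D)" R by (rule bI)
  define S where "S = (\<Oplus>i\<in>?D. c i \<otimes> F i)"
  have Sb: "S \<in> Idl (F ` ?D)"
    unfolding S_def by (rule ideal_finsum[OF bI]) (use c(1) genideal_self[OF D] b.I_l_closed in auto)
  have cc: "c e \<in> carrier R" "F e \<in> carrier R" "S \<in> carrier R" using c(1) F(1) e(1) b.Icarr[OF Sb] by auto
  have z: "c e \<otimes> F e \<oplus> S = \<zero>" using dot_remove[OF c(1) F(1) e(1)] c(2) S_def by simp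
  have "F e = (t \<otimes> c e) \<otimes> F e" using e cc by simp
  also have "\<dots> = t \<otimes> (c e \<otimes> F e \<oplus> S) \<ominus> t \<otimes> S" using cc e(2) by algebra
  also have "\<dots> = \<ominus> (t \<otimes> S)" unfolding z using cc e(2) by (simp add: minus_eq)
  finally have Fe: "F e \<in> Idl (F ` ?D)" using Sb e(2) b.I_l_closed b.a_inv_closed by simp
  have img: "F ` {..<k} = insert (F e) (F ` ?D)" using e(1) by blast
  have "F ` {..<k} \<subseteq> Idl (F ` ?D)" unfolding img using Fe genideal_self[OF D] by simp
  then have "I \<subseteq> Idl (F ` ?D)" using genideal_minimal[OF bI] F(2) by blast
  moreover have "Idl (F ` ?D) \<subseteq> I"
    unfolding F(2)[symmetric] by (rule subset_Idl_subset) (use F(1) in auto)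
  ultimately have "num_gens R I \<le> card ?D" by (intro num_gens_le[OF _ D]) auto
  then show False using e(1) F(3) by simp
qed

end

context noetherian_local_ring
begin

text \<open>Linear independence of the classes in I/NI over the residue field; nothing is said about
  generating I.\<close>

definition independent_family :: "'a set \<Rightarrow> nat \<Rightarrow> (nat \<Rightarrow> 'a) \<Rightarrow> bool" where
  "independent_family I k F \<longleftrightarrow> F \<in> {..<k} \<rightarrow> I \<and>
    (\<forall>c\<in>{..<k} \<rightarrow> carrier R. dot k c F \<in> N \<cdot>\<^bsub>R\<^esub> I \<longrightarrow> c \<in> {..<k} \<rightarrow> N)"

lemma independent_family_mono:
  assumes I: "ideal I R" and ind: "independent_family I m F" and "k \<le> m"
  shows "independent_family I k F"
  unfolding independent_family_def
proof (intro conjI ballI impI)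
  have FI: "F \<in> {..<m} \<rightarrow> I" using ind unfolding independent_family_def by blast
  then show "F \<in> {..<k} \<rightarrow> I" using assms(3) by auto
  have Fc: "F \<in> {..<m} \<rightarrow> carrier R" using FI ideal.Icarr[OF I] by auto
  fix c assume c: "c \<in> {..<k} \<rightarrow> carrier R" "dot k c F \<in> N \<cdot>\<^bsub>R\<^esub> I"
  define c' where "c' i = (if i < k then c i else \<zero>)" for i
  have c': "c' \<in> {..<m} \<rightarrow> carrier R" using c(1) unfolding c'_def by auto
  have "dot m c' F = dot k c F"
    unfolding dot_def
  proof (rule add.finprod_mono_neutral_cong_right)
    show "\<And>i. i \<in> {..<m} - {..<k} \<Longrightarrow> c' i \<otimes> F i = \<zero>\<^bsub>R\<^esub>" using Fc by (auto simp: c'_def Pi_iff)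
    show "(\<lambda>i. c' i \<otimes> F i) \<in> {..<m} \<rightarrow> carrier R" using c' Fc by auto
  qed (use assms(3) in \<open>auto simp: c'_def\<close>)
  then have "c' \<in> {..<m} \<rightarrow> N" using ind c' c(2) unfolding independent_family_def by simp
  then show "c \<in> {..<k} \<rightarrow> N" using assms(3) unfolding c'_def by (auto simp: Pi_iff split: if_splits)
qed

text \<open>Steinitz exchange. In an expression of H k through the generators some G e has a
  coefficient outside N, for otherwise a combination of the H with coefficient one at k would lie in
  N I. That coefficient is a unit, so G e is traded for H k.\<close>

lemma exchange_step:
  assumes I: "ideal I R" and H: "independent_family I (Suc k) H"
    and G: "G \<in> {..<l} \<rightarrow> carrier R" and gen: "Idl (H ` {..<k} \<union> G ` {..<l}) = I"
  obtains l' G' where "l = Suc l'" "G' ` {..<l'} \<subseteq> G ` {..<l}" "Idl (H ` {..<Suc k} \<union> G' ` {..<l'}) = I"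
proof -
  interpret I: ideal I R by fact
  have HI: "H \<in> {..<Suc k} \<rightarrow> I" and ind: "\<And>c. c \<in> {..<Suc k} \<rightarrow> carrier R \<Longrightarrow>
      dot (Suc k) c H \<in> N \<cdot>\<^bsub>R\<^esub> I \<Longrightarrow> c \<in> {..<Suc k} \<rightarrow> N"
    using H unfolding independent_family_def by blast+
  have Hc: "H \<in> {..<Suc k} \<rightarrow> carrier R" "H \<in> {..<k} \<rightarrow> carrier R" "H k \<in> carrier R" "H k \<in> I"
    using HI I.Icarr by (auto simp: Pi_iff)
  have carr: "H ` {..<k} \<union> G ` {..<l} \<subseteq> carrier R" using Hc G by auto
  have GI: "\<And>i. i < l \<Longrightarrow> G i \<in> I" using genideal_self[OF carr] gen by auto
  have "H k \<in> Idl (append_family k H G ` {..<k + l})" using Hc(4) gen by (simp add: append_family_image)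
  then obtain c where c: "c \<in> {..<k + l} \<rightarrow> carrier R" "H k = dot (k + l) c (append_family k H G)"
    using genideal_family[OF append_family_closed[OF Hc(2) G]] by blast
  define b where "b i = c (k + i)" for i
  have bc: "b \<in> {..<l} \<rightarrow> carrier R" "c \<in> {..<k} \<rightarrow> carrier R" using c(1) by (auto simp: b_def)
  have eq: "H k = dot k c H \<oplus> dot l b G" using c dot_append[OF c(1) Hc(2) G] by (simp add: b_def[abs_def])
  have dc: "dot k c H \<in> carrier R" "dot l b G \<in> carrier R" using dot_closed bc Hc G by auto
  have "\<exists>e<l. b e \<notin> N"
  proof (rule ccontr)
    assume "\<not> ?thesis"
    then have bN: "dot l b G \<in> N \<cdot>\<^bsub>R\<^esub> I" using GI by (intro dot_in_ideal_prod[OF ideal_N I]) auto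
    define g where "g i = (if i < k then \<ominus> c i else \<one>)" for i
    have g: "g \<in> {..<Suc k} \<rightarrow> carrier R" using bc by (auto simp: g_def Pi_iff)
    have "{..<Suc k} - {k} = {..<k}" by auto
    then have "dot (Suc k) g H = H k \<oplus> (\<Oplus>i\<in>{..<k}. g i \<otimes> H i)"
      using dot_remove[OF g Hc(1), of k] Hc(3) by (simp add: g_def)
    also have "(\<Oplus>i\<in>{..<k}. g i \<otimes> H i) = dot k (\<lambda>i. \<zero> \<ominus> c i) H"
      unfolding dot_def using bc Hc by (intro finsum_cong') (auto simp: g_def minus_eq Pi_iff)
    also have "\<dots> = dot k (\<lambda>i. \<zero>) H \<ominus> dot k c H" using bc Hc by (intro dot_minus) auto
    also have "dot k (\<lambda>i. \<zero>) H = \<zero>" by (rule dot_zero[OF Hc(2)]) simp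
    also have "H k \<oplus> (\<zero> \<ominus> dot k c H) = dot l b G"
      unfolding eq using dc by algebra
    finally have "dot (Suc k) g H \<in> N \<cdot>\<^bsub>R\<^esub> I" using bN by simp
    then have "g k \<in> N" using ind[OF g] by auto
    then show False using primeideal_one_notin[OF prime_N] by (simp add: g_def)
  qed
  then obtain e where e: "e < l" "b e \<notin> N" by blast
  then obtain l' where l': "l = Suc l'" by (cases l) auto
  have be: "b e \<in> carrier R" "G e \<in> carrier R" using bc G e by auto
  obtain t where t: "t \<in> carrier R" "t \<otimes> b e = \<one>" using unit_if_notin_N[OF be(1) e(2)] by blast
  define G' where "G' i = (if i < e then G i else G (Suc i))" for i
  have img: "G' ` {..<l'} = G ` ({..<l} - {e})"
  proof
    show "G' ` {..<l'} \<subseteq> G ` ({..<l} - {e})" using l' e by (auto simp: G'_def)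
    show "G ` ({..<l} - {e}) \<subseteq> G' ` {..<l'}"
    proof
      fix y assume "y \<in> G ` ({..<l} - {e})"
      then obtain i where i: "i < l" "i \<noteq> e" "y = G i" by auto
      show "y \<in> G' ` {..<l'}"
      proof (cases "i < e")
        case True
        then show ?thesis using i e l' by (intro image_eqI[of _ _ i]) (auto simp: G'_def)
      next
        case False
        then obtain i' where "i = Suc i'" using i by (cases i) auto
        then show ?thesis using i False l' by (intro image_eqI[of _ _ i']) (auto simp: G'_def)
      qed
    qed
  qed
  let ?X = "H ` {..<Suc k} \<union> G ` ({..<l} - {e})"
  have X: "?X \<subseteq> carrier R" using Hc G by auto
  have XI: "?X \<subseteq> I" using HI GI by auto
  have BI: "ideal (Idl ?X) R" by (rule genideal_ideal[OF X])
  interpret B: ideal "Idl ?X" R by (rule BI)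
  note XB = genideal_self[OF X]
  define S where "S = (\<Oplus>i\<in>{..<l} - {e}. b i \<otimes> G i)"
  have SB: "S \<in> Idl ?X"
    unfolding S_def
  proof (rule ideal_finsum[OF BI])
    fix i assume i: "i \<in> {..<l} - {e}"
    then have "G i \<in> Idl ?X" using XB by blast
    then show "b i \<otimes> G i \<in> Idl ?X" using B.I_l_closed bc(1) i by blast
  qed
  have HB: "H k \<in> Idl ?X" "dot k c H \<in> Idl ?X"
    using XB bc(2) by (auto intro!: dot_in_ideal[OF BI])
  have Sc: "S \<in> carrier R" using B.Icarr[OF SB] .
  have eq2: "H k = dot k c H \<oplus> (b e \<otimes> G e \<oplus> S)"
    using eq dot_remove[OF bc(1) G e(1)] by (simp add: S_def)
  have "G e = (t \<otimes> b e) \<otimes> G e" using t be by simp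
  also have "\<dots> = t \<otimes> ((dot k c H \<oplus> (b e \<otimes> G e \<oplus> S)) \<ominus> dot k c H \<ominus> S)" using t(1) be dc Sc by algebra
  also have "\<dots> = t \<otimes> (H k \<ominus> dot k c H \<ominus> S)" using eq2 by simp
  also have "\<dots> \<in> Idl ?X"
    unfolding minus_eq using HB SB t(1) B.a_closed B.a_inv_closed B.I_l_closed by simp
  finally have Ge: "G e \<in> Idl ?X" .
  have "G ` {..<l} = insert (G e) (G ` ({..<l} - {e}))" using e(1) by blast
  then have "H ` {..<k} \<union> G ` {..<l} \<subseteq> Idl ?X" using Ge XB by auto
  then have "I \<subseteq> Idl ?X" using genideal_minimal[OF BI] gen by blast
  moreover have "Idl ?X \<subseteq> I" by (rule genideal_minimal[OF I XI])
  ultimately have "Idl (H ` {..<Suc k} \<union> G' ` {..<l'}) = I" unfolding img by blast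
  moreover have "G' ` {..<l'} \<subseteq> G ` {..<l}" unfolding img by blast
  ultimately show thesis using that l' by blast
qed

lemma exchange:
  assumes I: "ideal I R" and H: "independent_family I m H"
    and G: "G \<in> {..<l} \<rightarrow> carrier R" and gen: "Idl (G ` {..<l}) = I"
  shows "\<exists>l' G'. l = m + l' \<and> G' ` {..<l'} \<subseteq> G ` {..<l} \<and> Idl (H ` {..<m} \<union> G' ` {..<l'}) = I"
  using H
proof (induction m)
  case 0
  show ?case using gen by (intro exI[of _ l] exI[of _ G]) simp
next
  case (Suc m)
  obtain l1 G1 where G1: "l = m + l1" "G1 ` {..<l1} \<subseteq> G ` {..<l}" "Idl (H ` {..<m} \<union> G1 ` {..<l1}) = I"
    using Suc.IH independent_family_mono[OF I Suc.prems, of m] by auto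
  have "G ` {..<l} \<subseteq> carrier R" using G by auto
  then have "G1 \<in> {..<l1} \<rightarrow> carrier R" using G1(2) by blast
  from exchange_step[OF I Suc.prems this G1(3)]
  obtain l' G' where G': "l1 = Suc l'" "G' ` {..<l'} \<subseteq> G1 ` {..<l1}" "Idl (H ` {..<Suc m} \<union> G' ` {..<l'}) = I"
    by blast
  then show ?case using G1 by (intro exI[of _ l'] exI[of _ G']) auto
qed

lemma minimal_generating_family:
  assumes I: "ideal I R"
  obtains F where "F \<in> {..<num_gens R I} \<rightarrow> carrier R" "Idl (F ` {..<num_gens R I}) = I"
proof -
  obtain S where S: "S \<subseteq> carrier R" "finite S" "I = Idl S" using finetely_gen[OF I] by blast
  then have "\<exists>n S. finite S \<and> S \<subseteq> I \<and> card S = n \<and> genideal R S = I" using genideal_self[OF S(1)] by blast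
  from LeastI_ex[OF this] obtain T where T: "finite T" "T \<subseteq> I" "card T = num_gens R I" "Idl T = I"
    unfolding num_gens_def by blast
  obtain F where F: "bij_betw F {0..<card T} T" using ex_bij_betw_nat_finite[OF T(1)] by blast
  then have "F ` {..<num_gens R I} = T" unfolding bij_betw_def T(3) atLeast0LessThan by blast
  then show thesis using that[of F] T ideal.Icarr[OF I] by (auto simp: Pi_iff)
qed

lemma minimal_generators_syzygy:
  assumes F: "F \<in> {..<k} \<rightarrow> carrier R" "Idl (F ` {..<k}) = I" "k = num_gens R I"
    and c: "c \<in> {..<k} \<rightarrow> carrier R" "dot k c F = \<zero>"
  shows "c \<in> {..<k} \<rightarrow> N"
proof
  fix i assume i: "i \<in> {..<k}"
  show "c i \<in> N"
  proof (rule ccontr)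
    assume "c i \<notin> N"
    then obtain t where "t \<in> carrier R" "t \<otimes> c i = \<one>" using unit_if_notin_N[of "c i"] c i by auto
    then show False using minimal_generators_no_unit[OF F c] i by auto
  qed
qed

text \<open>An element of N I has an expression through F with coefficients in N; subtracting it
  reduces independence modulo N I to the relations of F.\<close>

lemma independent_if_syzygies_in_N:
  assumes I: "ideal I R" and F: "F \<in> {..<k} \<rightarrow> carrier R" "Idl (F ` {..<k}) = I"
    and syz: "\<And>c. c \<in> {..<k} \<rightarrow> carrier R \<Longrightarrow> dot k c F = \<zero> \<Longrightarrow> c \<in> {..<k} \<rightarrow> N"
  shows "independent_family I k F"
  unfolding independent_family_def
proof (intro conjI ballI impI)
  have "F ` {..<k} \<subseteq> carrier R" using F by auto
  then show "F \<in> {..<k} \<rightarrow> I" using genideal_self F(2) by blast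
  interpret N: ideal N R by (rule ideal_N)
  fix c assume c: "c \<in> {..<k} \<rightarrow> carrier R" "dot k c F \<in> N \<cdot>\<^bsub>R\<^esub> I"
  then obtain n where n: "n \<in> {..<k} \<rightarrow> N" "dot k c F = dot k n F"
    using ideal_prod_family[OF ideal_N F(1)] F(2) by metis
  have nc: "n \<in> {..<k} \<rightarrow> carrier R" using n(1) N.Icarr by (auto simp: Pi_iff)
  have "dot k (\<lambda>i. c i \<ominus> n i) F = \<zero>"
    using dot_minus[OF c(1) nc F(1)] n(2) dot_closed[OF nc F(1)] r_neg by (simp add: minus_eq)
  moreover have "(\<lambda>i. c i \<ominus> n i) \<in> {..<k} \<rightarrow> carrier R" using c(1) nc by auto
  ultimately have d: "(\<lambda>i. c i \<ominus> n i) \<in> {..<k} \<rightarrow> N" using syz by blast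
  show "c \<in> {..<k} \<rightarrow> N"
  proof
    fix i assume i: "i \<in> {..<k}"
    have "(c i \<ominus> n i) \<oplus> n i = c i" by (rule minus_add_cancel) (use c(1) nc i in auto)
    moreover have "(c i \<ominus> n i) \<oplus> n i \<in> N" using d n(1) i N.a_closed by (auto simp: Pi_iff)
    ultimately show "c i \<in> N" by simp
  qed
qed

text \<open>The lower bound comes from exchanging the independent family F into a generating family
  of minimal size.\<close>

lemma num_gens_eqI:
  assumes I: "ideal I R" and F: "F \<in> {..<k} \<rightarrow> carrier R" "Idl (F ` {..<k}) = I"
    and syz: "\<And>c. c \<in> {..<k} \<rightarrow> carrier R \<Longrightarrow> dot k c F = \<zero> \<Longrightarrow> c \<in> {..<k} \<rightarrow> N"
  shows "num_gens R I = k"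
proof (rule antisym)
  show "num_gens R I \<le> k" using num_gens_le[of "{..<k}" F I] F by auto
  obtain G where G: "G \<in> {..<num_gens R I} \<rightarrow> carrier R" "Idl (G ` {..<num_gens R I}) = I"
    by (rule minimal_generating_family[OF I])
  have "\<exists>l' G'. num_gens R I = k + l' \<and> G' ` {..<l'} \<subseteq> G ` {..<num_gens R I} \<and>
      Idl (F ` {..<k} \<union> G' ` {..<l'}) = I"
    using independent_if_syzygies_in_N[OF I F] syz by (intro exchange[OF I _ G]) blast
  then show "k \<le> num_gens R I" by auto
qed

end

section \<open>Quotients of a local ring\<close>

lemma (in noetherian_cring) quotient_noetherian_cring:
  assumes A: "ideal A R"
  shows "noetherian_cring (R Quot A)"
proof -
  interpret h: ring_hom_cring R "R Quot A" "(+>) A" by (rule ideal.rcos_ring_hom_cring[OF A is_cring])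
  note vimage = ring_hom_ring.ideal_vimage[OF ideal.rcos_ring_hom_ring[OF A]]
  have surj: "\<exists>x\<in>carrier R. y = A +> x" if "y \<in> carrier (R Quot A)" for y
    using that unfolding FactRing_def A_RCOSETS_def' by simp
  have "noetherian_ring (R Quot A)"
  proof (intro noetherian_ring.intro noetherian_ring_axioms.intro h.S.ring_axioms)
    fix K assume K: "ideal K (R Quot A)"
    let ?P = "{r \<in> carrier R. A +> r \<in> K}"
    have "ideal ?P R" by (rule vimage[OF K])
    then obtain T where T: "T \<subseteq> carrier R" "finite T" "?P = Idl T" using finetely_gen by blast
    let ?T = "(+>) A ` T"
    have Tc: "?T \<subseteq> carrier (R Quot A)" using T(1) h.hom_closed by blast
    have TK: "?T \<subseteq> K" using genideal_self[OF T(1)] T(3) by blast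
    have G: "ideal (Idl\<^bsub>R Quot A\<^esub> ?T) (R Quot A)" by (rule h.S.genideal_ideal[OF Tc])
    have "T \<subseteq> {r \<in> carrier R. A +> r \<in> Idl\<^bsub>R Quot A\<^esub> ?T}" using T(1) h.S.genideal_self[OF Tc] by blast
    then have P: "?P \<subseteq> {r \<in> carrier R. A +> r \<in> Idl\<^bsub>R Quot A\<^esub> ?T}"
      unfolding T(3) by (rule genideal_minimal[OF vimage[OF G]])
    have "K \<subseteq> Idl\<^bsub>R Quot A\<^esub> ?T"
    proof
      fix y assume y: "y \<in> K"
      then have "y \<in> carrier (R Quot A)" using ideal.Icarr[OF K] by blast
      then obtain x where "x \<in> carrier R" "y = A +> x" using surj by blast
      then show "y \<in> Idl\<^bsub>R Quot A\<^esub> ?T" using P y by blast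
    qed
    moreover have "Idl\<^bsub>R Quot A\<^esub> ?T \<subseteq> K" by (rule h.S.genideal_minimal[OF K TK])
    ultimately show "\<exists>T\<subseteq>carrier (R Quot A). finite T \<and> K = Idl\<^bsub>R Quot A\<^esub> T"
      using Tc finite_imageI[OF T(2)] by (intro exI[of _ ?T] conjI subset_antisym)
  qed
  then show ?thesis using h.S.is_cring by (simp add: noetherian_cring_def)
qed

text \<open>The quotient map with kernel A, freed from cosets. The target is not assumed to be
  local: units are found in R and mapped over, and the image of N, which is prime, stands in for a
  maximal ideal.\<close>

locale local_surjection = noetherian_local_ring R N + S: noetherian_cring S + ring_hom_cring R S h
  for R (structure) and N and S (structure) and h +
  fixes A
  assumes A: "ideal A R" and A_subset_N: "A \<subseteq> N"
    and surj: "y \<in> carrier S \<Longrightarrow> \<exists>x\<in>carrier R. h x = y"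
    and ker: "x \<in> carrier R \<Longrightarrow> h x = \<zero>\<^bsub>S\<^esub> \<longleftrightarrow> x \<in> A"
begin

lemma hom_dot:
  assumes "c \<in> {..<k} \<rightarrow> carrier R" "F \<in> {..<k} \<rightarrow> carrier R"
  shows "h (dot k c F) = S.dot k (\<lambda>i. h (c i)) (\<lambda>i. h (F i))"
proof -
  have "h (dot k c F) = (\<Oplus>\<^bsub>S\<^esub>i\<in>{..<k}. (h \<circ> (\<lambda>i. c i \<otimes> F i)) i)"
    unfolding dot_def using assms by (intro hom_finsum) auto
  also have "\<dots> = S.dot k (\<lambda>i. h (c i)) (\<lambda>i. h (F i))"
    unfolding S.dot_def using assms by (intro S.finsum_cong') (auto simp: Pi_iff)
  finally show ?thesis .
qed

lemma hom_minus: "x \<in> carrier R \<Longrightarrow> y \<in> carrier R \<Longrightarrow> h (x \<ominus> y) = h x \<ominus>\<^bsub>S\<^esub> h y"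
  by (simp add: minus_eq S.minus_eq)

lemma hom_eq_iff:
  assumes "x \<in> carrier R" "y \<in> carrier R"
  shows "h x = h y \<longleftrightarrow> x \<ominus> y \<in> A"
proof
  assume "h x = h y"
  then have "h (x \<ominus> y) = \<zero>\<^bsub>S\<^esub>" using assms by (simp add: hom_minus S.minus_eq S.r_neg)
  then show "x \<ominus> y \<in> A" using ker[OF minus_closed[OF assms]] by blast
next
  assume "x \<ominus> y \<in> A"
  then have "h (x \<ominus> y) = \<zero>\<^bsub>S\<^esub>" using ker[OF minus_closed[OF assms]] by blast
  then have "h x \<ominus>\<^bsub>S\<^esub> h y = \<zero>\<^bsub>S\<^esub>" using assms by (simp add: hom_minus)
  then show "h x = h y"
    using assms S.sum_zero_eq_neg[of "h x" "\<ominus>\<^bsub>S\<^esub> h y"] by (simp add: S.minus_eq)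
qed

lemma hom_in_image_iff:
  assumes "ideal K R" "A \<subseteq> K" "x \<in> carrier R"
  shows "h x \<in> h ` K \<longleftrightarrow> x \<in> K"
proof
  interpret K: ideal K R by fact
  assume "h x \<in> h ` K"
  then obtain y where y: "y \<in> K" "h x = h y" by blast
  have yc: "y \<in> carrier R" using y K.Icarr by blast
  have "x \<ominus> y \<in> K" using hom_eq_iff[OF assms(3) yc] y(2) assms(2) by blast
  then have "(x \<ominus> y) \<oplus> y \<in> K" using y K.a_closed by blast
  moreover have "(x \<ominus> y) \<oplus> y = x" using assms(3) yc by algebra
  ultimately show "x \<in> K" by simp
qed blast

lemma image_ideal:
  assumes K: "ideal K R"
  shows "ideal (h ` K) S"
proof -
  have Kc: "k \<in> carrier R" if "k \<in> K" for k using ideal.Icarr[OF K that] .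
  note K' = additive_subgroup.a_closed[OF ideal.axioms(1)[OF K]]
    additive_subgroup.zero_closed[OF ideal.axioms(1)[OF K]]
    additive_subgroup.a_inv_closed[OF ideal.axioms(1)[OF K]]
  have hK: "h k \<in> h ` K" if "k \<in> K" for k using that by (rule imageI)
  have absorb: "s \<otimes>\<^bsub>S\<^esub> k \<in> h ` K" if ks: "k \<in> h ` K" "s \<in> carrier S" for k s
  proof -
    obtain k' where k': "k' \<in> K" "k = h k'" using ks(1) by blast
    obtain s' where s': "s' \<in> carrier R" "h s' = s" using surj[OF ks(2)] by blast
    have "s \<otimes>\<^bsub>S\<^esub> k = h (s' \<otimes> k')" using Kc[OF k'(1)] s' k'(2) by simp
    then show ?thesis using hK[OF ideal.I_l_closed[OF K k'(1) s'(1)]] by simp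
  qed
  show ?thesis
  proof (rule idealI[OF S.ring_axioms])
    show "subgroup (h ` K) (add_monoid S)"
    proof (rule subgroup.intro)
      show "h ` K \<subseteq> carrier (add_monoid S)" using Kc by auto
      show "\<one>\<^bsub>add_monoid S\<^esub> \<in> h ` K" using hK[OF K'(2)] by simp
    next
      fix a b assume ab: "a \<in> h ` K" "b \<in> h ` K"
      obtain a' where a': "a' \<in> K" "a = h a'" using ab(1) by blast
      obtain b' where b': "b' \<in> K" "b = h b'" using ab(2) by blast
      have "a \<oplus>\<^bsub>S\<^esub> b = h (a' \<oplus> b')" using a' b' Kc by simp
      then show "a \<otimes>\<^bsub>add_monoid S\<^esub> b \<in> h ` K" using hK[OF K'(1)[OF a'(1) b'(1)]] by simp
    next
      fix a assume a: "a \<in> h ` K"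
      obtain a' where a': "a' \<in> K" "a = h a'" using a by blast
      have "\<ominus>\<^bsub>S\<^esub> a = h (\<ominus> a')" using a' Kc by simp
      then show "inv\<^bsub>add_monoid S\<^esub> a \<in> h ` K"
        using hK[OF K'(3)[OF a'(1)]] by (simp add: a_inv_def[symmetric])
    qed
  next
    fix a s assume as: "a \<in> h ` K" "s \<in> carrier S"
    show "s \<otimes>\<^bsub>S\<^esub> a \<in> h ` K" by (rule absorb[OF as])
    moreover have "a \<in> carrier S" using as(1) Kc by blast
    ultimately show "a \<otimes>\<^bsub>S\<^esub> s \<in> h ` K" using S.m_comm[of a s] as(2) by simp
  qed
qed

lemma image_N_prime: "primeideal (h ` N) S"
proof (rule primeidealI[OF image_ideal[OF ideal_N] S.is_cring])
  have "\<one>\<^bsub>S\<^esub> \<notin> h ` N"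
    using hom_in_image_iff[OF ideal_N A_subset_N one_closed] primeideal_one_notin[OF prime_N] by simp
  then show "carrier S \<noteq> h ` N" using S.one_closed by blast
  fix a b assume ab: "a \<in> carrier S" "b \<in> carrier S" "a \<otimes>\<^bsub>S\<^esub> b \<in> h ` N"
  obtain a' b' where ab': "a' \<in> carrier R" "a = h a'" "b' \<in> carrier R" "b = h b'" using ab surj by metis
  then have "a' \<otimes> b' \<in> N" using ab(3) hom_in_image_iff[OF ideal_N A_subset_N, of "a' \<otimes> b'"] by simp
  then have "a' \<in> N \<or> b' \<in> N" using primeideal.I_prime[OF prime_N] ab' by blast
  then show "a \<in> h ` N \<or> b \<in> h ` N" using ab' by blast
qed

lemma lift_family:
  assumes "\<And>i. P i \<Longrightarrow> F i \<in> carrier S"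
  obtains G where "\<And>i. P i \<Longrightarrow> G i \<in> carrier R" "\<And>i. P i \<Longrightarrow> h (G i) = F i"
proof -
  have "\<forall>i. \<exists>x. P i \<longrightarrow> x \<in> carrier R \<and> h x = F i" using assms surj by blast
  from choice[OF this] show thesis using that by blast
qed

text \<open>Only the entries above the diagonal are lifted, and the rest is filled in by
  antisymmetry. So the lift is alternating exactly and not just modulo A.\<close>

lemma lift_alternating:
  fixes n :: nat
  assumes w: "S.alternating {..<n} w"
  obtains w' where "alternating {..<n} w'" "\<And>s t. s < n \<Longrightarrow> t < n \<Longrightarrow> h (w' s t) = w s t"
proof -
  have wc: "w s t \<in> carrier S" "w s s = \<zero>\<^bsub>S\<^esub>" if "s < n" "t < n" for s t
    using S.alternatingD(1,2)[OF w] that by auto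
  have ws: "w s t = \<ominus>\<^bsub>S\<^esub> w t s" if "s < n" "t < n" for s t
    by (rule S.alternatingD(3)[OF w]) (use that in auto)
  obtain u where u: "\<And>p. fst p < n \<and> snd p < n \<Longrightarrow> u p \<in> carrier R"
    "\<And>p. fst p < n \<and> snd p < n \<Longrightarrow> h (u p) = w (fst p) (snd p)"
    using lift_family[of "\<lambda>p. fst p < n \<and> snd p < n" "\<lambda>p. w (fst p) (snd p)"] wc(1) by auto
  define w' where "w' s t = (if s < t then u (s, t) else if t < s then \<ominus> u (t, s) else \<zero>)" for s t
  have "alternating {..<n} w'"
    unfolding alternating_def
  proof (intro ballI conjI)
    fix s t assume "s \<in> {..<n}" "t \<in> {..<n}"
    then have c: "u (s, t) \<in> carrier R" "u (t, s) \<in> carrier R" using u(1) by auto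
    show "w' s t \<in> carrier R" "w' s s = \<zero>" using c by (auto simp: w'_def)
    show "w' s t = \<ominus> w' t s" using c by (auto simp: w'_def)
  qed
  moreover have "h (w' s t) = w s t" if st: "s < n" "t < n" for s t
  proof -
    consider "s < t" | "t < s" | "s = t" by linarith
    then show ?thesis
    proof cases
      case 2
      then have "h (w' s t) = \<ominus>\<^bsub>S\<^esub> w t s" using u st by (simp add: w'_def)
      then show ?thesis using ws[OF st] by simp
    qed (use u st wc(2) in \<open>auto simp: w'_def\<close>)
  qed
  ultimately show thesis using that by blast
qed

lemma alternating_dot_zero:
  assumes w: "alternating {..<n} w" and F: "F \<in> {..<n} \<rightarrow> carrier R"
  shows "dot n (\<lambda>s. dot n (w s) F) F = \<zero>"
proof -
  have wc: "w s t \<in> carrier R" "w s s = \<zero>" if "s < n" "t < n" for s t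
    using alternatingD(1,2)[OF w] that by auto
  have ws: "w s t = \<ominus> w t s" if "s < n" "t < n" for s t
    by (rule alternatingD(3)[OF w]) (use that in auto)
  have Fc: "\<And>s. s < n \<Longrightarrow> F s \<in> carrier R" using F by auto
  have "dot n (\<lambda>s. dot n (w s) F) F = (\<Oplus>s\<in>{..<n}. \<Oplus>t\<in>{..<n}. w s t \<otimes> F t \<otimes> F s)"
    unfolding dot_def
  proof (rule finsum_cong')
    fix s assume s: "s \<in> {..<n}"
    show "(\<Oplus>t\<in>{..<n}. w s t \<otimes> F t) \<otimes> F s = (\<Oplus>t\<in>{..<n}. w s t \<otimes> F t \<otimes> F s)"
      using wc(1) Fc s by (intro finsum_ldistr) auto
  qed (use wc(1) Fc in \<open>auto intro!: finsum_closed\<close>)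
  also have "\<dots> = \<zero>"
  proof (rule alternating_sum_zero)
    show "alternating {..<n} (\<lambda>s t. w s t \<otimes> F t \<otimes> F s)"
      unfolding alternating_def
    proof (intro ballI conjI)
      fix s t assume st: "s \<in> {..<n}" "t \<in> {..<n}"
      then have st': "s < n" "t < n" by auto
      have c: "w t s \<in> carrier R" "w s t \<in> carrier R" "F s \<in> carrier R" "F t \<in> carrier R" using wc Fc st' by auto
      show "w s t \<otimes> F t \<otimes> F s \<in> carrier R" using c by simp
      show "w s s \<otimes> F s \<otimes> F s = \<zero>" using wc(2)[OF st'] c by simp
      show "w s t \<otimes> F t \<otimes> F s = \<ominus> (w t s \<otimes> F s \<otimes> F t)"
        unfolding ws[OF st'] using c by (simp add: l_minus r_minus m_ac)
    qed
  qed simp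
  finally show ?thesis .
qed

end

section \<open>Counting generators\<close>

context cring
begin

lemma dot_add:
  assumes "c \<in> {..<k} \<rightarrow> carrier R" "c' \<in> {..<k} \<rightarrow> carrier R" "F \<in> {..<k} \<rightarrow> carrier R"
  shows "dot k (\<lambda>i. c i \<oplus> c' i) F = dot k c F \<oplus> dot k c' F"
proof -
  have "dot k (\<lambda>i. c i \<oplus> c' i) F = (\<Oplus>i\<in>{..<k}. c i \<otimes> F i \<oplus> c' i \<otimes> F i)"
    unfolding dot_def using assms by (intro finsum_cong') (auto simp: l_distr Pi_iff)
  also have "\<dots> = dot k c F \<oplus> dot k c' F"
    unfolding dot_def using assms by (intro finsum_addf) auto
  finally show ?thesis .
qed

lemma dot_commute:
  assumes "c \<in> {..<k} \<rightarrow> carrier R" "F \<in> {..<k} \<rightarrow> carrier R"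
  shows "dot k c F = dot k F c"
  unfolding dot_def using assms by (intro finsum_cong') (auto simp: m_comm Pi_iff)

lemma finsum_swap:
  assumes "finite D" "finite E" "\<And>s j. s \<in> D \<Longrightarrow> j \<in> E \<Longrightarrow> \<phi> s j \<in> carrier R"
  shows "(\<Oplus>s\<in>D. \<Oplus>j\<in>E. \<phi> s j) = (\<Oplus>j\<in>E. \<Oplus>s\<in>D. \<phi> s j)"
  using assms(2,1,3)
proof (induction E)
  case (insert k E)
  have c: "\<And>s j. s \<in> D \<Longrightarrow> j \<in> E \<Longrightarrow> \<phi> s j \<in> carrier R" "\<And>s. s \<in> D \<Longrightarrow> \<phi> s k \<in> carrier R"
    using insert.prems(2) by auto
  have "(\<Oplus>s\<in>D. \<Oplus>j\<in>insert k E. \<phi> s j) = (\<Oplus>s\<in>D. \<phi> s k \<oplus> (\<Oplus>j\<in>E. \<phi> s j))"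
    using c insert.hyps by (intro finsum_cong' finsum_insert) (auto intro!: finsum_closed)
  also have "\<dots> = (\<Oplus>s\<in>D. \<phi> s k) \<oplus> (\<Oplus>s\<in>D. \<Oplus>j\<in>E. \<phi> s j)"
    using c by (intro finsum_addf) (auto intro!: finsum_closed)
  also have "\<dots> = (\<Oplus>s\<in>D. \<phi> s k) \<oplus> (\<Oplus>j\<in>E. \<Oplus>s\<in>D. \<phi> s j)"
    using insert.IH[OF insert.prems(1) c(1)] by simp
  also have "\<dots> = (\<Oplus>j\<in>insert k E. \<Oplus>s\<in>D. \<phi> s j)"
    using c insert.hyps by (intro finsum_insert[symmetric]) (auto intro!: finsum_closed)
  finally show ?case .
qed simp

lemma dot_dot_swap:
  assumes a: "a \<in> {..<m} \<rightarrow> carrier R" and F: "F \<in> {..<n} \<rightarrow> carrier R"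
    and Z: "\<And>j s. j < m \<Longrightarrow> s < n \<Longrightarrow> Z j s \<in> carrier R"
  shows "dot n (\<lambda>s. dot m a (\<lambda>j. Z j s)) F = dot m a (\<lambda>j. dot n (Z j) F)"
proof -
  have c: "\<And>j. j < m \<Longrightarrow> a j \<in> carrier R" "\<And>s. s < n \<Longrightarrow> F s \<in> carrier R" using a F by auto
  have "dot n (\<lambda>s. dot m a (\<lambda>j. Z j s)) F = (\<Oplus>s\<in>{..<n}. \<Oplus>j\<in>{..<m}. a j \<otimes> Z j s \<otimes> F s)"
    unfolding dot_def
  proof (rule finsum_cong')
    fix s assume "s \<in> {..<n}"
    then show "(\<Oplus>j\<in>{..<m}. a j \<otimes> Z j s) \<otimes> F s = (\<Oplus>j\<in>{..<m}. a j \<otimes> Z j s \<otimes> F s)"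
      using c Z by (intro finsum_ldistr) auto
  qed (use c Z in \<open>auto intro!: finsum_closed\<close>)
  also have "\<dots> = (\<Oplus>j\<in>{..<m}. \<Oplus>s\<in>{..<n}. a j \<otimes> Z j s \<otimes> F s)"
    using c Z by (intro finsum_swap) auto
  also have "\<dots> = dot m a (\<lambda>j. dot n (Z j) F)"
    unfolding dot_def
  proof (rule finsum_cong')
    fix j assume j: "j \<in> {..<m}"
    have "(\<Oplus>s\<in>{..<n}. a j \<otimes> Z j s \<otimes> F s) = (\<Oplus>s\<in>{..<n}. a j \<otimes> (Z j s \<otimes> F s))"
      using c Z j by (intro finsum_cong') (auto simp: m_assoc)
    also have "\<dots> = a j \<otimes> (\<Oplus>s\<in>{..<n}. Z j s \<otimes> F s)"
      using c Z j by (intro finsum_rdistr[symmetric]) auto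
    finally show "(\<Oplus>s\<in>{..<n}. a j \<otimes> Z j s \<otimes> F s) = a j \<otimes> (\<Oplus>s\<in>{..<n}. Z j s \<otimes> F s)" .
  qed (use c Z in \<open>auto intro!: finsum_closed\<close>)
  finally show ?thesis .
qed

end

text \<open>Regularity of R is present only as \<open>koszul\<close>, the vanishing of the first
  Koszul homology of x. The lifts \<open>ft\<close> are taken inside J, hence inside N.\<close>

locale koszul_lift = local_surjection +
  fixes d n m :: nat and x f J Z ft Zt
  assumes J: "ideal J R" and AJ: "A \<subseteq> J" and JN: "J \<subseteq> N"
    and x: "x \<in> {..<d} \<rightarrow> carrier R" "N = Idl (x ` {..<d})"
    and koszul: "\<And>c. c \<in> {..<d} \<rightarrow> carrier R \<Longrightarrow> dot d c x = \<zero> \<Longrightarrow>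
      \<exists>w. alternating {..<d} w \<and> (\<forall>i<d. c i = dot d (w i) x)"
    and f: "f \<in> {..<n} \<rightarrow> carrier S" "Idl\<^bsub>S\<^esub> (f ` {..<n}) = h ` J" "n = num_gens S (h ` J)"
    and free: "S.free_H1 n f m Z"
    and ft: "\<And>s. s < n \<Longrightarrow> ft s \<in> J" "\<And>s. s < n \<Longrightarrow> h (ft s) = f s"
    and Zt: "\<And>j s. j < m \<Longrightarrow> s < n \<Longrightarrow> Zt j s \<in> carrier R"
      "\<And>j s. j < m \<Longrightarrow> s < n \<Longrightarrow> h (Zt j s) = Z j s"
begin

lemma ft_closed: "ft \<in> {..<n} \<rightarrow> carrier R"
  using ft(1) ideal.Icarr[OF J] by auto

lemma hom_dot_ft:
  assumes c: "c \<in> {..<n} \<rightarrow> carrier R"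
  shows "h (dot n c ft) = S.dot n (\<lambda>s. h (c s)) f"
proof -
  have "S.dot n (\<lambda>s. h (c s)) (\<lambda>s. h (ft s)) = S.dot n (\<lambda>s. h (c s)) f"
    unfolding S.dot_def using c f(1) ft(2) by (intro S.finsum_cong') (auto simp: Pi_iff)
  then show ?thesis using hom_dot[OF c ft_closed] by simp
qed

text \<open>A coefficient outside N is a unit of R, so its image would be a unit coefficient in a
  relation of minimal generators.\<close>

lemma syzygy_in_N:
  assumes c: "c \<in> {..<n} \<rightarrow> carrier R" and z: "S.dot n (\<lambda>s. h (c s)) f = \<zero>\<^bsub>S\<^esub>" and s: "s < n"
  shows "c s \<in> N"
proof (rule ccontr)
  assume "c s \<notin> N"
  have cs: "c s \<in> carrier R" using c s by auto
  obtain t where t: "t \<in> carrier R" "t \<otimes> c s = \<one>" using unit_if_notin_N[OF cs \<open>c s \<notin> N\<close>] by blast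
  have "h t \<otimes>\<^bsub>S\<^esub> h (c s) = h (t \<otimes> c s)" using t(1) cs by simp
  also have "\<dots> = \<one>\<^bsub>S\<^esub>" unfolding t(2) by simp
  finally have "h t \<otimes>\<^bsub>S\<^esub> h (c s) = \<one>\<^bsub>S\<^esub>" .
  moreover have "(\<lambda>s. h (c s)) \<in> {..<n} \<rightarrow> carrier S" using c by auto
  ultimately show False
    using S.minimal_generators_no_unit[OF f _ z s hom_closed[OF t(1)]] by blast
qed

text \<open>A cycle over the quotient lifts to coefficients that need not be a relation of
  \<open>ft\<close>; H j is the defect, an element of A.\<close>

definition H :: "nat \<Rightarrow> 'a" where
  "H j = dot n (Zt j) ft"

lemma H_in_A:
  assumes j: "j < m"
  shows "H j \<in> A"
proof -
  have Zc: "Zt j \<in> {..<n} \<rightarrow> carrier R" using Zt(1)[OF j] by auto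
  have "h (H j) = S.dot n (\<lambda>s. h (Zt j s)) f" unfolding H_def by (rule hom_dot_ft[OF Zc])
  also have "\<dots> = S.dot n (Z j) f"
    using free j f(1) Zt(2)[OF j] unfolding S.free_H1_def by (intro S.dot_cong) auto
  also have "\<dots> = \<zero>\<^bsub>S\<^esub>" using free j unfolding S.free_H1_def by blast
  finally show ?thesis using ker[OF dot_closed[OF Zc ft_closed]] by (simp add: H_def)
qed

lemma H_closed: "H \<in> {..<m} \<rightarrow> carrier R"
  using H_in_A ideal.Icarr[OF A] by auto

lemma hom_dot_Zt:
  assumes a: "a \<in> {..<m} \<rightarrow> carrier R" and s: "s < n"
  shows "h (dot m a (\<lambda>j. Zt j s)) = (\<Oplus>\<^bsub>S\<^esub>j\<in>{..<m}. h (a j) \<otimes>\<^bsub>S\<^esub> Z j s)"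
proof -
  have "(\<lambda>j. Zt j s) \<in> {..<m} \<rightarrow> carrier R" using Zt(1) s by auto
  from hom_dot[OF a this]
  have "h (dot m a (\<lambda>j. Zt j s)) = S.dot m (\<lambda>j. h (a j)) (\<lambda>j. h (Zt j s))" .
  also have "\<dots> = (\<Oplus>\<^bsub>S\<^esub>j\<in>{..<m}. h (a j) \<otimes>\<^bsub>S\<^esub> Z j s)"
    unfolding S.dot_def
  proof (rule S.finsum_cong')
    show "(\<lambda>j. h (a j) \<otimes>\<^bsub>S\<^esub> Z j s) \<in> {..<m} \<rightarrow> carrier S"
    proof
      fix j assume "j \<in> {..<m}"
      then have "a j \<in> carrier R" "h (Zt j s) = Z j s" "Zt j s \<in> carrier R" using a Zt s by auto
      then show "h (a j) \<otimes>\<^bsub>S\<^esub> Z j s \<in> carrier S" by (metis S.m_closed hom_closed)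
    qed
  qed (use Zt(2) s in auto)
  finally show ?thesis .
qed

lemma H_independent: "independent_family A m H"
  unfolding independent_family_def
proof (intro conjI ballI impI)
  show "H \<in> {..<m} \<rightarrow> A" using H_in_A by auto
  fix a assume a: "a \<in> {..<m} \<rightarrow> carrier R" and NA: "dot m a H \<in> N \<cdot>\<^bsub>R\<^esub> A"
  define r where "r s = dot m a (\<lambda>j. Zt j s)" for s
  have rc: "r \<in> {..<n} \<rightarrow> carrier R" unfolding r_def using a Zt(1) by (auto intro!: dot_closed)
  have rH: "dot n r ft = dot m a H"
    unfolding r_def H_def using dot_dot_swap[OF a ft_closed Zt(1)] by (simp add: H_def[abs_def])
  have "dot m a H \<in> A" using NA ideal_prod_inter[OF ideal_N A] by blast
  \<comment> \<open>The sum of the a j H j is in A, so r is a relation of the minimal generators f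
    over S; its coefficients therefore lie in N and are combinations of x.\<close>
  then have "S.dot n (\<lambda>s. h (r s)) f = \<zero>\<^bsub>S\<^esub>"
    using hom_dot_ft[OF rc] rH ker[OF dot_closed[OF a H_closed]] by simp
  from syzygy_in_N[OF rc this] have "\<exists>p\<in>{..<d} \<rightarrow> carrier R. s < n \<longrightarrow> r s = dot d p x" for s
    using genideal_family[OF x(1), of "r s"] x(2) by (cases "s < n") auto
  then have "\<forall>s. \<exists>p. p \<in> {..<d} \<rightarrow> carrier R \<and> (s < n \<longrightarrow> r s = dot d p x)" by blast
  from choice[OF this] obtain p where p: "\<And>s. p s \<in> {..<d} \<rightarrow> carrier R" "\<And>s. s < n \<Longrightarrow> r s = dot d (p s) x"
    by blast
  \<comment> \<open>N A is read as A N in order to have coefficients g in A, which disappear in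
    S.\<close>
  have "dot m a H \<in> A \<cdot>\<^bsub>R\<^esub> (Idl (x ` {..<d}))"
    using NA ideal_prod_commute[OF ideal_N A] x(2) by simp
  then obtain g where g: "g \<in> {..<d} \<rightarrow> A" "dot m a H = dot d g x" by (rule ideal_prod_family[OF A x(1)])
  have gc: "g \<in> {..<d} \<rightarrow> carrier R" using g(1) ideal.Icarr[OF A] by (auto simp: Pi_iff)
  define q where "q b = dot n (\<lambda>s. p s b) ft" for b
  have pc: "(\<lambda>s. p s b) \<in> {..<n} \<rightarrow> carrier R" if "b < d" for b using p(1) that by (auto simp: Pi_iff)
  have qc: "q \<in> {..<d} \<rightarrow> carrier R" unfolding q_def using pc ft_closed by (auto intro!: dot_closed)
  have "dot n r ft = dot n (\<lambda>s. dot d x (\<lambda>b. p s b)) ft"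
  proof (rule dot_cong[OF _ _ ft_closed])
    fix s assume "s < n"
    then show "r s = dot d x (p s)" using p(2) dot_commute[OF p(1) x(1)] by simp
  qed (use p(1) x(1) in \<open>auto intro!: dot_closed\<close>)
  also have "\<dots> = dot d x q"
    unfolding q_def by (rule dot_dot_swap[OF x(1) ft_closed]) (use pc in auto)
  also have "\<dots> = dot d q x" by (rule dot_commute[OF x(1) qc])
  \<comment> \<open>Two expressions of one element through x. Their difference q - g is a relation
    of x, hence comes from an alternating matrix w, the bivector sought.\<close>
  finally have "dot d q x = dot d g x" using rH g(2) by simp
  then have "dot d (\<lambda>b. q b \<ominus> g b) x = \<zero>"
    using dot_minus[OF qc gc x(1)] dot_closed[OF gc x(1)] r_neg by (simp add: minus_eq)
  moreover have "(\<lambda>b. q b \<ominus> g b) \<in> {..<d} \<rightarrow> carrier R" using qc gc by auto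
  ultimately obtain w where w: "alternating {..<d} w" "\<And>b. b < d \<Longrightarrow> q b \<ominus> g b = dot d (w b) x"
    using koszul by blast
  have wc: "w b \<in> {..<d} \<rightarrow> carrier R" if "b < d" for b using alternatingD(1)[OF w(1)] that by auto
  show "a \<in> {..<m} \<rightarrow> N"
  proof
    fix k assume k: "k \<in> {..<m}"
    have "h (a k) \<in> h ` N"
    proof (rule S.free_H1_coefficient_in_prime[OF free f(1), where x = "\<lambda>b. h (x b)" and d = d
          and \<rho> = "\<lambda>s b. h (p s b)" and w = "\<lambda>b c. h (w b c)"])
      show "(\<lambda>b. h (x b)) \<in> {..<d} \<rightarrow> carrier S" using x(1) by auto
      show "(\<lambda>b. h (p s b)) \<in> {..<d} \<rightarrow> carrier S" if "s < n" for s using p(1) by auto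
      show "(\<lambda>k. h (a k)) \<in> {..<m} \<rightarrow> carrier S" using a by auto
      show "(\<Oplus>\<^bsub>S\<^esub>j\<in>{..<m}. h (a j) \<otimes>\<^bsub>S\<^esub> Z j s) = S.dot d (\<lambda>b. h (p s b)) (\<lambda>b. h (x b))" if s: "s < n" for s
        using hom_dot_Zt[OF a s] hom_dot[OF p(1) x(1), of s] p(2)[OF s] by (simp add: r_def)
      show "S.alternating {..<d} (\<lambda>b c. h (w b c))"
        unfolding S.alternating_def
      proof (intro ballI conjI)
        fix b c assume bc: "b \<in> {..<d}" "c \<in> {..<d}"
        note W = alternatingD[OF w(1) bc] alternatingD[OF w(1) bc(2,1)]
        show "h (w b c) \<in> carrier S" using W(1) by simp
        show "h (w b b) = \<zero>\<^bsub>S\<^esub>" unfolding W(2) by simp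
        show "h (w b c) = \<ominus>\<^bsub>S\<^esub> h (w c b)" unfolding W(3) using W(4) by simp
      qed
      show "(\<Oplus>\<^bsub>S\<^esub>s\<in>{..<n}. f s \<otimes>\<^bsub>S\<^esub> h (p s b)) = S.dot d (\<lambda>c. h (w b c)) (\<lambda>c. h (x c))" if b: "b < d" for b
      proof -
        have hp: "(\<lambda>s. h (p s b)) \<in> {..<n} \<rightarrow> carrier S" using pc[OF b] by auto
        have qg: "q b \<in> carrier R" "g b \<in> carrier R" "g b \<in> A" using qc gc g(1) b by auto
        have "(\<Oplus>\<^bsub>S\<^esub>s\<in>{..<n}. f s \<otimes>\<^bsub>S\<^esub> h (p s b)) = S.dot n (\<lambda>s. h (p s b)) f"
          using S.dot_commute[OF f(1) hp] by (simp add: S.dot_def)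
        also have "\<dots> = h (q b)" unfolding q_def using hom_dot_ft[OF pc[OF b]] by simp
        also have "\<dots> = h (q b) \<ominus>\<^bsub>S\<^esub> h (g b)" using ker[OF qg(2)] qg by (simp add: S.minus_eq)
        also have "\<dots> = h (dot d (w b) x)" using hom_minus[OF qg(1,2)] w(2)[OF b] by simp
        also have "\<dots> = S.dot d (\<lambda>c. h (w b c)) (\<lambda>c. h (x c))" by (rule hom_dot[OF wc[OF b] x(1)])
        finally show ?thesis .
      qed
      show "primeideal (h ` N) S" by (rule image_N_prime)
      show "f ` {..<n} \<subseteq> h ` N"
      proof
        fix y assume "y \<in> f ` {..<n}"
        then obtain s where "s < n" "y = f s" by auto
        then have "ft s \<in> N" "y = h (ft s)" using ft JN by auto
        then show "y \<in> h ` N" by blast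
      qed
      have "x ` {..<d} \<subseteq> carrier R" using x(1) by auto
      then have "x ` {..<d} \<subseteq> N" using genideal_self x(2) by blast
      then show "(\<lambda>b. h (x b)) ` {..<d} \<subseteq> h ` N" by blast
      show "k < m" using k by simp
    qed
    then show "a k \<in> N" using hom_in_image_iff[OF ideal_N A_subset_N] a k by auto
  qed
qed

text \<open>The H j are combinations of \<open>ft\<close>, so the ideal generated by
  \<open>ft\<close> and G contains A; and modulo A the elements \<open>ft\<close> generate
  J.\<close>

lemma generators_of_J:
  assumes G: "G ` {..<l} \<subseteq> A" and gen: "Idl (H ` {..<m} \<union> G ` {..<l}) = A"
  shows "Idl (append_family n ft G ` {..<n + l}) = J"
proof -
  let ?X = "ft ` {..<n} \<union> G ` {..<l}"
  have XJ: "?X \<subseteq> J" using ft(1) G AJ by auto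
  have Xc: "?X \<subseteq> carrier R" using XJ ideal.Icarr[OF J] by blast
  have XI: "ideal (Idl ?X) R" by (rule genideal_ideal[OF Xc])
  interpret X: ideal "Idl ?X" R by (rule XI)
  note XX = genideal_self[OF Xc]
  have fX: "ft s \<in> Idl ?X" if "s < n" for s using XX that by auto
  have "H j \<in> Idl ?X" if j: "j < m" for j
    unfolding H_def by (rule dot_in_ideal[OF XI]) (use Zt(1)[OF j] fX in auto)
  then have "H ` {..<m} \<union> G ` {..<l} \<subseteq> Idl ?X" using XX by auto
  then have AX: "A \<subseteq> Idl ?X" using genideal_minimal[OF XI] gen by blast
  have "J \<subseteq> Idl ?X"
  proof
    fix y assume y: "y \<in> J"
    have yc: "y \<in> carrier R" using ideal.Icarr[OF J y] .
    have "h y \<in> Idl\<^bsub>S\<^esub> (f ` {..<n})" using y f(2) by blast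
    then obtain b where b: "b \<in> {..<n} \<rightarrow> carrier S" "h y = S.dot n b f"
      using S.genideal_family[OF f(1)] by blast
    obtain b' where b': "\<And>s. s < n \<Longrightarrow> b' s \<in> carrier R" "\<And>s. s < n \<Longrightarrow> h (b' s) = b s"
      using lift_family[of "\<lambda>s. s < n" b] b(1) by auto
    have b'c: "b' \<in> {..<n} \<rightarrow> carrier R" using b'(1) by auto
    define e where "e = dot n b' ft"
    have ec: "e \<in> carrier R" unfolding e_def by (rule dot_closed[OF b'c ft_closed])
    have "h e = S.dot n (\<lambda>s. h (b' s)) f" unfolding e_def by (rule hom_dot_ft[OF b'c])
    also have "\<dots> = S.dot n b f" by (rule S.dot_cong[OF b'(2) b(1) f(1)])
    finally have "h y = h e" using b(2) by simp
    then have "y \<ominus> e \<in> Idl ?X" using hom_eq_iff[OF yc ec] AX by blast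
    moreover have "e \<in> Idl ?X" unfolding e_def by (rule dot_in_ideal[OF XI b'c fX])
    ultimately have "(y \<ominus> e) \<oplus> e \<in> Idl ?X" using X.a_closed by blast
    moreover have "(y \<ominus> e) \<oplus> e = y" using yc ec by algebra
    ultimately show "y \<in> Idl ?X" by simp
  qed
  moreover have "Idl ?X \<subseteq> J" by (rule genideal_minimal[OF J XJ])
  ultimately show ?thesis by (simp add: append_family_image subset_antisym)
qed

text \<open>Since G lies in A, the first n coefficients are a relation of f modulo A; hence they are
  in N and, up to A, a combination of the basis cycles plus a Koszul relation. Pairing with
  \<open>ft\<close> turns \<open>dot n c ft\<close> into a combination of the H j up to A N. The
  whole relation becomes one between H and G modulo N A, and independence puts the last l
  coefficients into N.\<close>

lemma syzygy_of_J_generators: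
  assumes G: "G \<in> {..<l} \<rightarrow> A" and ind: "independent_family A (m + l) (append_family m H G)"
    and c: "c \<in> {..<n + l} \<rightarrow> carrier R" "dot (n + l) c (append_family n ft G) = \<zero>"
  shows "c \<in> {..<n + l} \<rightarrow> N"
proof -
  interpret A: ideal A R by (rule A)
  have Gc: "G \<in> {..<l} \<rightarrow> carrier R" using G A.Icarr by (auto simp: Pi_iff)
  define e where "e i = c (n + i)" for i
  have ec: "e \<in> {..<l} \<rightarrow> carrier R" and cc: "c \<in> {..<n} \<rightarrow> carrier R" using c(1) by (auto simp: e_def)
  define P where "P = dot n c ft"
  define Q where "Q = dot l e G"
  have PQc: "P \<in> carrier R" "Q \<in> carrier R"
    unfolding P_def Q_def using dot_closed[OF cc ft_closed] dot_closed[OF ec Gc] .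
  have PQ: "P \<oplus> Q = \<zero>"
    using c(2) dot_append[OF c(1) ft_closed Gc] unfolding P_def Q_def e_def[abs_def] by simp
  have QA: "Q \<in> A" unfolding Q_def by (rule dot_in_ideal[OF A ec]) (use G in auto)
  have "P = \<ominus> Q" using sum_zero_eq_neg[OF PQc PQ] .
  then have PA: "P \<in> A" using QA A.a_inv_closed by simp
  then have z: "S.dot n (\<lambda>s. h (c s)) f = \<zero>\<^bsub>S\<^esub>"
    using hom_dot_ft[OF cc] ker[OF PQc(1)] by (simp add: P_def)
  have cN: "\<And>s. s < n \<Longrightarrow> c s \<in> N" using syzygy_in_N[OF cc z] .
  have hc: "(\<lambda>s. h (c s)) \<in> {..<n} \<rightarrow> carrier S" using cc by auto
  obtain \<alpha> w where \<alpha>: "\<alpha> \<in> {..<m} \<rightarrow> carrier S" and w: "S.alternating {..<n} w"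
    and hcs: "\<And>s. s < n \<Longrightarrow> h (c s) = (\<Oplus>\<^bsub>S\<^esub>j\<in>{..<m}. \<alpha> j \<otimes>\<^bsub>S\<^esub> Z j s) \<oplus>\<^bsub>S\<^esub> S.dot n (w s) f"
    using free hc z unfolding S.free_H1_def by blast
  obtain a where a: "\<And>j. j < m \<Longrightarrow> a j \<in> carrier R" "\<And>j. j < m \<Longrightarrow> h (a j) = \<alpha> j"
    using lift_family[of "\<lambda>j. j < m" \<alpha>] \<alpha> by auto
  have ac: "a \<in> {..<m} \<rightarrow> carrier R" using a(1) by auto
  obtain v where v: "alternating {..<n} v" "\<And>s t. s < n \<Longrightarrow> t < n \<Longrightarrow> h (v s t) = w s t"
    by (rule lift_alternating[OF w]) blast
  have vc: "v s \<in> {..<n} \<rightarrow> carrier R" if "s < n" for s using alternatingD(1)[OF v(1)] that by auto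
  have wc: "w s \<in> {..<n} \<rightarrow> carrier S" if "s < n" for s using S.alternatingD(1)[OF w] that by auto
  define r where "r s = dot m a (\<lambda>j. Zt j s)" for s
  define y where "y s = dot n (v s) ft" for s
  have rc: "r \<in> {..<n} \<rightarrow> carrier R" unfolding r_def using ac Zt(1) by (auto intro!: dot_closed)
  have yc: "y \<in> {..<n} \<rightarrow> carrier R" unfolding y_def using vc ft_closed by (auto intro!: dot_closed)
  have ryc: "(\<lambda>s. r s \<oplus> y s) \<in> {..<n} \<rightarrow> carrier R" using rc yc by auto
  have diff: "c s \<ominus> (r s \<oplus> y s) \<in> A" if s: "s < n" for s
  proof -
    have sc: "c s \<in> carrier R" "r s \<in> carrier R" "y s \<in> carrier R" using cc rc yc s by auto
    have "h (r s) = (\<Oplus>\<^bsub>S\<^esub>j\<in>{..<m}. h (a j) \<otimes>\<^bsub>S\<^esub> Z j s)" unfolding r_def by (rule hom_dot_Zt[OF ac s])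
    also have "\<dots> = (\<Oplus>\<^bsub>S\<^esub>j\<in>{..<m}. \<alpha> j \<otimes>\<^bsub>S\<^esub> Z j s)"
    proof (rule S.finsum_cong')
      show "(\<lambda>j. \<alpha> j \<otimes>\<^bsub>S\<^esub> Z j s) \<in> {..<m} \<rightarrow> carrier S"
        using \<alpha> free s unfolding S.free_H1_def by (auto simp: Pi_iff)
    qed (use a(2) in auto)
    finally have 1: "h (r s) = (\<Oplus>\<^bsub>S\<^esub>j\<in>{..<m}. \<alpha> j \<otimes>\<^bsub>S\<^esub> Z j s)" .
    have "h (y s) = S.dot n (\<lambda>t. h (v s t)) f" unfolding y_def by (rule hom_dot_ft[OF vc[OF s]])
    also have "\<dots> = S.dot n (w s) f" by (rule S.dot_cong[OF v(2)[OF s] wc[OF s] f(1)])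
    finally have "h (c s) = h (r s \<oplus> y s)" using hcs[OF s] 1 sc by simp
    then show ?thesis using hom_eq_iff[of "c s" "r s \<oplus> y s"] sc by simp
  qed
  define D where "D = dot n (\<lambda>s. c s \<ominus> (r s \<oplus> y s)) ft"
  define E where "E = dot m a H"
  have Ec: "E \<in> carrier R" unfolding E_def by (rule dot_closed[OF ac H_closed])
  have "dot n r ft = E"
    unfolding r_def E_def using dot_dot_swap[OF ac ft_closed Zt(1)] by (simp add: H_def[abs_def])
  moreover have "dot n y ft = \<zero>" unfolding y_def by (rule alternating_dot_zero[OF v(1) ft_closed])
  ultimately have "D = P \<ominus> E"
    unfolding D_def P_def using dot_minus[OF cc ryc ft_closed] dot_add[OF rc yc ft_closed] Ec by simp
  moreover have "D \<in> A \<cdot>\<^bsub>R\<^esub> N"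
    unfolding D_def by (rule dot_in_ideal_prod[OF A ideal_N diff]) (use ft(1) JN in auto)
  ultimately have DN: "P \<ominus> E \<in> N \<cdot>\<^bsub>R\<^esub> A" using ideal_prod_commute[OF A ideal_N] by simp
  have NAI: "ideal (N \<cdot>\<^bsub>R\<^esub> A) R" by (rule ideal_prod_is_ideal[OF ideal_N A])
  have "\<ominus> (P \<ominus> E) \<in> N \<cdot>\<^bsub>R\<^esub> A"
    using additive_subgroup.a_inv_closed[OF ideal.axioms(1)[OF NAI] DN] .
  moreover have "\<ominus> (P \<ominus> E) = E \<oplus> Q"
  proof -
    have "\<ominus> (\<ominus> Q \<ominus> E) = E \<oplus> Q" using PQc Ec by (simp add: minus_eq minus_add a_comm)
    then show ?thesis using \<open>P = \<ominus> Q\<close> by simp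
  qed
  ultimately have EQ: "E \<oplus> Q \<in> N \<cdot>\<^bsub>R\<^esub> A" by simp
  define b where "b = append_family m a e"
  have bc: "b \<in> {..<m + l} \<rightarrow> carrier R" unfolding b_def by (rule append_family_closed[OF ac ec])
  have "dot m b H = E"
    unfolding E_def by (rule dot_cong[OF _ ac H_closed]) (simp add: b_def append_family_def)
  moreover have "(\<lambda>i. b (m + i)) = e" by (simp add: b_def append_family_def)
  ultimately have "dot (m + l) b (append_family m H G) = E \<oplus> Q"
    using dot_append[OF bc H_closed Gc] by (simp add: Q_def)
  then have bN: "b \<in> {..<m + l} \<rightarrow> N"
    using ind bc EQ unfolding independent_family_def by simp
  have eN: "e i \<in> N" if "i < l" for i
  proof -
    have "b (m + i) \<in> N" using bN that by auto
    then show ?thesis by (simp add: b_def append_family_def)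
  qed
  show ?thesis
  proof
    fix i assume i: "i \<in> {..<n + l}"
    show "c i \<in> N"
    proof (cases "i < n")
      case False
      then have "i = n + (i - n)" "i - n < l" using i by auto
      then show ?thesis using eN[of "i - n"] by (simp add: e_def)
    qed (rule cN)
  qed
qed

text \<open>By independence the H j can be exchanged into a minimal generating family of A. The
  elements G that remain, together with \<open>ft\<close>, generate J minimally.\<close>

lemma num_gens_J: "m \<le> num_gens R A" "num_gens R J = n + (num_gens R A - m)"
proof -
  obtain G0 where G0: "G0 \<in> {..<num_gens R A} \<rightarrow> carrier R" "Idl (G0 ` {..<num_gens R A}) = A"
    by (rule minimal_generating_family[OF A])
  obtain l G where l: "num_gens R A = m + l" and G: "G ` {..<l} \<subseteq> G0 ` {..<num_gens R A}"
    and gen: "Idl (H ` {..<m} \<union> G ` {..<l}) = A"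
    using exchange[OF A H_independent G0] by blast
  have "G0 ` {..<num_gens R A} \<subseteq> carrier R" using G0(1) by auto
  then have "G0 ` {..<num_gens R A} \<subseteq> A" using genideal_self G0(2) by blast
  then have GA: "G ` {..<l} \<subseteq> A" using G by blast
  then have GA': "G \<in> {..<l} \<rightarrow> A" by auto
  then have Gc: "G \<in> {..<l} \<rightarrow> carrier R" using ideal.Icarr[OF A] by (auto simp: Pi_iff)
  have K: "append_family m H G \<in> {..<m + l} \<rightarrow> carrier R" by (rule append_family_closed[OF H_closed Gc])
  have Kgen: "Idl (append_family m H G ` {..<m + l}) = A" using gen by (simp add: append_family_image)
  have ind: "independent_family A (m + l) (append_family m H G)"
    by (rule independent_if_syzygies_in_N[OF A K Kgen])
      (rule minimal_generators_syzygy[OF K Kgen l[symmetric]])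
  have "num_gens R J = n + l"
    by (rule num_gens_eqI[OF J append_family_closed[OF ft_closed Gc] generators_of_J[OF GA gen]])
      (rule syzygy_of_J_generators[OF GA' ind])
  then show "m \<le> num_gens R A" "num_gens R J = n + (num_gens R A - m)" using l by auto
qed

end

section \<open>From the Krull dimension to the theorem\<close>

lemma (in noetherian_local_ring) regular_local_koszul:
  assumes reg: "regular_local_ring R N" and x: "x \<in> {..<num_gens R N} \<rightarrow> carrier R" "Idl (x ` {..<num_gens R N}) = N"
    and c: "c \<in> {..<num_gens R N} \<rightarrow> carrier R" "dot (num_gens R N) c x = \<zero>"
  shows "\<exists>w. alternating {..<num_gens R N} w \<and> (\<forall>i<num_gens R N. c i = dot (num_gens R N) (w i) x)"
proof -
  define d where "d = num_gens R N"
  have kd: "krull_dim R = enat d" using reg by (simp add: regular_local_ring_def d_def)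
  \<comment> \<open>The dimension is a supremum and has to be shown to be attained. If all chains
    had at most d members, it would be at most d - 1; the chain consisting of N alone excludes d =
    0, where this subtraction would be truncated.\<close>
  have ps0: "\<exists>ps. prime_chain ps \<and> d < length ps"
  proof (rule ccontr)
    assume n: "\<not> ?thesis"
    have "prime_chain [N]" using prime_N by (simp add: prime_chain_def)
    then have d0: "d > 0" using n by (metis One_nat_def length_Cons list.size(3) not_gr_zero zero_less_one)
    have "krull_dim R \<le> enat (d - 1)"
      unfolding krull_dim_def
    proof (rule SUP_least)
      fix ps assume "ps \<in> {ps. ps \<noteq> [] \<and> (\<forall>P \<in> set ps. primeideal P R) \<and> sorted_wrt (\<subset>) ps}"
      then have "prime_chain ps" by (simp add: prime_chain_def)
      then have "length ps \<le> d" using n by (meson not_le)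
      then show "enat (length ps - 1) \<le> enat (d - 1)" by simp
    qed
    then show False using kd d0 by simp
  qed
  then obtain ps where ps: "prime_chain ps" "d < length ps" by blast
  have xc: "x ` {..<d} \<subseteq> carrier R" and xN: "N = Idl ({} \<union> x ` {..<d})" using x unfolding d_def by auto
  have "length ps \<le> Suc (card {..<d})"
    by (rule prime_chain_length_le[OF _ _ xc xN ps(1)]) auto
  then have len: "length ps = Suc (card {..<d})" using ps(2) by simp
  \<comment> \<open>Taken with B empty: membership in \<open>Idl {}\<close> means being zero, so the
    relations hold exactly.\<close>
  have "primeideal (Idl {}) R \<and>
    (\<forall>c. (\<forall>i\<in>{..<d}. c i \<in> carrier R) \<longrightarrow> (\<Oplus>i\<in>{..<d}. c i \<otimes> x i) \<in> Idl {} \<longrightarrow>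
      (\<exists>w. alternating {..<d} w \<and> (\<forall>i\<in>{..<d}. c i \<ominus> (\<Oplus>j\<in>{..<d}. w i j \<otimes> x j) \<in> Idl {})))"
    by (rule regular_parameters[OF _ _ xc xN ps(1) len]) auto
  moreover have "\<forall>i\<in>{..<d}. c i \<in> carrier R" "(\<Oplus>i\<in>{..<d}. c i \<otimes> x i) \<in> Idl {}"
    using c unfolding d_def dot_def genideal_empty by auto
  ultimately obtain w where w: "alternating {..<d} w"
    "\<forall>i\<in>{..<d}. c i \<ominus> (\<Oplus>j\<in>{..<d}. w i j \<otimes> x j) \<in> Idl {}" by blast
  have "c i = dot d (w i) x" if i: "i < d" for i
  proof -
    have wi: "w i \<in> {..<d} \<rightarrow> carrier R" using alternatingD(1)[OF w(1)] i by auto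
    have xd: "x \<in> {..<d} \<rightarrow> carrier R" using x(1) unfolding d_def .
    have dc: "dot d (w i) x \<in> carrier R" by (rule dot_closed[OF wi xd])
    have ci: "c i \<in> carrier R" using c(1) i unfolding d_def by auto
    have "c i \<ominus> dot d (w i) x = \<zero>" using w(2) i unfolding genideal_empty dot_def by auto
    moreover have "c i = (c i \<ominus> dot d (w i) x) \<oplus> dot d (w i) x"
    proof -
      show ?thesis using minus_add_cancel[OF ci dc] by simp
    qed
    ultimately show ?thesis using dc by simp
  qed
  then show ?thesis using w(1) unfolding d_def by blast
qed

theorem theorem1p8:
  fixes Q :: "('a, 'b) ring_scheme" and N A J :: "'a set"
  assumes "regular_local_ring Q N"
    and "ideal A Q" and "A \<subseteq> ideal_prod Q N N"
    and "ideal J Q" and "A \<subseteq> J" and "J \<subseteq> N"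
    and "qci_ideal (Q Quot A) ((\<lambda>x. A +>\<^bsub>Q\<^esub> x) ` J)"
  shows "enat (num_gens Q J) = enat (num_gens Q A) + grade (Q Quot A) ((\<lambda>x. A +>\<^bsub>Q\<^esub> x) ` J)"
proof -
  let ?S = "Q Quot A" and ?h = "\<lambda>x. A +>\<^bsub>Q\<^esub> x"
  have Q: "noetherian_ring Q" "cring Q" "maximalideal N Q" "\<And>M. maximalideal M Q \<Longrightarrow> M = N"
    using assms(1) by (auto simp: regular_local_ring_def local_ring_with_def)
  interpret noetherian_local_ring Q N
    using Q by (intro noetherian_local_ring.intro noetherian_cring.intro noetherian_local_ring_axioms.intro)
  have Shom: "ring_hom_cring Q ?S ?h" by (rule ideal.rcos_ring_hom_cring[OF assms(2) is_cring])
  have Snoeth: "noetherian_cring ?S" by (rule quotient_noetherian_cring[OF assms(2)])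
  have AN: "A \<subseteq> N" using assms(5,6) by blast
  interpret L: local_surjection Q N ?S ?h A
  proof (intro local_surjection.intro local_surjection_axioms.intro)
    show "noetherian_local_ring Q N" by (rule noetherian_local_ring_axioms)
    show "\<exists>x\<in>carrier Q. A +>\<^bsub>Q\<^esub> x = y" if "y \<in> carrier ?S" for y
      using that unfolding FactRing_def A_RCOSETS_def' by auto
    show "A +>\<^bsub>Q\<^esub> x = \<zero>\<^bsub>?S\<^esub> \<longleftrightarrow> x \<in> A" if "x \<in> carrier Q" for x
    proof -
      have "x \<ominus>\<^bsub>Q\<^esub> \<zero>\<^bsub>Q\<^esub> \<in> A \<longleftrightarrow> A +>\<^bsub>Q\<^esub> x = A +>\<^bsub>Q\<^esub> \<zero>\<^bsub>Q\<^esub>"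
        by (rule quotient_eq_iff_same_a_r_cos[OF assms(2) that]) simp
      then show ?thesis using ring_hom_cring.hom_zero[OF Shom] that by (simp add: minus_eq)
    qed
  qed (fact Snoeth Shom assms(2) AN)+
  define I where "I = ?h ` J"
  have "\<one>\<^bsub>?S\<^esub> \<notin> I"
    unfolding I_def using L.hom_in_image_iff[OF assms(4,5) one_closed] assms(6)
      primeideal_one_notin[OF prime_N] by (metis L.hom_one subsetD)
  then obtain f m Z where f: "f \<in> {..<num_gens ?S I} \<rightarrow> carrier ?S" "Idl\<^bsub>?S\<^esub> (f ` {..<num_gens ?S I}) = I"
    and free: "L.S.free_H1 (num_gens ?S I) f m Z" and mn: "m \<le> num_gens ?S I"
    and grade: "grade ?S I = enat (num_gens ?S I - m)"
    using L.S.qci_ideal_data[of I] assms(7) unfolding I_def by blast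
  define n where "n = num_gens ?S I"
  obtain x where x: "x \<in> {..<num_gens Q N} \<rightarrow> carrier Q" "Idl\<^bsub>Q\<^esub> (x ` {..<num_gens Q N}) = N"
    by (rule minimal_generating_family[OF ideal_N])
  have "f s \<in> I" if "s < n" for s
    using that f L.S.genideal_self[of "f ` {..<n}"] unfolding n_def by (auto simp: Pi_iff)
  then have "\<forall>s. \<exists>y. s < n \<longrightarrow> y \<in> J \<and> ?h y = f s" unfolding I_def by (metis imageE)
  from choice[OF this] obtain ft where ft: "\<And>s. s < n \<Longrightarrow> ft s \<in> J \<and> ?h (ft s) = f s" by blast
  have "Z j s \<in> carrier ?S" if "j < m" "s < n" for j s
    using free that unfolding L.S.free_H1_def n_def by auto
  \<comment> \<open>Both indices of Z are packed into a pair because \<open>lift_family\<close>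
    lifts families with a single index.\<close>
  then obtain zt where zt: "\<And>p. fst p < m \<and> snd p < n \<Longrightarrow> zt p \<in> carrier Q"
    "\<And>p. fst p < m \<and> snd p < n \<Longrightarrow> ?h (zt p) = Z (fst p) (snd p)"
    using L.lift_family[of "\<lambda>p. fst p < m \<and> snd p < n" "\<lambda>p. Z (fst p) (snd p)"] by auto
  interpret K: koszul_lift Q N ?S ?h A "num_gens Q N" n m x f J Z ft "\<lambda>j s. zt (j, s)"
  proof (intro koszul_lift.intro koszul_lift_axioms.intro)
    show "local_surjection Q N ?S ?h A" by (rule L.local_surjection_axioms)
    show "\<And>c. c \<in> {..<num_gens Q N} \<rightarrow> carrier Q \<Longrightarrow> dot (num_gens Q N) c x = \<zero>\<^bsub>Q\<^esub> \<Longrightarrow>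
      \<exists>w. alternating {..<num_gens Q N} w \<and> (\<forall>i<num_gens Q N. c i = dot (num_gens Q N) (w i) x)"
      by (rule regular_local_koszul[OF assms(1) x])
  qed (use assms(4-6) x f free ft zt in \<open>auto simp: n_def I_def\<close>)
  \<comment> \<open>The differences are of natural numbers; m is at most n and at most
    \<open>num_gens Q A\<close>, so n + (\<open>num_gens Q A\<close> - m) may be regrouped.\<close>
  have "num_gens Q J = num_gens Q A + (n - m)"
    using K.num_gens_J mn by (simp add: n_def)
  then show ?thesis using grade unfolding I_def n_def by simp
qed

end
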